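(* Let $f:\mathbb{R}\to\mathbb{R}$ be a $C^2$ strictly convex function with $\lim_{|u|\to\infty} f(u)/|u|=\infty$ and let $\alpha\in L^\infty([0,\infty);\mathbb{R})$. Let $u_0\in L^1([0,\infty))\cap L^\infty([0,\infty))$ and $u_b\in BV([0,\infty))$. Let $u,v\in L^\infty\cap BV_{loc}$ be two weak solutions (in the sense defined in the context) of $$u_t+f(u)_x=\alpha(t)u\quad (x>0,\ t>0),\qquad u(x,0)=u_0(x),\qquad u(0,t)=u_b(t),$$ with the same initial and boundary data $u_0$, $u_b$, both satisfying the Lax entropy condition stated in the context. Assume moreover that $u$ and $v$ are $C^1$ except on a discrete set of Lipschitz curves. Then $u\equiv v$.
   Context: $\lambda_f$ is the point where $f'$ changes sign and $\bar u_b(t)=\max\{u_b(t),\lambda_f\}$. Weak solution. $u$ is a weak solution if $t\mapsto u(\cdot,t)\in C([0,T];L^1_{loc}(0,\infty))$, the identity $$\int_0^\infty\!\!\int_0^\infty \big(u\varphi_t+f(u)\varphi_x+\alpha(t)u\varphi\big)\,dx\,dt+\int_0^\infty u_0(x)\varphi(x,0)\,dx=0$$ holds for all $\varphi\in C_c^\infty((0,\infty)\times[0,\infty))$, $u(\cdot,t)\in BV(\mathbb{R}^+,\mathbb{R})$ for any fixed $t>0$, and for almost every $t>0$ the following boundary condition holds: either $u(0+,t)=\bar u_b(t)$, or both $f'(u(0+,t))\le0$ and $f(u(0+,t))\ge f(\bar u_b(t))$. Lax entropy condition. At (almost every) point of discontinuity $(x,t)$, $x>0$, $t>0$, of $u$,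 lying on the discontinuity curve $x=X(t)$ with $X$ differentiable at $t$, one has $$f'(u(x-,t))>\dot X(t)>f'(u(x+,t)).$$ *)

theory Defs
  imports "HOL-Analysis.Analysis"
begin

text \<open>
  Functions of \<open>(x, t)\<close> are curried, \<open>u x t\<close>, and \<open>L\<^sup>\<infinity>\<close> functions are represented by
  actual functions. A function of bounded variation is a representative with finite pointwise
  variation, so that its one-sided limits exist in the ordinary sense.
\<close>

definition quadrant :: "(real \<times> real) set" where
  "quadrant = {0<..} \<times> {0<..}"

definition strictly_convex :: "(real \<Rightarrow> real) \<Rightarrow> bool" where
  "strictly_convex f \<longleftrightarrow>
    (\<forall>x y s. x \<noteq> y \<longrightarrow> 0 < s \<longrightarrow> s < 1 \<longrightarrow>
      f ((1 - s) * x + s * y) < (1 - s) * f x + s * f y)"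

definition sign_change_point :: "(real \<Rightarrow> real) \<Rightarrow> real" where
  "sign_change_point f =
    (THE l. (\<forall>w<l. deriv f w < 0) \<and> (\<forall>w>l. 0 < deriv f w))"

definition Linfty_on :: "'a::euclidean_space set \<Rightarrow> ('a \<Rightarrow> real) \<Rightarrow> bool" where
  "Linfty_on S g \<longleftrightarrow>
    g \<in> borel_measurable (lebesgue_on S) \<and> (\<exists>C. AE x in lebesgue_on S. \<bar>g x\<bar> \<le> C)"

text \<open>Finite total variation; integrability over \<open>S\<close> is not part of the notion.\<close>

definition BV_on :: "real set \<Rightarrow> (real \<Rightarrow> real) \<Rightarrow> bool" where
  "BV_on S g \<longleftrightarrow>
    (\<exists>V. \<forall>(n::nat) p. (\<forall>i\<le>n. p i \<in> S) \<longrightarrow> (\<forall>i<n. p i \<le> p (Suc i)) \<longrightarrow>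
      (\<Sum>i<n. \<bar>g (p (Suc i)) - g (p i)\<bar>) \<le> V)"

text \<open>
  \<open>D i j\<close> is the partial derivative of order \<open>i\<close> in \<open>x\<close> and \<open>j\<close> in \<open>t\<close>. For
  \<open>S = {0<..} \<times> {0..}\<close> the derivatives in \<open>t\<close> at \<open>t = 0\<close> are one-sided, which gives smoothness
  up to the boundary.
\<close>

definition Ck_on :: "enat \<Rightarrow> (real \<times> real) set \<Rightarrow> (real \<Rightarrow> real \<Rightarrow> real) \<Rightarrow> bool" where
  "Ck_on k S g \<longleftrightarrow>
    (\<exists>D :: nat \<Rightarrow> nat \<Rightarrow> real \<Rightarrow> real \<Rightarrow> real.
      (\<forall>(x, t)\<in>S. D 0 0 x t = g x t) \<and>
      (\<forall>i j. enat (i + j) \<le> k \<longrightarrow> continuous_on S (\<lambda>(x, t). D i j x t)) \<and>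
      (\<forall>i j. enat (i + j) < k \<longrightarrow>
        (\<forall>(x, t)\<in>S.
          ((\<lambda>y. D i j y t) has_real_derivative D (Suc i) j x t) (at x within {y. (y, t) \<in> S}) \<and>
          ((\<lambda>s. D i j x s) has_real_derivative D i (Suc j) x t) (at t within {s. (x, s) \<in> S}))))"

definition vanishes_off :: "(real \<times> real) set \<Rightarrow> (real \<times> real) set \<Rightarrow> (real \<Rightarrow> real \<Rightarrow> real) \<Rightarrow> bool" where
  "vanishes_off K S g \<longleftrightarrow> (\<forall>(x, t)\<in>S - K. g x t = 0)"

definition test_function :: "(real \<Rightarrow> real \<Rightarrow> real) \<Rightarrow> bool" where
  "test_function \<phi> \<longleftrightarrow>
    Ck_on \<infinity> ({0<..} \<times> {0..}) \<phi> \<and>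
    (\<exists>K. compact K \<and> K \<subseteq> {0<..} \<times> {0..} \<and> vanishes_off K ({0<..} \<times> {0..}) \<phi>)"

text \<open>
  \<open>BV\<^sub>l\<^sub>o\<^sub>c\<close> of the open quadrant in the two-dimensional, distributional sense: the variation
  (the supremum of the integrals of \<open>w\<close> against divergences of \<open>C\<^sup>1\<close> fields of norm at most
  one) is finite on compact subsets.
\<close>

definition BV_loc :: "(real \<Rightarrow> real \<Rightarrow> real) \<Rightarrow> bool" where
  "BV_loc w \<longleftrightarrow>
    (\<forall>K. compact K \<longrightarrow> K \<subseteq> quadrant \<longrightarrow>
      set_integrable lebesgue K (\<lambda>(x, t). w x t) \<and>
      (\<exists>C. \<forall>\<psi>1 \<psi>2.
        Ck_on 1 quadrant \<psi>1 \<longrightarrow> Ck_on 1 quadrant \<psi>2 \<longrightarrow>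
        vanishes_off K quadrant \<psi>1 \<longrightarrow> vanishes_off K quadrant \<psi>2 \<longrightarrow>
        (\<forall>(x, t)\<in>quadrant. (\<psi>1 x t)\<^sup>2 + (\<psi>2 x t)\<^sup>2 \<le> 1) \<longrightarrow>
        (LINT p:quadrant|lebesgue.
          (case p of (x, t) \<Rightarrow>
            w x t * (deriv (\<lambda>y. \<psi>1 y t) x + deriv (\<lambda>s. \<psi>2 x s) t))) \<le> C))"

definition trace_left :: "(real \<Rightarrow> real \<Rightarrow> real) \<Rightarrow> real \<Rightarrow> real \<Rightarrow> real" where
  "trace_left u x t = Lim (at_left x) (\<lambda>y. u y t)"

definition trace_right :: "(real \<Rightarrow> real \<Rightarrow> real) \<Rightarrow> real \<Rightarrow> real \<Rightarrow> real" where
  "trace_right u x t = Lim (at_right x) (\<lambda>y. u y t)"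

definition continuous_into_L1loc :: "(real \<Rightarrow> real \<Rightarrow> real) \<Rightarrow> bool" where
  "continuous_into_L1loc u \<longleftrightarrow>
    (\<forall>T>0. \<forall>K. compact K \<longrightarrow> K \<subseteq> {0<..} \<longrightarrow>
      (\<forall>t\<in>{0..T}. set_integrable lebesgue K (\<lambda>x. u x t) \<and>
        ((\<lambda>s. LINT x:K|lebesgue. \<bar>u x s - u x t\<bar>) \<longlongrightarrow> 0) (at t within {0..T})))"

definition boundary_condition ::
    "(real \<Rightarrow> real) \<Rightarrow> (real \<Rightarrow> real) \<Rightarrow> (real \<Rightarrow> real \<Rightarrow> real) \<Rightarrow> real \<Rightarrow> bool" where
  "boundary_condition f u\<^sub>b u t \<longleftrightarrow>
    (let w = trace_right u 0 t; b = max (u\<^sub>b t) (sign_change_point f)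
     in w = b \<or> (deriv f w \<le> 0 \<and> f w \<ge> f b))"

definition weak_solution ::
    "(real \<Rightarrow> real) \<Rightarrow> (real \<Rightarrow> real) \<Rightarrow> (real \<Rightarrow> real) \<Rightarrow> (real \<Rightarrow> real) \<Rightarrow>
     (real \<Rightarrow> real \<Rightarrow> real) \<Rightarrow> bool" where
  "weak_solution f \<alpha> u\<^sub>0 u\<^sub>b u \<longleftrightarrow>
    continuous_into_L1loc u \<and>
    (\<forall>\<phi>. test_function \<phi> \<longrightarrow>
      (LINT t:{0<..}|lebesgue. LINT x:{0<..}|lebesgue.
         u x t * deriv (\<lambda>s. \<phi> x s) t + f (u x t) * deriv (\<lambda>y. \<phi> y t) x
         + \<alpha> t * u x t * \<phi> x t)
      + (LINT x:{0<..}|lebesgue. u\<^sub>0 x * \<phi> x 0) = 0) \<and>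
    (\<forall>t>0. BV_on {0<..} (\<lambda>x. u x t)) \<and>
    (AE t in lebesgue_on {0<..}. boundary_condition f u\<^sub>b u t)"

text \<open>
  The points of discontinuity are the jumps \<open>u(x-,t) \<noteq> u(x+,t)\<close>; where the two limits agree the
  inequalities below contradict each other. ``Almost every point'' is almost every \<open>t\<close> along each
  curve \<open>x = X(t)\<close>. All Lipschitz \<open>X\<close> are admitted: two Lipschitz functions have the same
  derivative almost everywhere on the set where they coincide, so only the part of the curve
  that runs through jumps matters.
\<close>

definition Lax_entropy :: "(real \<Rightarrow> real) \<Rightarrow> (real \<Rightarrow> real \<Rightarrow> real) \<Rightarrow> bool" where
  "Lax_entropy f u \<longleftrightarrow>
    (\<forall>X L a b. 0 \<le> a \<longrightarrow> a < b \<longrightarrow> L-lipschitz_on {a<..<b} X \<longrightarrow> (\<forall>t\<in>{a<..<b}. 0 < X t) \<longrightarrow>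
      (AE t in lebesgue_on {a<..<b}.
        trace_left u (X t) t \<noteq> trace_right u (X t) t \<longrightarrow>
        X differentiable (at t) \<and>
        deriv f (trace_left u (X t) t) > deriv X t \<and>
        deriv X t > deriv f (trace_right u (X t) t)))"

text \<open>
  A discrete set of curves is a family that is locally finite in the open quadrant. The curves
  are compact arcs, possibly reaching the boundary of the quadrant; a closed unbounded curve is a
  locally finite union of such arcs.
\<close>

definition C1_off_Lipschitz_curves :: "(real \<Rightarrow> real \<Rightarrow> real) \<Rightarrow> bool" where
  "C1_off_Lipschitz_curves u \<longleftrightarrow>
    (\<exists>\<C>. (\<forall>C\<in>\<C>. \<exists>L \<gamma>. L-lipschitz_on {0..1} \<gamma> \<and> C = path_image \<gamma> \<inter> quadrant) \<and>
      locally_finite_in (top_of_set quadrant) \<C> \<and>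
      Ck_on 1 (quadrant - \<Union>\<C>) u)"

end

theory Submission
  imports Defs
begin

text \<open>
  With the integrating factor \<open>w(t) = exp (-\<integral>\<^sub>0\<^sup>t \<alpha>)\<close>, a weak solution \<open>u\<close> has a Lipschitz potential \<open>U\<close> with
  \<open>U\<^sub>x = w u\<close> and \<open>U\<^sub>t = - w f(u)\<close>, so the conservation law becomes a Hamilton-Jacobi equation and
  uniqueness follows from a maximum principle for \<open>U - V\<close>. Along every Lipschitz curve \<open>x = X(t)\<close> and
  for almost every \<open>t\<close>, \<open>d/dt U(X(t), t) = w (u X' - f(u))\<close> holds with \<open>u\<close> either one-sided trace; this is
  the only form of the Rankine-Hugoniot condition that is needed. By Sard's argument the
  discontinuities lie, for almost every \<open>t\<close>, on countably many Lipschitz graphs, on which the Lax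
  condition makes all jumps decreasing. At a maximum point of \<open>U - V\<close> in \<open>x\<close>, the jump of \<open>v\<close> is therefore
  nested in that of \<open>u\<close>, and convexity of \<open>f\<close> shows that the maximum does not grow. A maximum at \<open>x = 0\<close> is
  controlled by the boundary condition, and one at the moving right end of the domain by finite
  speed of propagation.
\<close>

section \<open>One-dimensional real analysis\<close>

text \<open>The obstacle is that the point where \<open>U - V\<close> is maximal in x depends on t,
  while the derivative of a potential along a prescribed curve exists only for almost every t. One
  null set of times has to serve all candidates. Countably many curves are therefore singled out,
  namely the graphs carrying the discontinuities and the two ends of the domain; at every other
  point the traces are continuous in t and the derivative in t exists without exception
  (\<open>deriv_at_continuity_point\<close>). The differentiation looks backwards in time: a curve
  through the maximum point at time t supplies a competitor at earlier times, so it bounds the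
  increase of the maximum. The right end moves inwards at speed \<kappa>, a Lipschitz constant of f
  on the range [-C, C] of the solutions, which no wave can exceed. The comparison is one-sided: U <=
  V uses the Lax condition through v+ <= v-, and exchanging the two solutions gives
  equality.\<close>

lemma emeasure_interval_measure_le_lborel:
  fixes F G :: "real \<Rightarrow> real"
  assumes F: "mono F" "continuous_on UNIV F" and G: "mono G" "continuous_on UNIV G"
    and sum: "\<And>t. F t + G t = t"
  shows "emeasure (interval_measure F) A \<le> emeasure lborel A"
proof -
  have cF: "continuous (at_right a) F" and cG: "continuous (at_right a) G" for a
    using F(2) G(2) by (simp_all add: continuous_on_eq_continuous_at continuous_at_imp_continuous_at_within)
  have mF: "F x \<le> F y" and mG: "G x \<le> G y" if "x \<le> y" for x y
    using F(1) G(1) that by (auto dest: monoD)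
  \<comment> \<open>F + G is the identity, so the Stieltjes measures of F and G add up to Lebesgue
    measure; each summand is then dominated by it.\<close>
  let ?\<mu> = "\<lambda>A. emeasure (interval_measure F) A + emeasure (interval_measure G) A"
  define M where "M = measure_of UNIV (sets borel) ?\<mu>"
  have M_sets: "sets M = sets borel"
    unfolding M_def using sets.sigma_sets_eq[of borel] by (simp add: sets_measure_of_conv)
  have em: "emeasure M A = ?\<mu> A" if "A \<in> sets borel" for A
  proof (rule emeasure_measure_of[OF M_def])
    show "countably_additive (sets M) ?\<mu>"
    proof (rule countably_additiveI)
      fix B :: "nat \<Rightarrow> real set"
      assume B: "range B \<subseteq> sets M" "disjoint_family B"
      show "(\<Sum>i. ?\<mu> (B i)) = ?\<mu> (\<Union> (range B))"
        using B M_sets by (simp add: suminf_add[symmetric] suminf_emeasure)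
    qed
  qed (use that M_sets in \<open>auto simp: positive_def\<close>)
  have "M = lborel"
  proof (rule measure_eqI_generator_eq[where E="range (\<lambda>(a::real, b). {a<..b})" and \<Omega>=UNIV and A="\<lambda>n. {- real n<..real n}"])
    show "Int_stable (range (\<lambda>(a::real, b). {a<..b}))"
      by (auto simp: Int_stable_def)
    show "emeasure M X = emeasure lborel X" if X_in: "X \<in> range (\<lambda>(a, b). {a<..b})" for X
    proof -
      obtain a b where X: "X = {a<..b}" using X_in by auto
      show ?thesis
      proof (cases "a \<le> b")
        case True
        have "F b - F a + (G b - G a) = b - a" using sum[of a] sum[of b] by simp
        moreover have "emeasure M X = ennreal (F b - F a) + ennreal (G b - G a)"
          unfolding X using True mF mG cF cG by (simp add: em emeasure_interval_measure_Ioc)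
        ultimately show ?thesis
          using True mF[of a b] mG[of a b] X by (simp flip: ennreal_plus)
      qed (simp add: X)
    qed
    show "sets M = sigma_sets UNIV (range (\<lambda>(a::real, b). {a<..b}))"
      by (simp add: M_sets borel_sigma_sets_Ioc)
    show "sets lborel = sigma_sets UNIV (range (\<lambda>(a::real, b). {a<..b}))"
      by (simp add: borel_sigma_sets_Ioc)
    show "(\<Union>i::nat. {- real i<..real i}) = UNIV"
    proof -
      have "\<exists>i::nat. - real i < x \<and> x \<le> real i" for x :: real
        using reals_Archimedean2[of "\<bar>x\<bar>"] by (metis abs_less_iff less_imp_le minus_less_iff)
      then show ?thesis by auto
    qed
    show "emeasure M {- real i<..real i} \<noteq> \<infinity>" for i
      using mF mG cF cG by (simp add: em emeasure_interval_measure_Ioc)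
  qed auto
  show ?thesis
  proof (cases "A \<in> sets borel")
    case True
    then show ?thesis using em[OF True] \<open>M = lborel\<close> by (simp add: add_increasing2)
  next
    case False
    then have "emeasure (interval_measure F) A = 0" by (simp add: emeasure_notin_sets)
    then show ?thesis by simp
  qed
qed

text \<open>By the domination above, the Stieltjes measure of F is absolutely continuous, and r is
  its Radon-Nikodym density.\<close>

lemma mono_nonexpansive_integral_rep:
  fixes F :: "real \<Rightarrow> real"
  assumes F: "mono F" and G: "mono (\<lambda>t. t - F t)"
  obtains r where "r \<in> borel_measurable borel" "\<And>t. 0 \<le> r t" "\<And>s t. s \<le> t \<Longrightarrow> (r has_integral (F t - F s)) {s..t}"
proof -
  have bd: "F s \<le> F t" "F t - F s \<le> t - s" if "s \<le> t" for s t
    using monoD[OF F that] monoD[OF G that] by auto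
  have cF: "continuous_on UNIV F"
  proof -
    have "1-lipschitz_on UNIV F"
    proof (rule lipschitz_onI)
      fix x y :: real
      show "dist (F x) (F y) \<le> 1 * dist x y"
        using bd[of x y] bd[of y x] by (cases "x \<le> y") (auto simp: dist_real_def)
    qed simp
    then show ?thesis by (rule lipschitz_on_continuous_on)
  qed
  have le: "emeasure (interval_measure F) A \<le> emeasure lborel A" for A
    by (rule emeasure_interval_measure_le_lborel[where G="\<lambda>t. t - F t"])
       (use F G cF in \<open>auto intro!: continuous_intros\<close>)
  have "absolutely_continuous lborel (interval_measure F)"
    unfolding absolutely_continuous_def using le by (auto simp: null_sets_def) (metis le_zero_eq)
  then obtain h where h: "h \<in> borel_measurable lborel" "density lborel h = interval_measure F"
    using sigma_finite_measure.Radon_Nikodym[OF lborel.sigma_finite_measure_axioms, of "interval_measure F"] by auto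
  have cR: "continuous (at_right a) F" for a
    using cF by (simp add: continuous_on_eq_continuous_at continuous_at_imp_continuous_at_within)
  have nn: "(\<integral>\<^sup>+x. h x * indicator {s<..t} x \<partial>lborel) = ennreal (F t - F s)" if "s \<le> t" for s t
  proof -
    have "(\<integral>\<^sup>+x. h x * indicator {s<..t} x \<partial>lborel) = emeasure (density lborel h) {s<..t}"
      using h(1) by (subst emeasure_density) auto
    then show ?thesis using h(2) that bd cR by (simp add: emeasure_interval_measure_Ioc)
  qed
  \<comment> \<open>The density takes extended values. Its integrals over bounded intervals are
    finite, so it is finite almost everywhere and \<open>enn2real\<close> changes no
    integral.\<close>
  have fin: "AE x in lborel. h x \<noteq> \<infinity>"
  proof -
    have "AE x in lborel. h x * indicator {- real n<..real n} x \<noteq> \<infinity>" for n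
      by (rule nn_integral_PInf_AE) (use h(1) nn[of "- real n" "real n"] in auto)
    then have "AE x in lborel. \<forall>n::nat. h x * indicator {- real n<..real n} x \<noteq> \<infinity>"
      by (simp add: AE_all_countable)
    then show ?thesis
    proof eventually_elim
      case (elim x)
      obtain n where "\<bar>x\<bar> < real n" using reals_Archimedean2 by blast
      then show ?case using elim[rule_format, of n] by (auto simp: indicator_def abs_less_iff split: if_splits)
    qed
  qed
  define r where "r = (\<lambda>x. enn2real (h x))"
  have "r \<in> borel_measurable borel" using h(1) unfolding r_def by simp
  moreover have "(r has_integral (F t - F s)) {s..t}" if "s \<le> t" for s t
  proof -
    have "(\<integral>\<^sup>+x. ennreal (r x * indicator {s<..t} x) \<partial>lborel) = (\<integral>\<^sup>+x. h x * indicator {s<..t} x \<partial>lborel)"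
      by (rule nn_integral_cong_AE)
         (use fin in \<open>eventually_elim, auto simp: r_def indicator_def less_top\<close>)
    then have "((\<lambda>x. r x * indicator {s<..t} x) has_integral (F t - F s)) UNIV"
      using nn[OF that] h(1) bd(1)[OF that]
      by (intro nn_integral_has_integral) (auto simp: r_def)
    then have "(r has_integral (F t - F s)) {s<..t}"
      using has_integral_restrict_UNIV[of "{s<..t}" r] by (simp add: indicator_def of_bool_def if_distrib[of "\<lambda>x. _ * x"] cong: if_cong)
    then show ?thesis
      by (rule has_integral_spike_set_eq[THEN iffD1, rotated 2]) (auto intro: negligible_subset[of "{s}"])
  qed
  ultimately show ?thesis by (intro that[of r]) (auto simp: r_def)
qed

text \<open>Averages over cubes with lower corner t are, in dimension one, averages over intervals
  to the right of t. The estimate is multiplied by the length h, which is the form that the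
  definition of the derivative asks for.\<close>

lemma lebesgue_differentiation_right:
  fixes g :: "real \<Rightarrow> real"
  assumes g: "\<And>a b. g integrable_on {a..b}"
  obtains N where "negligible N"
    "\<And>t e. t \<notin> N \<Longrightarrow> 0 < e \<Longrightarrow> \<exists>d>0. \<forall>h. 0 < h \<and> h < d \<longrightarrow> \<bar>integral {t..t+h} g - h * g t\<bar> \<le> e * h"
proof -
  have "\<And>a b. g integrable_on cbox a b" using g by simp
  from integrable_ccontinuous_explicit[OF this] obtain N where N: "negligible N"
    "\<And>x e. x \<notin> N \<Longrightarrow> 0 < e \<Longrightarrow> \<exists>d>0. \<forall>h. 0 < h \<and> h < d \<longrightarrow>
                         norm (integral (cbox x (x + h *\<^sub>R One)) g /\<^sub>R h ^ DIM(real) - g x) < e" by blast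
  show ?thesis
  proof (rule that[OF N(1)])
    fix t e :: real assume "t \<notin> N" "0 < e"
    from N(2)[OF this] obtain d where d: "d > 0"
      "\<And>h. 0 < h \<Longrightarrow> h < d \<Longrightarrow> \<bar>integral {t..t+h} g / h - g t\<bar> < e"
      by (auto simp: divide_inverse mult.commute)
    have "\<bar>integral {t..t+h} g - h * g t\<bar> \<le> e * h" if "0 < h" "h < d" for h
    proof -
      have "integral {t..t+h} g - h * g t = h * (integral {t..t+h} g / h - g t)"
        using that by (simp add: field_simps)
      then have "\<bar>integral {t..t+h} g - h * g t\<bar> = h * \<bar>integral {t..t+h} g / h - g t\<bar>"
        using that by (simp add: abs_mult)
      also have "\<dots> \<le> h * e" using d(2)[OF that] that by (intro mult_left_mono) auto
      finally show ?thesis by (simp add: mult.commute)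
    qed
    then show "\<exists>d>0. \<forall>h. 0 < h \<and> h < d \<longrightarrow> \<bar>integral {t..t+h} g - h * g t\<bar> \<le> e * h"
      using d(1) by blast
  qed
qed

lemma lebesgue_differentiation_left:
  fixes g :: "real \<Rightarrow> real"
  assumes g: "\<And>a b. g integrable_on {a..b}"
  obtains N where "negligible N"
    "\<And>t e. t \<notin> N \<Longrightarrow> 0 < e \<Longrightarrow> \<exists>d>0. \<forall>h. 0 < h \<and> h < d \<longrightarrow> \<bar>integral {t-h..t} g - h * g t\<bar> \<le> e * h"
proof -
  have "(\<lambda>x. g (- x)) integrable_on {a..b}" for a b
    using g[of "-b" "-a"] Henstock_Kurzweil_Integration.integrable_reflect_real[where f=g and a="-b" and b="-a"] by simp
  from lebesgue_differentiation_right[OF this] obtain N where N: "negligible N"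
    "\<And>t e. t \<notin> N \<Longrightarrow> 0 < e \<Longrightarrow> \<exists>d>0. \<forall>h. 0 < h \<and> h < d \<longrightarrow> \<bar>integral {t..t+h} (\<lambda>x. g (- x)) - h * g (- t)\<bar> \<le> e * h"
    by metis
  show ?thesis
  proof (rule that[of "uminus ` N"])
    show "negligible (uminus ` N)"
      by (rule negligible_differentiable_image_negligible[OF _ N(1)]) (auto simp: differentiable_on_def)
    fix t e :: real assume t: "t \<notin> uminus ` N" and e: "0 < e"
    then have "- t \<notin> N" by (metis imageI minus_minus)
    from N(2)[OF this e] obtain d where d: "d > 0"
      "\<And>h. 0 < h \<Longrightarrow> h < d \<Longrightarrow> \<bar>integral {-t..-t+h} (\<lambda>x. g (- x)) - h * g t\<bar> \<le> e * h" by auto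
    have "integral {-t..-t+h} (\<lambda>x. g (- x)) = integral {t-h..t} g" for h
      using Henstock_Kurzweil_Integration.integral_reflect_real[where a="t-h" and b=t and f=g] by (simp add: algebra_simps)
    then show "\<exists>d>0. \<forall>h. 0 < h \<and> h < d \<longrightarrow> \<bar>integral {t-h..t} g - h * g t\<bar> \<le> e * h"
      using d by auto
  qed
qed

lemma ae_deriv_of_integral:
  fixes G g :: "real \<Rightarrow> real"
  assumes G: "\<And>s t. a \<le> s \<Longrightarrow> s \<le> t \<Longrightarrow> t \<le> b \<Longrightarrow> (g has_integral (G t - G s)) {s..t}"
  obtains N where "negligible N" "\<And>t. a < t \<Longrightarrow> t < b \<Longrightarrow> t \<notin> N \<Longrightarrow> (G has_real_derivative g t) (at t)"
proof -
  \<comment> \<open>Extension by zero, because the differentiation results ask for integrability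
    over every interval; at interior points \<open>k\<close> agrees with \<open>g\<close>.\<close>
  define k where "k = (\<lambda>x. if x \<in> {a..b} then g x else 0)"
  have comp_integrable: "k integrable_on {c..d}" for c d
  proof -
    have "g integrable_on {max a c..min b d}"
      using G[of "max a c" "min b d"] by (cases "max a c \<le> min b d") (auto simp: integrable_on_def)
    moreover have "{a..b} \<inter> {c..d} = {max a c..min b d}" by auto
    ultimately show ?thesis unfolding k_def by (subst integrable_restrict_Int) simp
  qed
  obtain N1 where N1: "negligible N1" "\<And>t e. t \<notin> N1 \<Longrightarrow> 0 < e \<Longrightarrow> \<exists>d>0. \<forall>h. 0 < h \<and> h < d \<longrightarrow> \<bar>integral {t..t+h} k - h * k t\<bar> \<le> e * h"
    using lebesgue_differentiation_right[of k] comp_integrable by blast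
  obtain N2 where N2: "negligible N2" "\<And>t e. t \<notin> N2 \<Longrightarrow> 0 < e \<Longrightarrow> \<exists>d>0. \<forall>h. 0 < h \<and> h < d \<longrightarrow> \<bar>integral {t-h..t} k - h * k t\<bar> \<le> e * h"
    using lebesgue_differentiation_left[of k] comp_integrable by blast
  have kG: "integral {s..t} k = G t - G s" if "a \<le> s" "s \<le> t" "t \<le> b" for s t
  proof -
    have "integral {s..t} k = integral {s..t} g"
      by (rule integral_cong) (use that in \<open>auto simp: k_def\<close>)
    then show ?thesis using G[OF that] by (simp add: integral_unique)
  qed
  show ?thesis
  proof (rule that[of "N1 \<union> N2"])
    show "negligible (N1 \<union> N2)" using N1 N2 by simp
    fix t assume t: "a < t" "t < b" "t \<notin> N1 \<union> N2"
    have kt: "k t = g t" using t by (simp add: k_def)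
    show "(G has_real_derivative g t) (at t)"
      unfolding has_field_derivative_def has_derivative_at_alt
    proof (intro conjI allI impI)
      show "bounded_linear (\<lambda>x. g t * x)" by (rule bounded_linear_mult_right)
      fix e :: real assume e: "0 < e"
      obtain d1 where d1: "d1 > 0" "\<And>h. 0 < h \<Longrightarrow> h < d1 \<Longrightarrow> \<bar>integral {t..t+h} k - h * k t\<bar> \<le> e * h"
        using N1(2)[OF _ e, of t] t by auto
      obtain d2 where d2: "d2 > 0" "\<And>h. 0 < h \<Longrightarrow> h < d2 \<Longrightarrow> \<bar>integral {t-h..t} k - h * k t\<bar> \<le> e * h"
        using N2(2)[OF _ e, of t] t by auto
      define d where "d = min (min (t - a) (b - t)) (min d1 d2)"
      have "norm (G y - G t - g t * (y - t)) \<le> e * norm (y - t)" if "norm (y - t) < d" for y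
      proof -
        consider "y = t" | "t < y" | "y < t" by linarith
        then show ?thesis
        proof cases
          case 2
          then have "\<bar>integral {t..t+(y-t)} k - (y-t) * k t\<bar> \<le> e * (y-t)"
            using that by (intro d1(2)) (auto simp: d_def)
          moreover have "integral {t..y} k = G y - G t"
            using 2 t that by (intro kG) (auto simp: d_def)
          ultimately show ?thesis using 2 kt by (simp add: mult.commute)
        next
          case 3
          then have "\<bar>integral {t-(t-y)..t} k - (t-y) * k t\<bar> \<le> e * (t-y)"
            using that by (intro d2(2)) (auto simp: d_def)
          moreover have "integral {y..t} k = G t - G y"
            using 3 t that by (intro kG) (auto simp: d_def)
          ultimately show ?thesis using 3 kt by (simp add: algebra_simps abs_if split: if_splits)
        qed simp
      qed
      moreover have "d > 0" using t d1 d2 by (simp add: d_def)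
      ultimately show "\<exists>d>0. \<forall>y. norm (y - t) < d \<longrightarrow> norm (G y - G t - g t * (y - t)) \<le> e * norm (y - t)" by blast
    qed
  qed
qed

section \<open>Monotonicity from a one-sided derivative condition off a null set\<close>

lemma negligible_outer_open:
  fixes N :: "real set"
  assumes "negligible N" "0 < e"
  obtains U where "open U" "N \<subseteq> U" "U \<in> lmeasurable" "measure lebesgue U \<le> e"
proof -
  have N: "N \<in> sets lebesgue" "emeasure lebesgue N = 0"
    using assms(1) by (auto simp: negligible_iff_null_sets)
  obtain U where U: "open U" "N \<subseteq> U" "U - N \<in> lmeasurable" "emeasure lebesgue (U - N) < ennreal e"
    using sets_lebesgue_outer_open[OF N(1) assms(2)] by blast
  have "emeasure lebesgue U = emeasure lebesgue (U - N)"
    using N U(1) by (intro emeasure_Diff_null_set[symmetric]) (auto simp: null_sets_def)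
  then have lt: "emeasure lebesgue U < ennreal e" using U(4) by simp
  then have "U \<in> lmeasurable"
    using U(1) by (intro fmeasurableI) (auto simp: top.not_eq_extremum intro: less_le_trans)
  moreover have "measure lebesgue U \<le> e"
    using lt assms(2) by (simp add: measure_def enn2real_leI less_imp_le)
  ultimately show ?thesis using U that by blast
qed

text \<open>On the exceptional set the possible growth at rate B is paid for by a function that
  increases at rate B inside a small open neighbourhood of that set; elsewhere the Dini condition
  costs only the slope e. In the application g is a spatial maximum, which can be compared with its
  earlier values only, hence the left Dini condition.\<close>

lemma antimono_if_left_dini_nonpos:
  fixes g :: "real \<Rightarrow> real"
  assumes up: "\<And>s t. 0 \<le> s \<Longrightarrow> s \<le> t \<Longrightarrow> t \<le> T \<Longrightarrow> g t \<le> g s + B * (t - s)" and B: "0 \<le> B"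
    and N: "negligible N"
    and dini: "\<And>t e. 0 < t \<Longrightarrow> t \<le> T \<Longrightarrow> t \<notin> N \<Longrightarrow> 0 < e \<Longrightarrow>
      \<exists>d>0. \<forall>s. t - d < s \<and> s < t \<and> 0 \<le> s \<longrightarrow> g t \<le> g s + e * (t - s)"
    and T: "0 \<le> T"
  shows "g T \<le> g 0"
proof -
  have main: "g T \<le> g 0 + e * (T + B)" if e: "0 < e" for e
  proof -
    obtain U where U: "open U" "N \<subseteq> U" "U \<in> lmeasurable" "measure lebesgue U \<le> e"
      using negligible_outer_open[OF N e] by blast
    define m where "m t = measure lebesgue (U \<inter> {0..t})" for t
    \<comment> \<open>Over [0, T] the subtracted terms change by at most e * (T + B), which is the
      error in \<open>main\<close>.\<close>
    define h where "h t = g t - e * t - B * m t" for t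
    have fm: "U \<inter> {a..b} \<in> lmeasurable" for a b
      using U(3) by (simp add: fmeasurable_Int_fmeasurable)
    have m_mono: "m s \<le> m t" if "s \<le> t" for s t
      unfolding m_def using that fm by (intro measure_mono_fmeasurable) (auto simp: fmeasurableD)
    have m_bd: "0 \<le> m t" "m t \<le> e" for t
      unfolding m_def using U(3,4) fm
      by (auto intro!: order_trans[OF measure_mono_fmeasurable[of _ U lebesgue]] simp: fmeasurableD)
    have m_add: "m t \<ge> m s + (t - s)" if "0 \<le> s" "s \<le> t" "{s..t} \<subseteq> U" for s t
    proof -
      have "measure lebesgue ((U \<inter> {0..s}) \<union> {s<..<t}) = m s + measure lebesgue {s<..<t}"
        unfolding m_def using fm lmeasurable_box[of s t]
        by (intro measure_Un_AE) (auto simp: fmeasurableD)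
      moreover have "measure lebesgue ((U \<inter> {0..s}) \<union> {s<..<t}) \<le> m t"
        unfolding m_def using that fm by (intro measure_mono_fmeasurable) (auto simp: fmeasurableD subset_iff)
      ultimately show ?thesis using that by simp
    qed
    have h_up: "h t \<le> h s + B * (t - s)" if "0 \<le> s" "s \<le> t" "t \<le> T" for s t
    proof -
      have "B * m s \<le> B * m t" "e * s \<le> e * t" using m_mono[of s t] that B e by (auto intro: mult_left_mono)
      then show ?thesis unfolding h_def using up[OF that] by linarith
    qed
    have h_loc: "\<exists>d>0. \<forall>s. t - d < s \<and> s < t \<and> 0 \<le> s \<longrightarrow> h t \<le> h s" if t: "0 < t" "t \<le> T" for t
    proof (cases "t \<in> N")
      case True
      then obtain d where d: "d > 0" "ball t d \<subseteq> U" using U(1,2) by (meson open_contains_ball subsetD)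
      have "h t \<le> h s" if "t - d < s" "s < t" "0 \<le> s" for s
      proof -
        have "{s..t} \<subseteq> U" using d that by (intro order_trans[OF _ d(2)]) (auto simp: dist_real_def)
        then have "m s + (t - s) \<le> m t" using that by (intro m_add) auto
        then have "B * (m s + (t - s)) \<le> B * m t" using B by (intro mult_left_mono)
        then have "B * m s + B * (t - s) \<le> B * m t" by (simp add: distrib_left)
        moreover have "e * s \<le> e * t" using e that by simp
        ultimately show ?thesis unfolding h_def using up[of s t] that t by linarith
      qed
      then show ?thesis using d by blast
    next
      case False
      from dini[OF t False e] obtain d where d: "d > 0"
        "\<And>s. t - d < s \<Longrightarrow> s < t \<Longrightarrow> 0 \<le> s \<Longrightarrow> g t \<le> g s + e * (t - s)" by blast
      have "h t \<le> h s" if "t - d < s" "s < t" "0 \<le> s" for s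
      proof -
        have "B * m s \<le> B * m t" using m_mono[of s t] that B by (auto intro: mult_left_mono)
        then show ?thesis unfolding h_def using d(2)[OF that] by (simp add: right_diff_distrib)
      qed
      then show ?thesis using d by blast
    qed
    \<comment> \<open>Induction on the continuum, downwards from T: \<open>s0\<close> is the infimum
      of the times from which on \<open>h\<close> stays above \<open>h T\<close>. The growth bound
      \<open>h_up\<close> extends the inequality to \<open>s0\<close> itself, and
      \<open>h_loc\<close> extends it below any positive \<open>s0\<close>.\<close>
    define S where "S = {s \<in> {0..T}. \<forall>\<tau>\<in>{s..T}. h T \<le> h \<tau>}"
    define s0 where "s0 = Inf S"
    have "T \<in> S" using T by (auto simp: S_def)
    have bdd: "bdd_below S" by (rule bdd_belowI[of _ 0]) (auto simp: S_def)
    have "0 \<le> s0" unfolding s0_def using \<open>T \<in> S\<close> by (intro cInf_greatest) (auto simp: S_def)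
    moreover have "s0 \<le> T" unfolding s0_def using \<open>T \<in> S\<close> bdd by (rule cInf_lower)
    ultimately have s0: "0 \<le> s0" "s0 \<le> T" .
    have above: "h T \<le> h \<tau>" if \<tau>: "s0 < \<tau>" "\<tau> \<le> T" for \<tau>
    proof -
      obtain s where "s \<in> S" "s < \<tau>"
        using cInf_lessD[of S \<tau>] \<open>T \<in> S\<close> \<tau> unfolding s0_def by blast
      then show ?thesis using \<tau> by (auto simp: S_def)
    qed
    have at_s0: "h T \<le> h s0"
    proof (cases "s0 = T")
      case False
      have "h T \<le> h s0 + d" if d: "0 < d" for d
      proof -
        define \<tau> where "\<tau> = min T (s0 + d / (B + 1))"
        have "0 < d / (B + 1)" using d B by simp
        then have \<tau>: "s0 < \<tau>" "\<tau> \<le> T" "\<tau> - s0 \<le> d / (B + 1)" using s0 False by (auto simp: \<tau>_def)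
        have "B * (\<tau> - s0) \<le> B * (d / (B + 1))" using \<tau> B by (intro mult_left_mono) auto
        also have "\<dots> \<le> d" using d B by (simp add: field_simps)
        finally have "h \<tau> \<le> h s0 + d" using h_up[of s0 \<tau>] \<tau> s0 by linarith
        then show ?thesis using above[of \<tau>] \<tau> by linarith
      qed
      then show ?thesis by (rule field_le_epsilon)
    qed simp
    have "s0 = 0"
    proof (rule ccontr)
      assume "s0 \<noteq> 0"
      then have "0 < s0" using s0 by simp
      from h_loc[OF this s0(2)] obtain d where d: "d > 0"
        "\<And>s. s0 - d < s \<Longrightarrow> s < s0 \<Longrightarrow> 0 \<le> s \<Longrightarrow> h s0 \<le> h s" by blast
      define s where "s = max 0 (s0 - d / 2)"
      have s: "0 \<le> s" "s < s0" "s0 - d < s" using d \<open>0 < s0\<close> by (auto simp: s_def)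
      have "h T \<le> h \<tau>" if "s \<le> \<tau>" "\<tau> \<le> T" for \<tau>
      proof (cases "\<tau> < s0")
        case True
        then show ?thesis using d(2)[of \<tau>] s that at_s0 by linarith
      next
        case False
        then show ?thesis using above[of \<tau>] at_s0 that by (cases "\<tau> = s0") auto
      qed
      then have "s \<in> S" using s s0 by (auto simp: S_def)
      then show False using cInf_lower[OF _ bdd] s unfolding s0_def by fastforce
    qed
    then have "h T \<le> h 0" using at_s0 by simp
    moreover have "B * m T \<le> B * e" using m_bd B by (intro mult_left_mono) auto
    moreover have "0 \<le> B * m 0" using m_bd B by simp
    ultimately show ?thesis unfolding h_def by (simp add: distrib_left mult.commute)
  qed
  show ?thesis
  proof (rule field_le_epsilon)
    fix d :: real assume d: "0 < d"
    have "0 < d / (T + B + 1)" using d T B by simp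
    from main[OF this] have "g T \<le> g 0 + d / (T + B + 1) * (T + B)" .
    also have "d / (T + B + 1) * (T + B) \<le> d" using d T B by (simp add: field_simps)
    finally show "g T \<le> g 0 + d" by simp
  qed
qed

lemma const_if_lipschitz_ae_deriv_zero:
  fixes g :: "real \<Rightarrow> real"
  assumes lip: "\<And>s t. 0 \<le> s \<Longrightarrow> s \<le> t \<Longrightarrow> t \<le> T \<Longrightarrow> \<bar>g t - g s\<bar> \<le> B * (t - s)"
    and N: "negligible N"
    and der: "\<And>t. 0 < t \<Longrightarrow> t < T \<Longrightarrow> t \<notin> N \<Longrightarrow> (g has_real_derivative 0) (at t)"
    and T: "0 \<le> T"
  shows "g T = g 0"
proof -
  have *: "k T \<le> k 0" if k: "k = g \<or> k = (\<lambda>x. - g x)" for k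
  \<comment> \<open>The end point T joins the exceptional set because the derivative is known only
    in the open interval.\<close>
  proof (rule antimono_if_left_dini_nonpos[where N="N \<union> {T}" and B="\<bar>B\<bar>" and T=T])
    fix s t assume st: "0 \<le> s" "s \<le> t" "t \<le> T"
    have "B * (t - s) \<le> \<bar>B\<bar> * (t - s)" using st by (intro mult_right_mono) auto
    then show "k t \<le> k s + \<bar>B\<bar> * (t - s)" using lip[OF st] k by auto
  next
    fix t e :: real assume t: "0 < t" "t \<le> T" "t \<notin> N \<union> {T}" and e: "0 < e"
    have "(g has_derivative times 0) (at t)"
      using der[of t] t by (simp add: has_field_derivative_def)
    then obtain d where d: "d > 0" "\<And>y. norm (y - t) < d \<Longrightarrow> norm (g y - g t - 0 * (y - t)) \<le> e * norm (y - t)"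
      using e unfolding has_derivative_at_alt by blast
    have "k t \<le> k s + e * (t - s)" if "t - d < s" "s < t" for s
      using d(2)[of s] that k by (auto simp: abs_le_iff)
    then show "\<exists>d>0. \<forall>s. t - d < s \<and> s < t \<and> 0 \<le> s \<longrightarrow> k t \<le> k s + e * (t - s)"
      using d(1) by blast
  qed (use N T in auto)
  from *[of g] *[of "\<lambda>x. - g x"] show ?thesis by simp
qed

text \<open>The affine change F = t/2 + X/(2K) turns slopes in [-K, K] into slopes in [0, 1], so the
  monotone representation applies. Borel measurability and the pointwise bound allow r to multiply
  continuous functions under the integral.\<close>

lemma lipschitz_integral_rep:
  fixes X :: "real \<Rightarrow> real"
  assumes X: "L-lipschitz_on UNIV X"
  obtains r where "r \<in> borel_measurable borel" "\<And>t. \<bar>r t\<bar> \<le> L"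
    "\<And>s t. s \<le> t \<Longrightarrow> (r has_integral (X t - X s)) {s..t}"
proof -
  \<comment> \<open>L + 1 instead of L keeps the division by K meaningful when L = 0.\<close>
  define K where "K = L + 1"
  have L: "0 \<le> L" using X by (rule lipschitz_on_nonneg)
  have K: "0 < K" using L by (simp add: K_def)
  have lip: "\<bar>X t - X s\<bar> \<le> L * (t - s)" if "s \<le> t" for s t
    using lipschitz_onD[OF X, of s t] that by (simp add: dist_real_def abs_minus_commute)
  have lipK: "\<bar>X t - X s\<bar> \<le> K * (t - s)" if "s \<le> t" for s t
    using lip[OF that] mult_right_mono[of L K "t - s"] that by (simp add: K_def)
  define F where "F t = t / 2 + X t / K / 2" for t
  have "mono F"
  proof (rule monoI)
    fix s t :: real assume "s \<le> t"
    then have "\<bar>X t / K - X s / K\<bar> \<le> t - s" using lipK[of s t] K by (simp add: field_simps flip: diff_divide_distrib)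
    then show "F s \<le> F t" unfolding F_def abs_le_iff by argo
  qed
  moreover have "mono (\<lambda>t. t - F t)"
  proof (rule monoI)
    fix s t :: real assume "s \<le> t"
    then have "\<bar>X t / K - X s / K\<bar> \<le> t - s" using lipK[of s t] K by (simp add: field_simps flip: diff_divide_distrib)
    then show "s - F s \<le> t - F t" unfolding F_def abs_le_iff by argo
  qed
  ultimately obtain q where q: "q \<in> borel_measurable borel"
    "\<And>s t. s \<le> t \<Longrightarrow> (q has_integral (F t - F s)) {s..t}"
    using mono_nonexpansive_integral_rep[of F] by metis
  define p where "p t = K * (2 * q t - 1)" for t
  have p_int: "(p has_integral (X t - X s)) {s..t}" if "s \<le> t" for s t
  proof -
    have "(p has_integral (K * (2 * (F t - F s) - (t - s)))) {s..t}"
      unfolding p_def using q(2)[OF that] has_integral_const_real[of "1::real" s t] that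
      by (intro has_integral_mult_right has_integral_diff) auto
    moreover have "K * (2 * (F t - F s) - (t - s)) = X t - X s"
      using K by (simp add: F_def field_simps)
    ultimately show ?thesis by simp
  qed
  have p_meas: "p \<in> borel_measurable borel" unfolding p_def using q(1) by measurable
  \<comment> \<open>Clipping enforces the bound L at every point. It changes \<open>p\<close> only
    on a null set, since off such a set \<open>p\<close> is the derivative of X.\<close>
  define r where "r t = max (- L) (min L (p t))" for t
  have pL: "\<exists>N. negligible N \<and> (\<forall>t. a < t \<longrightarrow> t < b \<longrightarrow> t \<notin> N \<longrightarrow> r t = p t)" for a b
  proof -
    obtain N where N: "negligible N" "\<And>t. a < t \<Longrightarrow> t < b \<Longrightarrow> t \<notin> N \<Longrightarrow> (X has_real_derivative p t) (at t)"
      using ae_deriv_of_integral[of a b p X] p_int by blast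
    have "r t = p t" if "a < t" "t < b" "t \<notin> N" for t
    proof -
      have "((\<lambda>y. (X y - X t) / (y - t)) \<longlongrightarrow> p t) (at t)"
        using N(2)[OF that] by (simp add: has_field_derivative_iff)
      moreover have "\<forall>\<^sub>F y in at t. \<bar>(X y - X t) / (y - t)\<bar> \<le> L"
        unfolding eventually_at_filter
      proof (intro always_eventually allI impI)
        fix y assume "y \<noteq> t"
        then show "\<bar>(X y - X t) / (y - t)\<bar> \<le> L"
          using lipschitz_onD[OF X, of y t] by (simp add: dist_real_def abs_divide divide_le_eq)
      qed
      ultimately have "\<bar>p t\<bar> \<le> L"
        by (intro tendsto_upperbound[OF tendsto_rabs]) auto
      then show ?thesis by (auto simp: r_def)
    qed
    then show ?thesis using N(1) by blast
  qed
  show ?thesis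
  proof (rule that[of r])
    show "r \<in> borel_measurable borel" unfolding r_def using p_meas by measurable
    show "\<bar>r t\<bar> \<le> L" for t using L by (auto simp: r_def)
    fix s t :: real assume st: "s \<le> t"
    obtain N where N: "negligible N" "\<And>x. s - 1 < x \<Longrightarrow> x < t + 1 \<Longrightarrow> x \<notin> N \<Longrightarrow> r x = p x" using pL[of "s - 1" "t + 1"] by blast
    show "(r has_integral (X t - X s)) {s..t}"
      by (rule has_integral_spike[OF N(1) _ p_int[OF st]]) (use N(2) in auto)
  qed
qed

text \<open>Sard's theorem in dimension one, moved to \<open>real^1\<close>, where a vanishing
  derivative is a matrix of rank 0 < 1.\<close>

lemma negligible_image_zero_derivative:
  fixes f :: "real \<Rightarrow> real"
  assumes der: "\<And>x. x \<in> S \<Longrightarrow> (f has_real_derivative 0) (at x)"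
  shows "negligible (f ` S)"
proof -
  define F :: "real^1 \<Rightarrow> real^1" where "F = (\<lambda>x. vec (f (x $ 1)))"
  have comp: "((\<lambda>x::real^1. x $ 1) has_derivative (\<lambda>h. h $ 1)) (at x within T)" for x T
    by (rule bounded_linear_imp_has_derivative) (simp add: bounded_linear_vec_nth)
  have vecd: "(vec :: real \<Rightarrow> real^1) = (\<lambda>c. c *\<^sub>R 1)" by (simp add: vec_eq_iff fun_eq_iff)
  have neg: "negligible (F ` (vec ` S))"
  proof (rule baby_Sard[where f'="\<lambda>x h. 0"])
    fix x :: "real^1" assume "x \<in> vec ` S"
    then obtain s where s: "s \<in> S" "x = vec s" by blast
    have "(f has_derivative (\<lambda>h. 0)) (at (x $ 1))"
      using der[OF s(1)] s(2) by (simp add: has_field_derivative_def mult_zero_left[abs_def])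
    from has_derivative_compose[OF comp this]
    have "((\<lambda>x. f (x $ 1)) has_derivative (\<lambda>h. 0)) (at x within vec ` S)" .
    from has_derivative_scaleR_left[OF this, of 1]
    show "(F has_derivative (\<lambda>h. 0)) (at x within vec ` S)" by (simp add: F_def vecd)
    show "rank (matrix (\<lambda>h::real^1. 0::real^1)) < CARD(1)"
      by (simp add: matrix_def rank_eq_0 vec_eq_iff)
  qed simp
  have eq: "f ` S = (\<lambda>x. x $ 1) ` (F ` (vec ` S))"
    by (simp add: F_def image_image)
  show ?thesis unfolding eq
  proof (rule negligible_locally_Lipschitz_image[OF _ neg])
    fix x :: "real^1" assume "x \<in> F ` vec ` S"
    show "\<exists>T B. open T \<and> x \<in> T \<and> (\<forall>y\<in>F ` vec ` S \<inter> T. norm (y $ 1 - x $ 1) \<le> B * norm (y - x))"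
      using component_le_norm_cart[of "_ - x" 1] by (intro exI[of _ UNIV] exI[of _ 1]) auto
  qed simp
qed

section \<open>Lipschitz arcs and graphs over the time axis\<close>

text \<open>McShane's extension: the hypothesis makes p an M-Lipschitz function of q on P, and the
  infimum of the cones of slope M extends that function to the whole line.\<close>

lemma lipschitz_graph_extension:
  fixes p q :: "'a \<Rightarrow> real"
  assumes pq: "\<And>s s'. s \<in> P \<Longrightarrow> s' \<in> P \<Longrightarrow> \<bar>p s - p s'\<bar> \<le> M * \<bar>q s - q s'\<bar>" and M: "0 \<le> M"
  obtains X where "M-lipschitz_on UNIV X" "\<And>s. s \<in> P \<Longrightarrow> X (q s) = p s"
proof (cases "P = {}")
  case True
  have "M-lipschitz_on UNIV (\<lambda>t::real. 0::real)" using M by (intro lipschitz_onI) auto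
  then show ?thesis using that[of "\<lambda>_. 0"] True by simp
next
  case False
  define X where "X t = (INF s\<in>P. p s + M * \<bar>t - q s\<bar>)" for t
  have low: "p s0 - M * \<bar>t - q s0\<bar> \<le> p s + M * \<bar>t - q s\<bar>" if "s0 \<in> P" "s \<in> P" for s0 s t
  proof -
    have "M * \<bar>q s0 - q s\<bar> \<le> M * (\<bar>t - q s0\<bar> + \<bar>t - q s\<bar>)" using M by (intro mult_left_mono) auto
    then show ?thesis using pq[OF that] by (simp add: distrib_left)
  qed
  have bdd: "bdd_below ((\<lambda>s. p s + M * \<bar>t - q s\<bar>) ` P)" for t
    using False low by (meson bdd_belowI2 ex_in_conv)
  have half: "X t \<le> X t' + M * \<bar>t - t'\<bar>" for t t'
  proof -
    have "X t - M * \<bar>t - t'\<bar> \<le> p s + M * \<bar>t' - q s\<bar>" if "s \<in> P" for s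
    proof -
      have "X t \<le> p s + M * \<bar>t - q s\<bar>" unfolding X_def by (rule cINF_lower[OF bdd that])
      moreover have "M * \<bar>t - q s\<bar> \<le> M * (\<bar>t - t'\<bar> + \<bar>t' - q s\<bar>)" using M by (intro mult_left_mono) auto
      ultimately show ?thesis by (simp add: distrib_left)
    qed
    then have "X t - M * \<bar>t - t'\<bar> \<le> X t'" unfolding X_def[of t'] by (intro cINF_greatest False)
    then show ?thesis by simp
  qed
  have "M-lipschitz_on UNIV X"
  proof (rule lipschitz_onI)
    show "dist (X x) (X y) \<le> M * dist x y" for x y
      using half[of x y] half[of y x] by (simp add: dist_real_def abs_le_iff abs_minus_commute)
  qed (rule M)
  moreover have "X (q s) = p s" if "s \<in> P" for s
  proof (rule antisym)
    have "X (q s) \<le> p s + M * \<bar>q s - q s\<bar>" unfolding X_def by (rule cINF_lower[OF bdd that])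
    then show "X (q s) \<le> p s" by simp
    show "p s \<le> X (q s)" unfolding X_def using low[OF that, of _ "q s"] by (intro cINF_greatest False) simp
  qed
  ultimately show ?thesis by (rule that)
qed

text \<open>
  Outside the critical values of the time component, which form a null set by Sard's argument, the
  arc is locally a graph over the time axis with bounded slope.
\<close>

lemma lipschitz_arc_covered_by_graphs:
  fixes \<gamma> :: "real \<Rightarrow> real \<times> real"
  assumes \<gamma>: "L-lipschitz_on {0..1} \<gamma>"
  obtains \<X> N where "countable \<X>" "negligible N"
    "\<And>X. X \<in> \<X> \<Longrightarrow> \<exists>L. L-lipschitz_on UNIV X" "\<And>X. X \<in> \<X> \<Longrightarrow> \<exists>c>0. \<forall>t. c \<le> X t"
    "\<And>x t. (x, t) \<in> \<gamma> ` {0..1} \<Longrightarrow> 0 < x \<Longrightarrow> t \<notin> N \<Longrightarrow> \<exists>X\<in>\<X>. X t = x"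
proof -
  \<comment> \<open>Constant continuation beyond [0, 1] keeps the arc Lipschitz, so that
    differentiability of \<open>q\<close> can be discussed on a neighbourhood of the parameter
    interval, end points included.\<close>
  define c :: "real \<Rightarrow> real" where "c s = max 0 (min 1 s)" for s
  have c: "c s \<in> {0..1}" "\<bar>c s - c s'\<bar> \<le> \<bar>s - s'\<bar>" for s s' by (auto simp: c_def)
  have c_id: "c s = s" if "s \<in> {0..1}" for s using that by (auto simp: c_def)
  define p where "p s = fst (\<gamma> (c s))" for s
  define q where "q s = snd (\<gamma> (c s))" for s
  have L: "0 \<le> L" using \<gamma> by (rule lipschitz_on_nonneg)
  have dist: "dist (\<gamma> (c s)) (\<gamma> (c s')) \<le> L * \<bar>s - s'\<bar>" for s s'
  proof -
    have "dist (\<gamma> (c s)) (\<gamma> (c s')) \<le> L * \<bar>c s - c s'\<bar>"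
      using lipschitz_onD[OF \<gamma> c(1) c(1), of s s'] by (simp add: dist_real_def)
    also have "\<dots> \<le> L * \<bar>s - s'\<bar>" using L c(2) by (intro mult_left_mono) auto
    finally show ?thesis .
  qed
  have pL: "\<bar>p s - p s'\<bar> \<le> L * \<bar>s - s'\<bar>" for s s'
    using dist_fst_le[of "\<gamma> (c s)" "\<gamma> (c s')"] dist[of s s'] by (simp add: p_def dist_real_def)
  have qL: "\<bar>q s - q s'\<bar> \<le> L * \<bar>s - s'\<bar>" for s s'
    using dist_snd_le[of "\<gamma> (c s)" "\<gamma> (c s')"] dist[of s s'] by (simp add: q_def dist_real_def)
  have "L-lipschitz_on UNIV q" using qL L by (intro lipschitz_onI) (auto simp: dist_real_def)
  then obtain r where r: "\<And>s t. s \<le> t \<Longrightarrow> (r has_integral (q t - q s)) {s..t}"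
    by (rule lipschitz_integral_rep) blast
  obtain N1 where N1: "negligible N1" "\<And>s. -1 < s \<Longrightarrow> s < 2 \<Longrightarrow> s \<notin> N1 \<Longrightarrow> (q has_real_derivative r s) (at s)"
    using ae_deriv_of_integral[of "-1" 2 r q] r by blast
  define S where "S = {s. -1 < s \<and> s < 2 \<and> s \<notin> N1 \<and> r s = 0}"
  \<comment> \<open>The first image consists of the times coming from parameters without a
    derivative and is null because \<open>q\<close> is Lipschitz; the second consists of the
    critical values and is null by Sard's argument.\<close>
  define N where "N = q ` N1 \<union> q ` S"
  have negl: "negligible N"
  proof -
    have "negligible (q ` N1)"
    proof (rule negligible_locally_Lipschitz_image[OF _ N1(1)])
      fix x assume "x \<in> N1"
      show "\<exists>T B. open T \<and> x \<in> T \<and> (\<forall>y\<in>N1 \<inter> T. norm (q y - q x) \<le> B * norm (y - x))"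
        using qL by (intro exI[of _ UNIV] exI[of _ L]) auto
    qed simp
    moreover have "negligible (q ` S)"
      by (rule negligible_image_zero_derivative) (use N1(2) in \<open>force simp: S_def\<close>)
    ultimately show ?thesis by (simp add: N_def)
  qed
  \<comment> \<open>The first condition bounds the inverse slope of \<open>q\<close> at scale 1 / (k
    + 1). The cell index j keeps two parameters within that scale, so on one set
    \<open>P k j m\<close> the position is a Lipschitz function of time. The last condition keeps
    the graph away from x = 0.\<close>
  define P :: "nat \<Rightarrow> int \<Rightarrow> nat \<Rightarrow> real set" where
    "P k j m = {s \<in> {0..1}. (\<forall>s'. \<bar>s' - s\<bar> < 1 / (real k + 1) \<longrightarrow> \<bar>s' - s\<bar> \<le> (real k + 1) * \<bar>q s' - q s\<bar>) \<and>
      \<lfloor>s * (real k + 1)\<rfloor> = j \<and> 1 / (real m + 1) \<le> p s}" for k j m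
  have graph: "\<exists>X. (\<exists>M. M-lipschitz_on UNIV X) \<and> (\<forall>t. 1 / (real m + 1) \<le> X t) \<and> (\<forall>s\<in>P k j m. X (q s) = p s)" for k j m
  proof -
    have "\<bar>p s - p s'\<bar> \<le> (L * (real k + 1)) * \<bar>q s - q s'\<bar>" if "s \<in> P k j m" "s' \<in> P k j m" for s s'
    proof -
      have "\<bar>s * (real k + 1) - s' * (real k + 1)\<bar> < 1"
        using that unfolding P_def by (simp add: floor_eq_iff) linarith
      then have "\<bar>s - s'\<bar> * (real k + 1) < 1"
        by (metis abs_mult abs_of_nonneg add_nonneg_nonneg left_diff_distrib of_nat_0_le_iff zero_le_one)
      then have "\<bar>s - s'\<bar> < 1 / (real k + 1)" by (simp add: less_divide_eq)
      then have "\<bar>s - s'\<bar> \<le> (real k + 1) * \<bar>q s - q s'\<bar>"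
        using that unfolding P_def by blast
      then have "L * \<bar>s - s'\<bar> \<le> L * ((real k + 1) * \<bar>q s - q s'\<bar>)" using L by (rule mult_left_mono)
      then show ?thesis using pL[of s s'] by (simp add: mult.assoc)
    qed
    then obtain X where X: "(L * (real k + 1))-lipschitz_on UNIV X" "\<And>s. s \<in> P k j m \<Longrightarrow> X (q s) = p s"
      using L lipschitz_graph_extension[of "P k j m" p "L * (real k + 1)" q] by (metis mult_nonneg_nonneg of_nat_0_le_iff add_nonneg_nonneg zero_le_one)
    \<comment> \<open>The extension may come close to x = 0 or cross it; the maximum prevents this
      and changes nothing on \<open>P k j m\<close>.\<close>
    define Y where "Y t = max (1 / (real m + 1)) (X t)" for t
    have "(L * (real k + 1))-lipschitz_on UNIV Y"
    proof (rule lipschitz_onI)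
      fix t t' :: real
      have "\<bar>Y t - Y t'\<bar> \<le> \<bar>X t - X t'\<bar>" by (auto simp: Y_def)
      then show "dist (Y t) (Y t') \<le> (L * (real k + 1)) * dist t t'"
        using lipschitz_onD[OF X(1), of t t'] by (simp add: dist_real_def)
    qed (use L in simp)
    moreover have "Y (q s) = p s" if "s \<in> P k j m" for s
      using X(2)[OF that] that by (simp add: Y_def P_def)
    ultimately show ?thesis by (intro exI[of _ Y]) (auto simp: Y_def)
  qed
  then have "\<forall>k j m. \<exists>X. (\<exists>M. M-lipschitz_on UNIV X) \<and> (\<forall>t. 1 / (real m + 1) \<le> X t) \<and> (\<forall>s\<in>P k j m. X (q s) = p s)"
    by blast
  then obtain X where X: "\<And>k j m. \<exists>M. M-lipschitz_on UNIV (X k j m)"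
    "\<And>k j m t. 1 / (real m + 1) \<le> X k j m t" "\<And>k j m s. s \<in> P k j m \<Longrightarrow> X k j m (q s) = p s"
    by metis
  show ?thesis
  proof (rule that[of "range (\<lambda>(k, j, m). X k j m)" N])
    show "\<exists>L. L-lipschitz_on UNIV Y" if "Y \<in> range (\<lambda>(k, j, m). X k j m)" for Y
      using that X(1) by auto
    show "\<exists>c>0. \<forall>t. c \<le> Y t" if "Y \<in> range (\<lambda>(k, j, m). X k j m)" for Y
    proof -
      obtain k j m where "Y = X k j m" using \<open>Y \<in> _\<close> by auto
      then show ?thesis using X(2)[of m k j] by (intro exI[of _ "1 / (real m + 1)"]) auto
    qed
    fix x t assume xt: "(x, t) \<in> \<gamma> ` {0..1}" "0 < x" "t \<notin> N"
    then obtain s where s: "s \<in> {0..1}" "(x, t) = \<gamma> s" by blast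
    then have ps: "p s = x" and qs: "q s = t" by (simp_all add: p_def q_def c_id flip: s(2))
    have "s \<notin> N1" "s \<notin> S" using xt(3) qs by (auto simp: N_def)
    then have rs: "r s \<noteq> 0" and der: "(q has_real_derivative r s) (at s)" using s N1(2)[of s] by (auto simp: S_def)
    then obtain d where d: "d > 0" "\<And>y. \<bar>y - s\<bar> < d \<Longrightarrow> \<bar>q y - q s - r s * (y - s)\<bar> \<le> \<bar>r s\<bar> / 2 * \<bar>y - s\<bar>"
      unfolding has_field_derivative_def has_derivative_at_alt
      by (metis half_gt_zero zero_less_abs_iff real_norm_def)
    \<comment> \<open>The scale 1 / (k + 1) lies within the range d of the linear approximation,
      whose remainder costs half of the slope; this leaves the inverse slope 2 / |r s|, which is
      below k + 1.\<close>
    obtain k :: nat where k: "max (2 / \<bar>r s\<bar>) (1 / d) < real k" using reals_Archimedean2 by blast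
    obtain m :: nat where m: "1 / x < real m" using reals_Archimedean2 by blast
    have "\<bar>s' - s\<bar> \<le> (real k + 1) * \<bar>q s' - q s\<bar>" if "\<bar>s' - s\<bar> < 1 / (real k + 1)" for s'
    proof -
      have "1 / (real k + 1) \<le> d" using k d by (simp add: field_simps)
      then have "\<bar>q s' - q s - r s * (s' - s)\<bar> \<le> \<bar>r s\<bar> / 2 * \<bar>s' - s\<bar>" using d(2)[of s'] that by simp
      moreover have "\<bar>r s * (s' - s)\<bar> = \<bar>r s\<bar> * \<bar>s' - s\<bar>" by (rule abs_mult)
      ultimately have "\<bar>r s\<bar> / 2 * \<bar>s' - s\<bar> \<le> \<bar>q s' - q s\<bar>" by linarith
      then have *: "\<bar>s' - s\<bar> \<le> (2 / \<bar>r s\<bar>) * \<bar>q s' - q s\<bar>" using rs by (simp add: field_simps)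
      have "(2 / \<bar>r s\<bar>) * \<bar>q s' - q s\<bar> \<le> (real k + 1) * \<bar>q s' - q s\<bar>" using k by (intro mult_right_mono) auto
      with * show ?thesis by linarith
    qed
    moreover have "1 / (real m + 1) \<le> p s" using m xt(2) ps by (simp add: field_simps)
    ultimately have "s \<in> P k \<lfloor>s * (real k + 1)\<rfloor> m" using s(1) by (simp add: P_def)
    then have "X k \<lfloor>s * (real k + 1)\<rfloor> m t = x" using X(3) ps qs by metis
    then show "\<exists>Y\<in>range (\<lambda>(k, j, m). X k j m). Y t = x"
      by (intro bexI[of _ "X k \<lfloor>s * (real k + 1)\<rfloor> m"]) (auto intro: image_eqI[where x="(k, \<lfloor>s * (real k + 1)\<rfloor>, m)"])
  qed (simp_all add: negl)
qed

text \<open>By Lindelof, countably many of the neighbourhoods that meet only finitely many members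
  cover S. The empty set meets none of them and is added separately.\<close>

lemma countable_locally_finite_family:
  fixes S :: "'a::second_countable_topology set"
  assumes "locally_finite_in (top_of_set S) \<C>"
  shows "countable \<C>"
proof -
  have "\<forall>x\<in>S. \<exists>V. openin (top_of_set S) V \<and> x \<in> V \<and> finite {U \<in> \<C>. U \<inter> V \<noteq> {}}"
    using assms unfolding locally_finite_in_def by simp
  then obtain V where V: "\<And>x. x \<in> S \<Longrightarrow> openin (top_of_set S) (V x)" "\<And>x. x \<in> S \<Longrightarrow> x \<in> V x"
    "\<And>x. x \<in> S \<Longrightarrow> finite {U \<in> \<C>. U \<inter> V x \<noteq> {}}"
    by metis
  obtain \<F> where \<F>: "\<F> \<subseteq> V ` S" "countable \<F>" "\<Union>\<F> = \<Union>(V ` S)"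
    using Lindelof_openin[of "V ` S" S] V(1) by blast
  have "\<C> \<subseteq> {{}} \<union> (\<Union>W\<in>\<F>. {U \<in> \<C>. U \<inter> W \<noteq> {}})"
  proof
    fix U assume U: "U \<in> \<C>"
    show "U \<in> {{}} \<union> (\<Union>W\<in>\<F>. {U \<in> \<C>. U \<inter> W \<noteq> {}})"
    proof (cases "U = {}")
      case False
      then obtain x where "x \<in> U" by blast
      moreover have "U \<subseteq> S" using assms U unfolding locally_finite_in_def by auto
      ultimately have "x \<in> \<Union>\<F>" using V(2) \<F>(3) by blast
      then show ?thesis using U \<open>x \<in> U\<close> by blast
    qed simp
  qed
  moreover have "countable ({{}} \<union> (\<Union>W\<in>\<F>. {U \<in> \<C>. U \<inter> W \<noteq> {}}))"
    unfolding countable_Un_iff using \<F>(1,2) V(3) by (intro conjI countable_UN) (auto intro: countable_finite)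
  ultimately show ?thesis by (rule countable_subset)
qed

text \<open>Local finiteness makes the union of the curves relatively closed and the family
  countable, so the graphs and null sets of the single curves combine into one countable collection
  and one null set of times.\<close>

lemma C1_off_Lipschitz_curves_graphs:
  assumes "C1_off_Lipschitz_curves u"
  obtains \<Gamma> \<X> N where "open (quadrant - \<Gamma>)" "continuous_on (quadrant - \<Gamma>) (\<lambda>(x, t). u x t)"
    "countable \<X>" "negligible N"
    "\<And>X. X \<in> \<X> \<Longrightarrow> \<exists>L. L-lipschitz_on UNIV X" "\<And>X. X \<in> \<X> \<Longrightarrow> \<exists>c>0. \<forall>t. c \<le> X t"
    "\<And>x t. (x, t) \<in> \<Gamma> \<Longrightarrow> (x, t) \<in> quadrant \<Longrightarrow> t \<notin> N \<Longrightarrow> \<exists>X\<in>\<X>. X t = x"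
proof -
  obtain \<C> where \<C>: "\<And>C. C \<in> \<C> \<Longrightarrow> \<exists>L \<gamma>. L-lipschitz_on {0..1} \<gamma> \<and> C = path_image \<gamma> \<inter> quadrant"
    "locally_finite_in (top_of_set quadrant) \<C>" "Ck_on 1 (quadrant - \<Union>\<C>) u"
    using assms unfolding C1_off_Lipschitz_curves_def by blast
  have oq: "open quadrant" unfolding quadrant_def by (intro open_Times) auto
  have "closedin (top_of_set quadrant) (\<Union>\<C>)"
  proof (rule closedin_locally_finite_Union[OF _ \<C>(2)])
    fix C assume "C \<in> \<C>"
    then obtain L \<gamma> where \<gamma>: "L-lipschitz_on {0..1} \<gamma>" "C = path_image \<gamma> \<inter> quadrant" using \<C>(1) by blast
    have "path \<gamma>" unfolding path_def using \<gamma>(1) by (rule lipschitz_on_continuous_on)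
    then have "closed (path_image \<gamma>)" by (rule closed_path_image)
    then show "closedin (top_of_set quadrant) C"
      unfolding \<gamma>(2) by (metis Int_commute closedin_closed_Int)
  qed
  then have "openin (top_of_set quadrant) (quadrant - \<Union>\<C>)" by (simp add: openin_diff)
  then have open_C: "open (quadrant - \<Union>\<C>)" using oq openin_open_trans by blast
  have cont: "continuous_on (quadrant - \<Union>\<C>) (\<lambda>(x, t). u x t)"
  proof -
    obtain D :: "nat \<Rightarrow> nat \<Rightarrow> real \<Rightarrow> real \<Rightarrow> real" where
      D: "\<forall>(x, t)\<in>quadrant - \<Union>\<C>. D 0 0 x t = u x t"
      "\<forall>i j. enat (i + j) \<le> 1 \<longrightarrow> continuous_on (quadrant - \<Union>\<C>) (\<lambda>(x, t). D i j x t)"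
      using \<C>(3) unfolding Ck_on_def by blast
    have "continuous_on (quadrant - \<Union>\<C>) (\<lambda>(x, t). D 0 0 x t)"
      using D(2)[rule_format, of 0 0] by (simp add: zero_enat_def[symmetric])
    then show ?thesis
      by (rule continuous_on_eq) (use D(1) in auto)
  qed
  have "\<forall>C\<in>\<C>. \<exists>\<X> N. countable \<X> \<and> negligible N \<and> (\<forall>X\<in>\<X>. \<exists>L. L-lipschitz_on UNIV X) \<and>
      (\<forall>X\<in>\<X>. \<exists>c>0. \<forall>t. c \<le> X t) \<and> (\<forall>x t. (x, t) \<in> C \<longrightarrow> t \<notin> N \<longrightarrow> (\<exists>X\<in>\<X>. X t = x))"
  proof
    fix C assume "C \<in> \<C>"
    then obtain L \<gamma> where \<gamma>: "L-lipschitz_on {0..1} \<gamma>" "C = path_image \<gamma> \<inter> quadrant" using \<C>(1) by blast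
    obtain \<X> N where "countable \<X>" "negligible N"
      "\<And>X. X \<in> \<X> \<Longrightarrow> \<exists>L. L-lipschitz_on UNIV X" "\<And>X. X \<in> \<X> \<Longrightarrow> \<exists>c>0. \<forall>t. c \<le> X t"
      "\<And>x t. (x, t) \<in> \<gamma> ` {0..1} \<Longrightarrow> 0 < x \<Longrightarrow> t \<notin> N \<Longrightarrow> \<exists>X\<in>\<X>. X t = x"
      using lipschitz_arc_covered_by_graphs[OF \<gamma>(1)] by metis
    then show "\<exists>\<X> N. countable \<X> \<and> negligible N \<and> (\<forall>X\<in>\<X>. \<exists>L. L-lipschitz_on UNIV X) \<and>
      (\<forall>X\<in>\<X>. \<exists>c>0. \<forall>t. c \<le> X t) \<and> (\<forall>x t. (x, t) \<in> C \<longrightarrow> t \<notin> N \<longrightarrow> (\<exists>X\<in>\<X>. X t = x))"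
      unfolding \<gamma>(2) path_image_def quadrant_def
      by (intro exI[of _ \<X>] exI[of _ N]) auto
  qed
  from bchoice[OF this] obtain \<X> where "\<forall>C\<in>\<C>. \<exists>N. countable (\<X> C) \<and> negligible N \<and> (\<forall>X\<in>\<X> C. \<exists>L. L-lipschitz_on UNIV X) \<and>
      (\<forall>X\<in>\<X> C. \<exists>c>0. \<forall>t. c \<le> X t) \<and> (\<forall>x t. (x, t) \<in> C \<longrightarrow> t \<notin> N \<longrightarrow> (\<exists>X\<in>\<X> C. X t = x))" ..
  from bchoice[OF this] obtain N where N: "\<forall>C\<in>\<C>. countable (\<X> C) \<and> negligible (N C) \<and> (\<forall>X\<in>\<X> C. \<exists>L. L-lipschitz_on UNIV X) \<and>
      (\<forall>X\<in>\<X> C. \<exists>c>0. \<forall>t. c \<le> X t) \<and> (\<forall>x t. (x, t) \<in> C \<longrightarrow> t \<notin> N C \<longrightarrow> (\<exists>X\<in>\<X> C. X t = x))" ..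
  have *: "countable (\<X> C)" "negligible (N C)" if "C \<in> \<C>" for C
    using N that by simp_all
  have cC: "countable \<C>" using \<C>(2) by (rule countable_locally_finite_family)
  show ?thesis
  proof (rule that[OF open_C cont, of "\<Union>(\<X> ` \<C>)" "\<Union>(N ` \<C>)"])
    show "countable (\<Union>(\<X> ` \<C>))" using cC *(1) by (rule countable_UN)
    show "negligible (\<Union>(N ` \<C>))" using cC *(2) by (intro negligible_countable_Union) auto
    show "\<exists>L. L-lipschitz_on UNIV X" if "X \<in> \<Union>(\<X> ` \<C>)" for X
      using that N by auto
    show "\<exists>c>0. \<forall>t. c \<le> X t" if "X \<in> \<Union>(\<X> ` \<C>)" for X
      using that N by auto
    fix x t assume "(x, t) \<in> \<Union>\<C>" and t: "t \<notin> \<Union>(N ` \<C>)"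
    then obtain C where C: "C \<in> \<C>" "(x, t) \<in> C" by blast
    then have "\<exists>X\<in>\<X> C. X t = x" using N t by auto
    then show "\<exists>X\<in>\<Union>(\<X> ` \<C>). X t = x" using C(1) by auto
  qed
qed

section \<open>Smooth cutoff functions\<close>

text \<open>A smooth function is carried together with its derivatives of all orders, because
  \<open>Ck_on\<close> asks for such a family: for a product test function it consists of the
  products of the i-th derivative in x and the j-th in t.\<close>

definition smooth_derivs :: "(nat \<Rightarrow> real \<Rightarrow> real) \<Rightarrow> bool" where
  "smooth_derivs D \<longleftrightarrow> (\<forall>n x. (D n has_real_derivative D (Suc n) x) (at x))"

lemma smooth_derivsD: "smooth_derivs D \<Longrightarrow> (D n has_real_derivative D (Suc n) x) (at x)"
  by (simp add: smooth_derivs_def)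

lemma smooth_derivs_affine:
  assumes "smooth_derivs D"
  shows "smooth_derivs (\<lambda>n x. a ^ n * D n (a * x + b))"
  unfolding smooth_derivs_def
proof (intro allI)
  fix n x
  have "((\<lambda>x. a * x + b) has_real_derivative a) (at x)" by (auto intro!: derivative_eq_intros)
  from DERIV_chain2[OF smooth_derivsD[OF assms] this]
  have "((\<lambda>x. D n (a * x + b)) has_real_derivative D (Suc n) (a * x + b) * a) (at x)" .
  from DERIV_cmult[OF this, of "a ^ n"]
  show "((\<lambda>x. a ^ n * D n (a * x + b)) has_real_derivative a ^ Suc n * D (Suc n) (a * x + b)) (at x)"
    by (simp add: mult_ac)
qed

lemma smooth_derivs_diff:
  assumes "smooth_derivs D" "smooth_derivs E"
  shows "smooth_derivs (\<lambda>n x. D n x - E n x)"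
  using assms unfolding smooth_derivs_def by (auto intro: DERIV_diff)

text \<open>The derivatives of a product are sums over the index pairs that Leibniz' rule generates.\<close>

lemma smooth_derivs_mult:
  assumes "smooth_derivs D" "smooth_derivs E"
  obtains F where "smooth_derivs F" "\<And>x. F 0 x = D 0 x * E 0 x"
proof -
  define step where "step = (\<lambda>ps::(nat \<times> nat) list. concat (map (\<lambda>(i, j). [(Suc i, j), (i, Suc j)]) ps))"
  define L where "L n = (step ^^ n) [(0, 0)]" for n
  define S where "S ps x = (\<Sum>(i, j)\<leftarrow>ps. D i x * E j x)" for ps x
  have "(S ps has_real_derivative S (step ps) x) (at x)" for ps x
  proof (induction ps)
    case (Cons p ps)
    obtain i j where p: "p = (i, j)" by fastforce
    have "((\<lambda>x. D i x * E j x + S ps x) has_real_derivative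
        (D (Suc i) x * E j x + D i x * E (Suc j) x) + S (step ps) x) (at x)"
      by (rule DERIV_add[OF DERIV_cong[OF DERIV_mult[OF smooth_derivsD[OF assms(1)] smooth_derivsD[OF assms(2)]]] Cons.IH])
         simp
    then show ?case by (simp add: S_def step_def p add.assoc)
  qed (simp add: S_def step_def)
  then have "smooth_derivs (\<lambda>n. S (L n))" unfolding smooth_derivs_def by (simp add: L_def)
  moreover have "S (L 0) x = D 0 x * E 0 x" for x by (simp add: S_def L_def)
  ultimately show ?thesis using that by blast
qed

lemma poly_div_exp_tendsto_0: "((\<lambda>x::real. poly p x / exp x) \<longlongrightarrow> 0) at_top"
proof -
  have "((\<lambda>x::real. \<Sum>i\<le>degree p. coeff p i * (x ^ i / exp x)) \<longlongrightarrow> (\<Sum>i\<le>degree p. coeff p i * 0)) at_top"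
    by (intro tendsto_sum tendsto_mult tendsto_const tendsto_power_div_exp_0)
  then show ?thesis by (simp add: poly_altdef sum_divide_distrib)
qed

lemma smooth_derivs_exp_inverse:
  obtains D where "smooth_derivs D" "\<And>x. D 0 x = (if 0 < x then exp (- (1 / x)) else 0)"
proof -
  \<comment> \<open>With z = 1 / x, the derivative of p(z) exp(-z) with respect to x is z^2 (p(z) -
    p'(z)) exp(-z); this is the recursion for the polynomial factor.\<close>
  define P :: "nat \<Rightarrow> real poly" where "P n = ((\<lambda>p. [:0, 0, 1:] * (p - pderiv p)) ^^ n) 1" for n
  define D where "D n x = (if 0 < x then poly (P n) (1 / x) * exp (- (1 / x)) else 0)" for n and x :: real
  have "(D n has_real_derivative D (Suc n) x) (at x)" for n x
  proof -
    consider "x < 0" | "x = 0" | "0 < x" by linarith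
    then show ?thesis
    proof cases
      case 1
      have "((\<lambda>_. 0) has_real_derivative D (Suc n) x) (at x)" using 1 by (simp add: D_def)
      then show ?thesis
        by (rule has_field_derivative_transform_within_open[where S="{..<0}"]) (use 1 in \<open>auto simp: D_def\<close>)
    next
      case 2
      have "((\<lambda>y. D n y / y) \<longlongrightarrow> 0) (at_right 0)"
      proof -
        have "((\<lambda>y. poly ([:0, 1:] * P n) (inverse y) / exp (inverse y)) \<longlongrightarrow> 0) (at_right 0)"
          by (rule filterlim_compose[OF poly_div_exp_tendsto_0 filterlim_inverse_at_top_right])
        then show ?thesis
          by (rule Lim_transform_eventually)
             (auto simp: eventually_at_right_field D_def exp_minus divide_inverse intro!: exI[of _ 1])
      qed
      moreover have "((\<lambda>y. D n y / y) \<longlongrightarrow> 0) (at_left 0)"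
        by (rule Lim_transform_eventually[OF tendsto_const])
           (auto simp: eventually_at_left_field D_def intro!: exI[of _ "-1"])
      ultimately have "((\<lambda>y. D n y / y) \<longlongrightarrow> 0) (at 0)" by (simp add: filterlim_split_at)
      then show ?thesis using 2 by (simp add: has_field_derivative_iff D_def)
    next
      case 3
      have inv: "((\<lambda>x. 1 / x) has_real_derivative - (1 / x) * (1 / x)) (at x)"
        using 3 by (auto intro!: derivative_eq_intros simp: power2_eq_square)
      have "((\<lambda>x. poly (P n) (1 / x) * exp (- (1 / x))) has_real_derivative
          poly (pderiv (P n)) (1 / x) * (- (1 / x) * (1 / x)) * exp (- (1 / x)) +
          exp (- (1 / x)) * - (- (1 / x) * (1 / x)) * poly (P n) (1 / x)) (at x)"
        by (intro DERIV_mult DERIV_chain2[OF poly_DERIV inv] DERIV_chain2[OF DERIV_exp DERIV_minus[OF inv]])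
      also have "poly (pderiv (P n)) (1 / x) * (- (1 / x) * (1 / x)) * exp (- (1 / x)) +
          exp (- (1 / x)) * - (- (1 / x) * (1 / x)) * poly (P n) (1 / x) = D (Suc n) x"
        using 3 by (simp add: D_def P_def algebra_simps)
      finally show ?thesis
        by (rule has_field_derivative_transform_within_open[where S="{0<..}"]) (use 3 in \<open>auto simp: D_def\<close>)
    qed
  qed
  then have "smooth_derivs D" by (simp add: smooth_derivs_def)
  moreover have "D 0 x = (if 0 < x then exp (- (1 / x)) else 0)" for x by (simp add: D_def P_def)
  ultimately show ?thesis using that by blast
qed

lemma smooth_derivs_imp_continuous: "smooth_derivs D \<Longrightarrow> continuous_on S (D n)"
  by (meson DERIV_isCont continuous_at_imp_continuous_on smooth_derivsD)

lemma smooth_step: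
  obtains H where "smooth_derivs H" "\<And>x. x \<le> 0 \<Longrightarrow> H 0 x = 0" "\<And>x. 1 \<le> x \<Longrightarrow> H 0 x = 1"
    "\<And>x. 0 \<le> H 1 x" "\<And>x. x \<le> 0 \<or> 1 \<le> x \<Longrightarrow> H 1 x = 0" "\<And>x. 0 \<le> H 0 x \<and> H 0 x \<le> 1"
proof -
  obtain D where D: "smooth_derivs D" "\<And>x. D 0 x = (if 0 < x then exp (- (1 / x)) else 0)"
    using smooth_derivs_exp_inverse by metis
  \<comment> \<open>The product with the reflected function is a bump supported in [0, 1]; the step
    is its normalised primitive.\<close>
  obtain F where F: "smooth_derivs F" "\<And>x. F 0 x = D 0 x * D 0 (- x + 1)"
    using smooth_derivs_mult[OF D(1) smooth_derivs_affine[OF D(1), of "-1" 1]] by auto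
  have F0: "F 0 x = 0" if "x \<le> 0 \<or> 1 \<le> x" for x using that by (auto simp: F(2) D(2))
  have F_nonneg: "0 \<le> F 0 x" for x by (simp add: F(2) D(2))
  have F_pos: "0 < F 0 x" if "0 < x" "x < 1" for x using that by (simp add: F(2) D(2))
  note F_cont = smooth_derivs_imp_continuous[OF F(1)]
  have F_int: "F 0 integrable_on {a..b}" for a b using F_cont by (rule integrable_continuous_real)
  define c where "c = integral {0..1} (F 0)"
  have "c \<noteq> 0"
  proof
    assume "c = 0"
    then have "F 0 (1 / 2) = 0"
      using integral_eq_0_iff[OF F_cont[of "{0..1}"]] F_nonneg by (simp add: c_def)
    then show False using F_pos[of "1 / 2"] by simp
  qed
  moreover have "0 \<le> c" unfolding c_def using F_int F_nonneg by (intro Henstock_Kurzweil_Integration.integral_nonneg) auto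
  ultimately have c: "0 < c" by simp
  \<comment> \<open>Starting the integral at -1 rather than at 0 makes every x >= 0 an interior
    point for the fundamental theorem of calculus.\<close>
  define J where "J x = integral {-1..x} (F 0) / c" for x
  have J0: "J x = 0" if "x \<le> 0" for x
  proof -
    have "integral {-1..x} (F 0) = integral {-1..x} (\<lambda>_. 0)"
      by (rule integral_cong) (use that F0 in auto)
    then show ?thesis by (simp add: J_def)
  qed
  have J1: "J x = 1" if "1 \<le> x" for x
  proof -
    have "integral {-1..x} (F 0) = integral {-1..0} (F 0) + (integral {0..1} (F 0) + integral {1..x} (F 0))"
      using that F_int by (simp add: Henstock_Kurzweil_Integration.integral_combine)
    moreover have "integral {-1..0} (F 0) = integral {-1..0::real} (\<lambda>_. 0)"
      by (rule integral_cong) (use F0 in auto)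
    moreover have "integral {1..x} (F 0) = integral {1..x} (\<lambda>_. 0)"
      by (rule integral_cong) (use F0 in auto)
    ultimately show ?thesis using c by (simp add: J_def c_def)
  qed
  have J_der: "(J has_real_derivative F 0 x / c) (at x)" for x
  proof (cases "x < 0")
    case True
    have "((\<lambda>_. 0) has_real_derivative F 0 x / c) (at x)" using True F0 by simp
    then show ?thesis
      by (rule has_field_derivative_transform_within_open[where S="{..<0}"]) (use True J0 in auto)
  next
    case False
    have "((\<lambda>u. integral {-1..u} (F 0)) has_real_derivative F 0 x) (at x within {-1..x+1})"
      using False F_cont by (intro integral_has_real_derivative) auto
    then have "((\<lambda>u. integral {-1..u} (F 0)) has_real_derivative F 0 x) (at x)"
      using False at_within_interior[of x "{-1..x+1}"] by simp
    then show ?thesis unfolding J_def by (rule DERIV_cdivide)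
  qed
  define H where "H n = (case n of 0 \<Rightarrow> J | Suc k \<Rightarrow> \<lambda>x. F k x / c)" for n
  have "smooth_derivs H"
    unfolding smooth_derivs_def
  proof (intro allI)
    fix n x
    show "(H n has_real_derivative H (Suc n) x) (at x)"
      using J_der DERIV_cdivide[OF smooth_derivsD[OF F(1)]] by (cases n) (auto simp: H_def)
  qed
  moreover have "0 \<le> J x \<and> J x \<le> 1" for x
  proof -
    have mono: "J x \<le> J y" if "x \<le> y" for x y
      using that J_der F_nonneg c by (intro DERIV_nonneg_imp_nondecreasing[of x y J]) (auto intro: divide_nonneg_nonneg less_imp_le)
    show ?thesis using mono[of "min x 0" x] mono[of x "max x 1"] J0[of "min x 0"] J1[of "max x 1"] by simp
  qed
  ultimately show ?thesis
    using that[of H] J0 J1 F0 F_nonneg c by (simp add: H_def)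
qed

section \<open>Hamilton-Jacobi potentials\<close>

text \<open>Applied below with N = {0}: traces are controlled at positive times only, so bounds and
  limits of integrands in t are available off t = 0.\<close>

lemma dominated_convergence_off_negligible:
  fixes f :: "nat \<Rightarrow> 'n::euclidean_space \<Rightarrow> 'm::euclidean_space"
  assumes f: "\<And>k. (f k) integrable_on S" and h: "h integrable_on S" and N: "negligible N"
    and le: "\<And>k x. x \<in> S - N \<Longrightarrow> norm (f k x) \<le> h x"
    and conv: "\<And>x. x \<in> S - N \<Longrightarrow> (\<lambda>k. f k x) \<longlonglongrightarrow> g x"
  shows "g integrable_on S" "(\<lambda>k. integral S (f k)) \<longlonglongrightarrow> integral S g"
proof -
  let ?z = "\<lambda>k x. if x \<in> N then 0 else k x"
  have 1: "?z (f k) integrable_on S" for k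
    by (rule integrable_spike[OF f N]) auto
  have 2: "?z h integrable_on S"
    by (rule integrable_spike[OF h N]) auto
  have 3: "norm (?z (f k) x) \<le> ?z h x" if "x \<in> S" for k x
    using le that by auto
  have 4: "(\<lambda>k. ?z (f k) x) \<longlonglongrightarrow> ?z g x" if "x \<in> S" for x
    using conv that by auto
  have eq: "integral S (?z k) = integral S k" for k :: "'n \<Rightarrow> 'm"
    by (rule integral_spike[OF N]) auto
  from dominated_convergence[OF 1 2 3 4]
  have "?z g integrable_on S" and "(\<lambda>k. integral S (f k)) \<longlonglongrightarrow> integral S g" by (simp_all only: eq)
  then show "g integrable_on S" "(\<lambda>k. integral S (f k)) \<longlonglongrightarrow> integral S g"
    by (auto intro: integrable_spike[OF _ N])
qed

text \<open>Cutting [a, b] into n + 1 equal pieces bounds the total increment by a constant over n +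
  1. This serves where a first-order expansion with quadratic error is at hand.\<close>

lemma const_if_quadratic_bound:
  fixes P :: "real \<Rightarrow> real"
  assumes "\<And>s t. a \<le> s \<Longrightarrow> s \<le> t \<Longrightarrow> t \<le> b \<Longrightarrow> \<bar>P t - P s\<bar> \<le> C * (t - s)\<^sup>2" and ab: "a \<le> b"
  shows "P b = P a"
proof -
  have "\<bar>P b - P a\<bar> \<le> C * (b - a)\<^sup>2 / real (Suc n)" for n
  proof -
    define p where "p i = a + (b - a) * (real i / real (Suc n))" for i
    have p: "p (Suc i) - p i = (b - a) / real (Suc n)" for i
    proof -
      have "real (Suc i) = real i + 1" by simp
      then show ?thesis unfolding p_def by (simp only: add_divide_distrib distrib_left) simp
    qed
    have "P b - P a = (\<Sum>i<Suc n. P (p (Suc i)) - P (p i))"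
    proof -
      have "p (Suc n) = b" unfolding p_def by (subst divide_self) auto
      moreover have "p 0 = a" by (simp add: p_def)
      ultimately show ?thesis
        using sum_lessThan_telescope[of "\<lambda>i. P (p i)" "Suc n"] by (simp only:)
    qed
    also have "\<bar>\<dots>\<bar> \<le> (\<Sum>i<Suc n. C * ((b - a) / real (Suc n))\<^sup>2)"
    proof (rule order_trans[OF sum_abs sum_mono])
      fix i assume i: "i \<in> {..<Suc n}"
      have "a \<le> p i" using ab by (simp add: p_def)
      moreover have "p i \<le> p (Suc i)" using p[of i] ab by (smt (verit) divide_nonneg_nonneg of_nat_0_le_iff)
      moreover have "(b - a) * (real (Suc i) / real (Suc n)) \<le> (b - a) * 1"
        using i ab by (intro mult_left_mono) (auto simp: divide_le_eq)
      then have "p (Suc i) \<le> b" unfolding p_def by simp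
      ultimately show "\<bar>P (p (Suc i)) - P (p i)\<bar> \<le> C * ((b - a) / real (Suc n))\<^sup>2"
        using assms(1)[of "p i" "p (Suc i)"] p[of i] by simp
    qed
    also have "\<dots> = C * (b - a)\<^sup>2 / real (Suc n)"
      by (simp add: power2_eq_square)
    finally show ?thesis .
  qed
  moreover have "(\<lambda>n. C * (b - a)\<^sup>2 / real (Suc n)) \<longlonglongrightarrow> 0"
    by (rule LIMSEQ_Suc[OF lim_const_over_n])
  ultimately have "\<bar>P b - P a\<bar> \<le> 0"
    by (intro LIMSEQ_le_const[of _ 0]) auto
  then show ?thesis by simp
qed

lemma integral_close_to_const:
  fixes g :: "real \<Rightarrow> real"
  assumes int: "g integrable_on {a..b}" and ab: "a \<le> b" and e: "0 \<le> e"
    and close: "\<And>z. a < z \<Longrightarrow> z < b \<Longrightarrow> \<bar>g z - l\<bar> \<le> e"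
  shows "\<bar>integral {a..b} g - (b - a) * l\<bar> \<le> e * (b - a)"
proof -
  have "((\<lambda>z. g z - l) has_integral (integral {a..b} g - (b - a) * l)) (cbox a b)"
    using int ab has_integral_const_real[of l a b]
    by (auto intro!: has_integral_diff integrable_integral simp: mult.commute)
  then have "norm (integral {a..b} g - (b - a) * l) \<le> e * measure lborel (cbox a b)"
    by (rule has_integral_bound_spike_finite[OF e, of "{a, b}", rotated]) (use close in auto)
  then show ?thesis using ab by simp
qed

lemma integral_average_right:
  fixes g :: "real \<Rightarrow> real"
  assumes g: "(g \<longlongrightarrow> l) (at_right x)" and int: "\<And>y. x \<le> y \<Longrightarrow> g integrable_on {x..y}"
  shows "((\<lambda>y. integral {x..y} g / (y - x)) \<longlongrightarrow> l) (at_right x)"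
proof (rule tendstoI)
  fix e :: real assume e: "0 < e"
  have "\<forall>\<^sub>F y in at_right x. dist (g y) l < e / 2" using g e by (intro tendstoD) auto
  then obtain d where d: "d > x" "\<And>y. x < y \<Longrightarrow> y < d \<Longrightarrow> \<bar>g y - l\<bar> < e / 2"
    unfolding eventually_at_right_field by (auto simp: dist_real_def)
  have "dist (integral {x..y} g / (y - x)) l < e" if y: "x < y" "y < d" for y
  proof -
    have "\<bar>integral {x..y} g - (y - x) * l\<bar> \<le> e / 2 * (y - x)"
      using int[of y] y e d(2) by (intro integral_close_to_const) (auto intro: less_imp_le)
    also have "\<dots> < e * (y - x)" using e y by simp
    finally have "\<bar>integral {x..y} g - (y - x) * l\<bar> < e * (y - x)" .
    moreover have "integral {x..y} g / (y - x) - l = (integral {x..y} g - (y - x) * l) / (y - x)"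
      using y by (simp add: field_simps)
    ultimately show ?thesis
      using y by (simp add: dist_real_def abs_divide divide_less_eq)
  qed
  then show "\<forall>\<^sub>F y in at_right x. dist (integral {x..y} g / (y - x)) l < e"
    unfolding eventually_at_right_field using d(1) by blast
qed

lemma integral_average_left:
  fixes g :: "real \<Rightarrow> real"
  assumes g: "(g \<longlongrightarrow> l) (at_left x)" and "c < x" and int: "\<And>y. c \<le> y \<Longrightarrow> y \<le> x \<Longrightarrow> g integrable_on {y..x}"
  shows "((\<lambda>y. integral {y..x} g / (x - y)) \<longlongrightarrow> l) (at_left x)"
proof (rule tendstoI)
  fix e :: real assume e: "0 < e"
  have "\<forall>\<^sub>F y in at_left x. dist (g y) l < e / 2" using g e by (intro tendstoD) auto
  then obtain d where d: "d < x" "\<And>y. d < y \<Longrightarrow> y < x \<Longrightarrow> \<bar>g y - l\<bar> < e / 2"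
    unfolding eventually_at_left_field by (auto simp: dist_real_def)
  have "dist (integral {y..x} g / (x - y)) l < e" if y: "max c d < y" "y < x" for y
  proof -
    have "\<bar>integral {y..x} g - (x - y) * l\<bar> \<le> e / 2 * (x - y)"
      using int[of y] y e d(2) by (intro integral_close_to_const) (auto intro: less_imp_le)
    also have "\<dots> < e * (x - y)" using e y by simp
    finally have "\<bar>integral {y..x} g - (x - y) * l\<bar> < e * (x - y)" .
    moreover have "integral {y..x} g / (x - y) - l = (integral {y..x} g - (x - y) * l) / (x - y)"
      using y by (simp add: field_simps)
    ultimately show ?thesis
      using y by (simp add: dist_real_def abs_divide divide_less_eq)
  qed
  then show "\<forall>\<^sub>F y in at_left x. dist (integral {y..x} g / (x - y)) l < e"
    unfolding eventually_at_left_field using d(1) \<open>c < x\<close> by (intro exI[of _ "max c d"]) auto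
qed

text \<open>
  \<open>ul\<close> and \<open>ur\<close> are the left and right traces of \<open>u\<close> in \<open>x\<close>. Nothing is required of them at \<open>t = 0\<close>,
  where \<open>u\<close> need not have traces.
\<close>

locale potential =
  fixes f w :: "real \<Rightarrow> real" and U ul ur :: "real \<Rightarrow> real \<Rightarrow> real" and T B :: real
  assumes T: "0 < T"
    and f_cont: "continuous_on UNIV f"
    and w_cont: "continuous_on {0..T} w" and w_pos: "\<And>t. 0 \<le> t \<Longrightarrow> t \<le> T \<Longrightarrow> 0 < w t"
    and lip: "\<And>x y s t. 0 \<le> x \<Longrightarrow> 0 \<le> y \<Longrightarrow> 0 \<le> s \<Longrightarrow> s \<le> T \<Longrightarrow> 0 \<le> t \<Longrightarrow> t \<le> T \<Longrightarrow>
      \<bar>U x s - U y t\<bar> \<le> B * (\<bar>x - y\<bar> + \<bar>s - t\<bar>)"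
    and flux_bd: "\<And>x t. 0 \<le> x \<Longrightarrow> 0 < t \<Longrightarrow> t \<le> T \<Longrightarrow> \<bar>w t * f (ur x t)\<bar> \<le> B"
    and dt: "\<And>x s t. 0 \<le> x \<Longrightarrow> 0 \<le> s \<Longrightarrow> s \<le> t \<Longrightarrow> t \<le> T \<Longrightarrow>
      ((\<lambda>\<tau>. w \<tau> * f (ur x \<tau>)) has_integral (U x s - U x t)) {s..t}"
    and dx_right: "\<And>x t. 0 \<le> x \<Longrightarrow> 0 < t \<Longrightarrow> t \<le> T \<Longrightarrow>
      ((\<lambda>y. (U y t - U x t) / (y - x)) \<longlongrightarrow> w t * ur x t) (at_right x)"
    and dx_left: "\<And>x t. 0 < x \<Longrightarrow> 0 < t \<Longrightarrow> t \<le> T \<Longrightarrow>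
      ((\<lambda>y. (U y t - U x t) / (y - x)) \<longlongrightarrow> w t * ul x t) (at_left x)"
    and ur_right: "\<And>x t. 0 \<le> x \<Longrightarrow> 0 < t \<Longrightarrow> t \<le> T \<Longrightarrow> ((\<lambda>y. ur y t) \<longlongrightarrow> ur x t) (at_right x)"
    and ur_left: "\<And>x t. 0 < x \<Longrightarrow> 0 < t \<Longrightarrow> t \<le> T \<Longrightarrow> ((\<lambda>y. ur y t) \<longlongrightarrow> ul x t) (at_left x)"
begin

definition g where "g y t = w t * f (ur y t)"

lemma B_nonneg: "0 \<le> B"
  using flux_bd[of 0 T] T by (meson abs_ge_zero order_refl order_trans)

text \<open>
  The flux is a pointwise limit of these continuous functions, which is how it is seen to be
  integrable and how its integrals in space and time are interchanged.
\<close>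

definition q where
  "q n y t = w t * f ((U (y + inverse (real (Suc n))) t - U y t) * real (Suc n) / w t)" for n :: nat

lemma U_cont: "continuous_on ({0..} \<times> {0..T}) (\<lambda>(x, t). U x t)"
proof -
  have "(B * 2)-lipschitz_on ({0..} \<times> {0..T}) (\<lambda>(x, t). U x t)"
  proof (rule lipschitz_onI)
    fix p p' :: "real \<times> real" assume p: "p \<in> {0..} \<times> {0..T}" "p' \<in> {0..} \<times> {0..T}"
    obtain x s y t where eq: "p = (x, s)" "p' = (y, t)" by fastforce
    have "\<bar>U x s - U y t\<bar> \<le> B * (\<bar>x - y\<bar> + \<bar>s - t\<bar>)" using p lip eq by auto
    also have "\<dots> \<le> B * (2 * dist p p')"
      using dist_fst_le[of p p'] dist_snd_le[of p p'] B_nonneg eq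
      by (intro mult_left_mono) (auto simp: dist_real_def)
    finally show "dist (case p of (x, t) \<Rightarrow> U x t) (case p' of (x, t) \<Rightarrow> U x t) \<le> B * 2 * dist p p'"
      by (simp add: eq dist_real_def)
  qed (use B_nonneg in simp)
  then show ?thesis by (rule lipschitz_on_continuous_on)
qed

lemma U_cont_comp:
  assumes "continuous_on S a" "continuous_on S b" "\<And>z. z \<in> S \<Longrightarrow> 0 \<le> a z \<and> 0 \<le> b z \<and> b z \<le> T"
  shows "continuous_on S (\<lambda>z. U (a z) (b z))"
  by (rule continuous_on_compose2[OF U_cont continuous_on_Pair[OF assms(1,2)], unfolded prod.case]) (use assms(3) in auto)

lemma q_cont_comp:
  assumes "continuous_on S a" "continuous_on S b" "\<And>z. z \<in> S \<Longrightarrow> 0 \<le> a z \<and> 0 \<le> b z \<and> b z \<le> T"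
  shows "continuous_on S (\<lambda>z. q n (a z) (b z))"
proof -
  have w: "continuous_on S (\<lambda>z. w (b z))"
    using assms(3) by (intro continuous_on_compose2[OF w_cont assms(2)]) auto
  have "w (b z) \<noteq> 0" if "z \<in> S" for z using w_pos[of "b z"] assms(3)[OF that] by simp
  moreover have "0 \<le> a z + inverse (real (Suc n))" if "z \<in> S" for z
    using assms(3)[OF that] by (intro add_nonneg_nonneg) auto
  ultimately show ?thesis unfolding q_def
    using assms by (intro continuous_intros w continuous_on_compose2[OF f_cont] U_cont_comp) auto
qed

lemma q_bounded: "\<exists>D. 0 \<le> D \<and> (\<forall>n y t. 0 \<le> y \<longrightarrow> 0 \<le> t \<longrightarrow> t \<le> T \<longrightarrow> \<bar>q n y t\<bar> \<le> D)"
proof -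
  have ne: "{0..T} \<noteq> {}" using T by auto
  obtain tm where tm: "tm \<in> {0..T}" "\<And>t. t \<in> {0..T} \<Longrightarrow> w tm \<le> w t"
    using continuous_attains_inf[OF _ ne w_cont] by auto
  obtain tM where tM: "tM \<in> {0..T}" "\<And>t. t \<in> {0..T} \<Longrightarrow> w t \<le> w tM"
    using continuous_attains_sup[OF _ ne w_cont] by auto
  have wm: "0 < w tm" using w_pos tm by auto
  have "bounded (f ` {- (B / w tm)..B / w tm})"
    by (rule compact_imp_bounded[OF compact_continuous_image[OF continuous_on_subset[OF f_cont subset_UNIV] compact_Icc]])
  then obtain F where F0: "\<forall>y\<in>f ` {- (B / w tm)..B / w tm}. norm y \<le> F"
    unfolding bounded_iff by blast
  have F: "\<bar>f z\<bar> \<le> F" if "\<bar>z\<bar> \<le> B / w tm" for z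
    using bspec[OF F0 imageI[of z]] that by (simp add: abs_le_iff)
  have "\<bar>q n y t\<bar> \<le> w tM * F" if "0 \<le> y" "0 \<le> t" "t \<le> T" for n y t
  proof -
    have wt: "w tm \<le> w t" "w t \<le> w tM" "0 < w t" using tm tM w_pos that by auto
    have "\<bar>U (y + inverse (real (Suc n))) t - U y t\<bar> \<le> B * inverse (real (Suc n))"
      using lip[of "y + inverse (real (Suc n))" y t t] that by (simp add: add_nonneg_nonneg)
    then have "\<bar>U (y + inverse (real (Suc n))) t - U y t\<bar> * real (Suc n) \<le> B * inverse (real (Suc n)) * real (Suc n)"
      by (rule mult_right_mono) simp
    also have "\<dots> = B" by (simp only: mult.assoc) simp
    finally have "\<bar>(U (y + inverse (real (Suc n))) t - U y t) * real (Suc n)\<bar> \<le> B"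
      unfolding abs_mult by simp
    then have "\<bar>(U (y + inverse (real (Suc n))) t - U y t) * real (Suc n) / w t\<bar> \<le> B / w t"
      using wt by (simp add: abs_divide divide_right_mono)
    also have "\<dots> \<le> B / w tm" using wt wm B_nonneg by (intro divide_left_mono) auto
    finally have "\<bar>f ((U (y + inverse (real (Suc n))) t - U y t) * real (Suc n) / w t)\<bar> \<le> F" by (rule F)
    then show ?thesis unfolding q_def abs_mult using wt by (intro mult_mono) auto
  qed
  moreover have "0 \<le> w tM * F"
  proof (rule mult_nonneg_nonneg)
    show "0 \<le> w tM" using w_pos[of tM] tM by simp
    show "0 \<le> F" using F[of 0] B_nonneg wm by (simp add: order_trans[OF abs_ge_zero])
  qed
  ultimately show ?thesis by blast
qed

lemma inverse_Suc_at_right: "filterlim (\<lambda>n. y + inverse (real (Suc n))) (at_right y) sequentially"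
  unfolding filterlim_at
  using tendsto_add[OF tendsto_const[of y] LIMSEQ_inverse_real_of_nat] by (auto intro: always_eventually)

lemma q_lim:
  assumes "0 \<le> y" "0 < t" "t \<le> T"
  shows "(\<lambda>n. q n y t) \<longlonglongrightarrow> g y t"
proof -
  have "(\<lambda>n. (U (y + inverse (real (Suc n))) t - U y t) / (y + inverse (real (Suc n)) - y)) \<longlonglongrightarrow> w t * ur y t"
    by (rule filterlim_compose[OF dx_right[OF assms] inverse_Suc_at_right])
  then have "(\<lambda>n. (U (y + inverse (real (Suc n))) t - U y t) * real (Suc n) / w t) \<longlonglongrightarrow> w t * ur y t / w t"
    by (intro tendsto_divide) (use w_pos[of t] assms in \<open>auto simp: divide_inverse\<close>)
  then have "(\<lambda>n. (U (y + inverse (real (Suc n))) t - U y t) * real (Suc n) / w t) \<longlonglongrightarrow> ur y t"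
    using w_pos[of t] assms by simp
  then show ?thesis unfolding q_def g_def
    by (intro tendsto_mult tendsto_const continuous_on_tendsto_compose[OF f_cont]) auto
qed

section \<open>Spatial primitives of the flux and of the potential\<close>

definition G where "G x t = integral {0..x} (\<lambda>y. g y t)"

lemma g_integrable: 
  assumes "0 \<le> a" "0 < t" "t \<le> T"
  shows "(\<lambda>y. g y t) integrable_on {a..b}" "(\<lambda>n. integral {a..b} (\<lambda>y. q n y t)) \<longlonglongrightarrow> integral {a..b} (\<lambda>y. g y t)"
proof -
  obtain D where D: "\<And>n y t. 0 \<le> y \<Longrightarrow> 0 \<le> t \<Longrightarrow> t \<le> T \<Longrightarrow> \<bar>q n y t\<bar> \<le> D" using q_bounded by blast
  have 1: "(\<lambda>y. q n y t) integrable_on {a..b}" for n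
    using assms by (intro integrable_continuous_real q_cont_comp continuous_intros) auto
  show "(\<lambda>y. g y t) integrable_on {a..b}" "(\<lambda>n. integral {a..b} (\<lambda>y. q n y t)) \<longlonglongrightarrow> integral {a..b} (\<lambda>y. g y t)"
    using dominated_convergence[of "\<lambda>n y. q n y t" "{a..b}" "\<lambda>_. D" "\<lambda>y. g y t", OF 1 integrable_const_ivl] assms D
    by (simp_all add: q_lim)
qed

lemma g_bd: "0 \<le> y \<Longrightarrow> 0 < t \<Longrightarrow> t \<le> T \<Longrightarrow> \<bar>g y t\<bar> \<le> B"
  using flux_bd by (simp add: g_def)

lemma G_diff:
  assumes "0 \<le> x" "x \<le> y" "0 < t" "t \<le> T"
  shows "G y t - G x t = integral {x..y} (\<lambda>z. g z t)"
  using Henstock_Kurzweil_Integration.integral_combine[of 0 x y "\<lambda>z. g z t"] g_integrable(1)[of 0 t y] assms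
  by (simp add: G_def)

lemma G_lip:
  assumes "0 \<le> x" "0 \<le> y" "0 < t" "t \<le> T"
  shows "\<bar>G x t - G y t\<bar> \<le> B * \<bar>x - y\<bar>"
proof -
  have *: "\<bar>G y t - G x t\<bar> \<le> B * (y - x)" if "0 \<le> x" "x \<le> y" for x y
    using integral_close_to_const[of "\<lambda>z. g z t" x y B 0] g_integrable(1)[of x t y] that assms(3,4) g_bd B_nonneg
    by (simp add: G_diff)
  show ?thesis using *[of x y] *[of y x] assms by (cases "x \<le> y") (auto simp: abs_minus_commute)
qed

text \<open>For the approximations \<open>q n\<close>, rescaling the moving interval [0, X \<tau>]
  to [0, 1] turns the integral into one with a continuous parameter. Dominated convergence then
  carries integrability in \<tau> over to the flux.\<close>

lemma G_comp_integrable: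
  assumes X: "continuous_on {s..t} X" "\<And>\<tau>. s \<le> \<tau> \<Longrightarrow> \<tau> \<le> t \<Longrightarrow> 0 \<le> X \<tau>" and st: "0 \<le> s" "t \<le> T"
  shows "(\<lambda>\<tau>. G (X \<tau>) \<tau>) integrable_on {s..t}"
    "(\<lambda>n. integral {s..t} (\<lambda>\<tau>. integral {0..X \<tau>} (\<lambda>y. q n y \<tau>))) \<longlonglongrightarrow> integral {s..t} (\<lambda>\<tau>. G (X \<tau>) \<tau>)"
proof -
  obtain D where D: "0 \<le> D" "\<And>n y t. 0 \<le> y \<Longrightarrow> 0 \<le> t \<Longrightarrow> t \<le> T \<Longrightarrow> \<bar>q n y t\<bar> \<le> D" using q_bounded by blast
  have qi: "(\<lambda>y. q n y \<tau>) integrable_on {0..b}" if "s \<le> \<tau>" "\<tau> \<le> t" for n \<tau> b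
    using that st by (intro integrable_continuous_real q_cont_comp continuous_intros) auto
  have eq: "integral {0..X \<tau>} (\<lambda>y. q n y \<tau>) = X \<tau> * integral {0..1} (\<lambda>z. q n (X \<tau> * z) \<tau>)"
    if "\<tau> \<in> {s..t}" for n \<tau>
  proof (cases "X \<tau> = 0")
    case False
    then have pos: "0 < X \<tau>" using X(2)[of \<tau>] that by auto
    have "((\<lambda>y. q n y \<tau>) has_integral integral {0..X \<tau>} (\<lambda>y. q n y \<tau>)) (cbox 0 (X \<tau>))"
      using qi that by (simp add: integrable_integral)
    note aff = has_integral_affinity[OF this False, of 0]
    have "((\<lambda>z. q n (X \<tau> * z) \<tau>) has_integral (integral {0..X \<tau>} (\<lambda>y. q n y \<tau>) / X \<tau>)) {0..1}"
    proof -
      have "(\<lambda>x. x * inverse (X \<tau>)) ` {0..X \<tau>} = {0..1}"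
      proof (intro equalityI subsetI)
        fix z :: real assume "z \<in> {0..1}"
        then show "z \<in> (\<lambda>x. x * inverse (X \<tau>)) ` {0..X \<tau>}"
          using pos by (intro image_eqI[of _ _ "z * X \<tau>"]) (auto simp: mult_le_cancel_right1)
      qed (use pos in \<open>auto simp: field_simps\<close>)
      then show ?thesis using aff pos by (simp add: divide_inverse mult.commute)
    qed
    from integral_unique[OF this] show ?thesis using False by simp
  qed simp
  have "continuous_on {s..t} (\<lambda>\<tau>. integral (cbox 0 1) (\<lambda>z. q n (X \<tau> * z) \<tau>))" for n
    using X(2) st
    by (intro integral_continuous_on_param, unfold split_beta, intro q_cont_comp continuous_intros continuous_on_compose2[OF X(1)]) auto
  then have cont: "continuous_on {s..t} (\<lambda>\<tau>. integral {0..X \<tau>} (\<lambda>y. q n y \<tau>))" for n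
    using X(1) by (subst continuous_on_cong[OF refl eq]) (auto intro!: continuous_intros)
  have "bounded (X ` {s..t})"
    by (rule compact_imp_bounded[OF compact_continuous_image[OF X(1) compact_Icc]])
  then obtain M where M0: "\<forall>y\<in>X ` {s..t}. norm y \<le> M"
    unfolding bounded_iff by blast
  have M: "\<bar>X \<tau>\<bar> \<le> M" if "s \<le> \<tau>" "\<tau> \<le> t" for \<tau>
    using bspec[OF M0 imageI[of \<tau>]] that by simp
  have bd: "norm (integral {0..X \<tau>} (\<lambda>y. q n y \<tau>)) \<le> D * M" if "\<tau> \<in> {s..t}" for n \<tau>
  proof -
    have "\<bar>integral {0..X \<tau>} (\<lambda>y. q n y \<tau>) - (X \<tau> - 0) * 0\<bar> \<le> D * (X \<tau> - 0)"
    proof (rule integral_close_to_const)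
      show "(\<lambda>y. q n y \<tau>) integrable_on {0..X \<tau>}" using qi that by simp
      show "0 \<le> X \<tau>" using X(2) that by simp
      show "\<bar>q n z \<tau> - 0\<bar> \<le> D" if "0 < z" for z
        using D(2)[of z \<tau> n] that \<open>\<tau> \<in> {s..t}\<close> st by simp
    qed (rule D(1))
    also have "\<dots> \<le> D * M" using that M[of \<tau>] D by (intro mult_left_mono) auto
    finally show ?thesis by simp
  qed
  have lim: "(\<lambda>n. integral {0..X \<tau>} (\<lambda>y. q n y \<tau>)) \<longlonglongrightarrow> G (X \<tau>) \<tau>" if "\<tau> \<in> {s..t} - {0}" for \<tau>
    unfolding G_def using that st by (intro g_integrable(2)) auto
  show "(\<lambda>\<tau>. G (X \<tau>) \<tau>) integrable_on {s..t}"
    "(\<lambda>n. integral {s..t} (\<lambda>\<tau>. integral {0..X \<tau>} (\<lambda>y. q n y \<tau>))) \<longlonglongrightarrow> integral {s..t} (\<lambda>\<tau>. G (X \<tau>) \<tau>)"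
    using dominated_convergence_off_negligible[of "\<lambda>n \<tau>. integral {0..X \<tau>} (\<lambda>y. q n y \<tau>)" "{s..t}" "\<lambda>_. D * M" "{0}" "\<lambda>\<tau>. G (X \<tau>) \<tau>",
        OF integrable_continuous_real[OF cont] integrable_const_ivl negligible_sing bd lim] by auto
qed

text \<open>A second integration in x, so that the x-derivative of \<open>K\<close> is
  \<open>U\<close> and its t-derivative is \<open>- G\<close>. Unlike \<open>U\<close>, it has an
  expansion in x with quadratic error, which suffices for a chain rule along any Lipschitz curve;
  difference quotients in x then lead back to \<open>U\<close>.\<close>

definition K where "K x t = integral {0..x} (\<lambda>y. U y t)"

lemma U_x_integrable: "0 \<le> a \<Longrightarrow> 0 \<le> t \<Longrightarrow> t \<le> T \<Longrightarrow> (\<lambda>y. U y t) integrable_on {a..b}"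
  by (intro integrable_continuous_real U_cont_comp continuous_intros) auto

text \<open>For the continuous approximations \<open>q n\<close> the two integrations may be
  exchanged, and both iterated integrals pass to the limit by dominated convergence.\<close>

lemma K_dt:
  assumes x: "0 \<le> x" and st: "0 \<le> s" "s \<le> t" "t \<le> T"
  shows "K x t - K x s = - integral {s..t} (G x)"
proof -
  obtain D where D: "0 \<le> D" "\<And>n y t. 0 \<le> y \<Longrightarrow> 0 \<le> t \<Longrightarrow> t \<le> T \<Longrightarrow> \<bar>q n y t\<bar> \<le> D" using q_bounded by blast
  have swap: "integral {0..x} (\<lambda>y. integral {s..t} (q n y)) = integral {s..t} (\<lambda>\<tau>. integral {0..x} (\<lambda>y. q n y \<tau>))" for n
  proof -
    have "continuous_on (cbox (0, s) (x, t)) (\<lambda>(y, \<tau>). q n y \<tau>)"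
      unfolding split_beta using st by (intro q_cont_comp continuous_intros) (auto simp: cbox_Pair_eq)
    from integral_swap_continuous[OF this] show ?thesis by simp
  qed
  have qi: "q n y integrable_on {s..t}" if "0 \<le> y" for n y
    using that st by (intro integrable_continuous_real q_cont_comp[where a="\<lambda>_. y" and b="\<lambda>\<tau>. \<tau>"] continuous_intros) auto
  have lim_t: "(\<lambda>n. integral {s..t} (q n y)) \<longlonglongrightarrow> U y s - U y t" if "y \<in> {0..x}" for y
  proof -
    have "(\<lambda>n. integral {s..t} (q n y)) \<longlonglongrightarrow> integral {s..t} (g y)"
      by (rule dominated_convergence_off_negligible(2)[where h="\<lambda>_. D" and N="{0}"])
         (use that st D qi q_lim in auto)
    moreover have "(g y has_integral (U y s - U y t)) {s..t}"
      using dt[of y s t] that st by (simp add: g_def[abs_def])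
    ultimately show ?thesis by (simp add: integral_unique)
  qed
  have "(\<lambda>n. integral {0..x} (\<lambda>y. integral {s..t} (q n y))) \<longlonglongrightarrow> integral {0..x} (\<lambda>y. U y s - U y t)"
  proof (rule dominated_convergence(2)[where h="\<lambda>_. D * (t - s)"])
    show "(\<lambda>y. integral {s..t} (q n y)) integrable_on {0..x}" for n
    proof -
      have "continuous_on {0..x} (\<lambda>y. integral (cbox s t) (q n y))"
        by (rule integral_continuous_on_param, unfold split_beta, rule q_cont_comp)
           (use st in \<open>auto intro!: continuous_intros\<close>)
      then show ?thesis by (simp add: integrable_continuous_real)
    qed
    show "norm (integral {s..t} (q n y)) \<le> D * (t - s)" if "y \<in> {0..x}" for n y
      using integral_close_to_const[of "q n y" s t D 0] that st D qi by simp
  qed (use lim_t in auto)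
  moreover have "(\<lambda>n. integral {0..x} (\<lambda>y. integral {s..t} (q n y))) \<longlonglongrightarrow> integral {s..t} (G x)"
    unfolding swap using G_comp_integrable(2)[of s t "\<lambda>_. x"] x st by simp
  ultimately have "integral {0..x} (\<lambda>y. U y s - U y t) = integral {s..t} (G x)"
    by (rule LIMSEQ_unique)
  then show ?thesis
    unfolding K_def using U_x_integrable[of 0] st by (simp add: Henstock_Kurzweil_Integration.integral_diff)
qed

lemma K_dx:
  assumes "0 \<le> x" "0 \<le> y" "0 \<le> t" "t \<le> T"
  shows "\<bar>K y t - K x t - U x t * (y - x)\<bar> \<le> B * (y - x)\<^sup>2"
proof -
  have *: "K b t - K a t = integral {a..b} (\<lambda>y. U y t)" if "0 \<le> a" "a \<le> b" for a b
    using Henstock_Kurzweil_Integration.integral_combine[of 0 a b "\<lambda>y. U y t"] U_x_integrable[of 0 t b] that assms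
    by (simp add: K_def)
  have bd: "\<bar>integral {a..b} (\<lambda>y. U y t) - (b - a) * U x t\<bar> \<le> B * (b - a) * (b - a)"
    if "0 \<le> a" "a \<le> b" "x = a \<or> x = b" for a b
  proof (rule integral_close_to_const)
    fix z assume "a < z" "z < b"
    then have "B * \<bar>z - x\<bar> \<le> B * (b - a)" using that B_nonneg by (intro mult_left_mono) auto
    then show "\<bar>U z t - U x t\<bar> \<le> B * (b - a)" using lip[of z x t t] that \<open>a < z\<close> assms by simp
  qed (use that assms B_nonneg U_x_integrable in auto)
  show ?thesis
  proof (cases "x \<le> y")
    case True
    then show ?thesis using *[of x y] bd[of x y] assms by (simp add: power2_eq_square mult.commute mult.left_commute)
  next
    case False
    then have "\<bar>K x t - K y t - (x - y) * U x t\<bar> \<le> B * (x - y) * (x - y)" using *[of y x] bd[of y x] assms by simp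
    moreover have "K x t - K y t - (x - y) * U x t = - (K y t - K x t - U x t * (y - x))"
      "B * (x - y) * (x - y) = B * (y - x)\<^sup>2"
      by (simp_all add: power2_eq_square algebra_simps)
    ultimately show ?thesis by simp
  qed
qed

text \<open>A short increment is split into a move in x at the later time and a move in t at the
  earlier position. Freezing the coefficients there costs O((b - a)^2), because \<open>X\<close>,
  \<open>U\<close> and the dependence of \<open>G\<close> on x are Lipschitz, and errors of that
  order add up to zero.\<close>

lemma K_along_curve:
  assumes X: "L-lipschitz_on UNIV X" and r: "r \<in> borel_measurable borel" "\<And>t. \<bar>r t\<bar> \<le> L"
    "\<And>s t. s \<le> t \<Longrightarrow> (r has_integral (X t - X s)) {s..t}"
    and X_nonneg: "\<And>t. 0 \<le> t \<Longrightarrow> t \<le> T \<Longrightarrow> 0 \<le> X t"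
    and st: "0 \<le> s" "s \<le> t" "t \<le> T"
  shows "((\<lambda>\<tau>. r \<tau> * U (X \<tau>) \<tau> - G (X \<tau>) \<tau>) has_integral (K (X t) t - K (X s) s)) {s..t}"
proof -
  have L: "0 \<le> L" using X by (rule lipschitz_on_nonneg)
  have XL: "\<bar>X b - X a\<bar> \<le> L * (b - a)" if "a \<le> b" for a b
    using lipschitz_onD[OF X, of a b] that by (simp add: dist_real_def abs_minus_commute)
  have X_cont: "continuous_on S X" for S
    using lipschitz_on_continuous_on[OF X] continuous_on_subset by blast
  have rU: "(\<lambda>\<tau>. r \<tau> * U (X \<tau>) \<tau>) integrable_on {a..b}" if "0 \<le> a" "b \<le> T" for a b
  proof -
    have "(\<lambda>\<tau>. U (X \<tau>) \<tau>) absolutely_integrable_on {a..b}"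
      using that X_nonneg by (intro absolutely_integrable_continuous_real U_cont_comp X_cont continuous_intros) auto
    moreover have "r \<in> borel_measurable (lebesgue_on {a..b})"
      using r(1) by (simp add: measurable_completion measurable_restrict_space1)
    moreover have "bounded (r ` {a..b})" using r(2) by (auto simp: bounded_iff)
    ultimately show ?thesis
      by (intro set_lebesgue_integral_eq_integral(1) absolutely_integrable_bounded_measurable_product_real) auto
  qed
  have GX: "(\<lambda>\<tau>. G (X \<tau>) \<tau>) integrable_on {a..b}" if "0 \<le> a" "b \<le> T" for a b
    using that X_nonneg X_cont by (intro G_comp_integrable(1)) auto
  define I where "I \<tau> = r \<tau> * U (X \<tau>) \<tau> - G (X \<tau>) \<tau>" for \<tau>
  have I_int: "I integrable_on {a..b}" if "0 \<le> a" "b \<le> T" for a b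
    unfolding I_def using rU[OF that] GX[OF that] by (rule integrable_diff)
  define P where "P \<tau> = K (X \<tau>) \<tau> - integral {s..\<tau>} I" for \<tau>
  \<comment> \<open>The first summand is the remainder of \<open>K_dx\<close>; the others come from
    freezing the factor of \<open>r\<close> and from freezing \<open>G\<close>.\<close>
  define M where "M = B * L\<^sup>2 + (B * (L + 1) * L + B * L)"
  have "\<bar>P b - P a\<bar> \<le> M * (b - a)\<^sup>2" if ab: "s \<le> a" "a \<le> b" "b \<le> t" for a b
  proof -
    have ab': "0 \<le> a" "b \<le> T" using ab st by auto
    define J where "J \<tau> = r \<tau> * U (X a) b - G (X a) \<tau> - I \<tau>" for \<tau>
    have Ga: "G (X a) integrable_on {a..b}"
      using G_comp_integrable(1)[of a b "\<lambda>_. X a"] ab ab' X_nonneg st by simp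
    have "(J has_integral ((X b - X a) * U (X a) b - integral {a..b} (G (X a)) - integral {a..b} I)) {a..b}"
      unfolding J_def using r(3)[OF ab(2)] Ga I_int[OF ab']
      by (intro has_integral_diff has_integral_mult_left integrable_integral) auto
    then have J: "J integrable_on {a..b}"
      "integral {a..b} J = (X b - X a) * U (X a) b - integral {a..b} (G (X a)) - integral {a..b} I"
      by (auto simp: integrable_on_def integral_unique)
    have "P b - P a = (K (X b) b - K (X a) b - U (X a) b * (X b - X a)) + integral {a..b} J"
    proof -
      have "integral {s..b} I = integral {s..a} I + integral {a..b} I"
        using Henstock_Kurzweil_Integration.integral_combine[of s a b I] I_int[of s b] ab ab' st by simp
      moreover have "K (X a) b - K (X a) a = - integral {a..b} (G (X a))"
        using K_dt[of "X a" a b] X_nonneg ab ab' by simp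
      ultimately show ?thesis unfolding P_def J(2) by (simp add: mult.commute)
    qed
    moreover have "\<bar>K (X b) b - K (X a) b - U (X a) b * (X b - X a)\<bar> \<le> B * L\<^sup>2 * (b - a)\<^sup>2"
    proof -
      have "\<bar>K (X b) b - K (X a) b - U (X a) b * (X b - X a)\<bar> \<le> B * (X b - X a)\<^sup>2"
        using K_dx[of "X a" "X b" b] X_nonneg ab ab' by simp
      also have "(X b - X a)\<^sup>2 \<le> (L * (b - a))\<^sup>2" using XL[OF ab(2)] by (rule abs_le_square_iff[THEN iffD1, OF order_trans]) simp
      then have "B * (X b - X a)\<^sup>2 \<le> B * (L * (b - a))\<^sup>2" using B_nonneg by (rule mult_left_mono)
      finally show ?thesis by (simp add: power_mult_distrib)
    qed
    moreover have "\<bar>integral {a..b} J\<bar> \<le> (B * (L + 1) * L + B * L) * (b - a)\<^sup>2"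
    proof -
      have "\<bar>J z - 0\<bar> \<le> (B * (L + 1) * L + B * L) * (b - a)" if z: "a < z" "z < b" for z
      proof -
        have "\<bar>U (X a) b - U (X z) z\<bar> \<le> B * (\<bar>X a - X z\<bar> + \<bar>b - z\<bar>)"
          using lip[of "X a" "X z" b z] X_nonneg z ab ab' by simp
        also have "\<dots> \<le> B * ((L + 1) * (b - a))"
        proof (rule mult_left_mono[OF _ B_nonneg])
          have "L * (z - a) \<le> L * (b - a)" using L z by (intro mult_left_mono) auto
          then show "\<bar>X a - X z\<bar> + \<bar>b - z\<bar> \<le> (L + 1) * (b - a)"
            using XL[of a z] z by (simp add: distrib_right abs_minus_commute)
        qed
        finally have "\<bar>U (X a) b - U (X z) z\<bar> * \<bar>r z\<bar> \<le> B * ((L + 1) * (b - a)) * L"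
          using r(2) B_nonneg L ab by (intro mult_mono) auto
        then have 1: "\<bar>(U (X a) b - U (X z) z) * r z\<bar> \<le> B * (L + 1) * L * (b - a)"
          by (simp add: abs_mult mult_ac)
        have "\<bar>G (X z) z - G (X a) z\<bar> \<le> B * \<bar>X z - X a\<bar>"
          using G_lip[of "X z" "X a" z] X_nonneg z ab ab' by simp
        also have "\<dots> \<le> B * (L * (b - a))"
        proof (rule mult_left_mono[OF _ B_nonneg])
          have "L * (z - a) \<le> L * (b - a)" using L z by (intro mult_left_mono) auto
          then show "\<bar>X z - X a\<bar> \<le> L * (b - a)" using XL[of a z] z by simp
        qed
        finally have 2: "\<bar>G (X z) z - G (X a) z\<bar> \<le> B * L * (b - a)" by simp
        have "J z = (U (X a) b - U (X z) z) * r z + (G (X z) z - G (X a) z)"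
          by (simp add: J_def I_def algebra_simps)
        then show ?thesis using 1 2 by (simp add: distrib_right)
      qed
      then have "\<bar>integral {a..b} J - (b - a) * 0\<bar> \<le> (B * (L + 1) * L + B * L) * (b - a) * (b - a)"
        using J(1) ab B_nonneg L by (intro integral_close_to_const) auto
      then show ?thesis by (simp add: power2_eq_square)
    qed
    ultimately show ?thesis unfolding M_def by (simp add: distrib_right)
  qed
  then have "P t = P s" using st(2) by (rule const_if_quadratic_bound)
  then have "integral {s..t} I = K (X t) t - K (X s) s" by (simp add: P_def)
  then show ?thesis using I_int[of s t] st unfolding I_def[abs_def] by (metis integrable_integral)
qed

text \<open>The identity for \<open>K\<close> on the shifted curve X + h minus the one on X, divided
  by h, relates difference quotients in x. Those of \<open>K\<close> tend to \<open>U\<close>, those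
  of \<open>U\<close> and \<open>G\<close> to one-sided slopes, and the sign of h decides which
  trace appears as p.\<close>

lemma along_curve_limit:
  assumes X: "L-lipschitz_on UNIV X" and r: "r \<in> borel_measurable borel" "\<And>t. \<bar>r t\<bar> \<le> L"
    "\<And>s t. s \<le> t \<Longrightarrow> (r has_integral (X t - X s)) {s..t}"
    and X_nonneg: "\<And>t. 0 \<le> t \<Longrightarrow> t \<le> T \<Longrightarrow> 0 \<le> X t"
    and h: "\<And>n. h n \<noteq> 0" "h \<longlonglongrightarrow> 0" "\<And>n t. 0 \<le> t \<Longrightarrow> t \<le> T \<Longrightarrow> 0 \<le> X t + h n"
    and U_lim: "\<And>t. 0 < t \<Longrightarrow> t \<le> T \<Longrightarrow> (\<lambda>n. (U (X t + h n) t - U (X t) t) / h n) \<longlonglongrightarrow> w t * p t"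
    and G_lim: "\<And>t. 0 < t \<Longrightarrow> t \<le> T \<Longrightarrow> (\<lambda>n. (G (X t + h n) t - G (X t) t) / h n) \<longlonglongrightarrow> w t * f (p t)"
    and st: "0 \<le> s" "s \<le> t" "t \<le> T"
  shows "((\<lambda>\<tau>. w \<tau> * (r \<tau> * p \<tau> - f (p \<tau>))) has_integral (U (X t) t - U (X s) s)) {s..t}"
proof -
  have L: "0 \<le> L" using X by (rule lipschitz_on_nonneg)
  define I where "I n \<tau> = r \<tau> * ((U (X \<tau> + h n) \<tau> - U (X \<tau>) \<tau>) / h n) - (G (X \<tau> + h n) \<tau> - G (X \<tau>) \<tau>) / h n" for n \<tau>
  define k where "k n = (K (X t + h n) t - K (X t) t) / h n - (K (X s + h n) s - K (X s) s) / h n" for n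
  have I_int: "(I n has_integral k n) {s..t}" for n
  proof -
    have X': "L-lipschitz_on UNIV (\<lambda>t. X t + h n)" using X unfolding lipschitz_on_def by simp
    have "((\<lambda>\<tau>. r \<tau> * U (X \<tau> + h n) \<tau> - G (X \<tau> + h n) \<tau>) has_integral (K (X t + h n) t - K (X s + h n) s)) {s..t}"
      by (rule K_along_curve[OF X' r(1,2) _ h(3) st]) (use r(3) in auto)
    from has_integral_divide[OF has_integral_diff[OF this K_along_curve[OF X r X_nonneg st]], of "h n"]
    show ?thesis
      by (rule has_integral_eq_rhs[OF has_integral_eq, rotated]) (auto simp: I_def k_def field_simps h(1))
  qed
  have K_lim: "(\<lambda>n. (K (X \<tau> + h n) \<tau> - K (X \<tau>) \<tau>) / h n) \<longlonglongrightarrow> U (X \<tau>) \<tau>" if \<tau>: "0 \<le> \<tau>" "\<tau> \<le> T" for \<tau>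
  proof (rule LIM_zero_cancel, rule Lim_null_comparison)
    have "\<bar>(K (X \<tau> + h n) \<tau> - K (X \<tau>) \<tau>) / h n - U (X \<tau>) \<tau>\<bar> \<le> B * \<bar>h n\<bar>" for n
    proof -
      have "\<bar>K (X \<tau> + h n) \<tau> - K (X \<tau>) \<tau> - U (X \<tau>) \<tau> * h n\<bar> \<le> B * \<bar>h n\<bar> * \<bar>h n\<bar>"
        using K_dx[of "X \<tau>" "X \<tau> + h n" \<tau>] X_nonneg h(3) \<tau> by (simp add: power2_eq_square)
      moreover have "(K (X \<tau> + h n) \<tau> - K (X \<tau>) \<tau>) / h n - U (X \<tau>) \<tau> = (K (X \<tau> + h n) \<tau> - K (X \<tau>) \<tau> - U (X \<tau>) \<tau> * h n) / h n"
        using h(1)[of n] by (simp add: diff_divide_distrib)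
      ultimately show ?thesis using h(1)[of n] by (simp add: abs_divide divide_le_eq)
    qed
    then show "\<forall>\<^sub>F n in sequentially. norm ((K (X \<tau> + h n) \<tau> - K (X \<tau>) \<tau>) / h n - U (X \<tau>) \<tau>) \<le> B * \<bar>h n\<bar>"
      by simp
    show "(\<lambda>n. B * \<bar>h n\<bar>) \<longlonglongrightarrow> 0" using h(2) by (auto intro!: tendsto_eq_intros)
  qed
  have bd: "norm (I n \<tau>) \<le> L * B + B" if \<tau>: "\<tau> \<in> {s..t} - {0}" for n \<tau>
  proof -
    have t': "0 < \<tau>" "\<tau> \<le> T" using \<tau> st by auto
    have "\<bar>U (X \<tau> + h n) \<tau> - U (X \<tau>) \<tau>\<bar> \<le> B * \<bar>h n\<bar>"
      using lip[of "X \<tau> + h n" "X \<tau>" \<tau> \<tau>] X_nonneg h(3) t' by simp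
    then have "\<bar>(U (X \<tau> + h n) \<tau> - U (X \<tau>) \<tau>) / h n\<bar> \<le> B"
      using h(1)[of n] by (simp add: abs_divide divide_le_eq)
    then have 1: "\<bar>r \<tau> * ((U (X \<tau> + h n) \<tau> - U (X \<tau>) \<tau>) / h n)\<bar> \<le> L * B"
      unfolding abs_mult using r(2) L by (intro mult_mono) auto
    have "\<bar>G (X \<tau> + h n) \<tau> - G (X \<tau>) \<tau>\<bar> \<le> B * \<bar>h n\<bar>"
      using G_lip[of "X \<tau> + h n" "X \<tau>" \<tau>] X_nonneg h(3) t' by simp
    then have "\<bar>(G (X \<tau> + h n) \<tau> - G (X \<tau>) \<tau>) / h n\<bar> \<le> B"
      using h(1)[of n] by (simp add: abs_divide divide_le_eq)
    with 1 show ?thesis unfolding I_def real_norm_def by linarith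
  qed
  have lim: "(\<lambda>n. I n \<tau>) \<longlonglongrightarrow> w \<tau> * (r \<tau> * p \<tau> - f (p \<tau>))" if \<tau>: "\<tau> \<in> {s..t} - {0}" for \<tau>
  proof -
    have "0 < \<tau>" "\<tau> \<le> T" using \<tau> st by auto
    then have "(\<lambda>n. I n \<tau>) \<longlonglongrightarrow> r \<tau> * (w \<tau> * p \<tau>) - w \<tau> * f (p \<tau>)"
      unfolding I_def by (intro tendsto_intros U_lim G_lim)
    then show ?thesis by (simp add: algebra_simps)
  qed
  have ii: "I n integrable_on {s..t}" for n using I_int by (auto simp: integrable_on_def)
  note dom = dominated_convergence_off_negligible[where N="{0}", OF ii integrable_const_ivl negligible_sing bd lim]
  have "k \<longlonglongrightarrow> integral {s..t} (\<lambda>\<tau>. w \<tau> * (r \<tau> * p \<tau> - f (p \<tau>)))"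
    using dom(2) I_int by (simp add: integral_unique[OF I_int])
  moreover have "k \<longlonglongrightarrow> U (X t) t - U (X s) s"
    unfolding k_def using st by (intro tendsto_diff K_lim) auto
  ultimately have "integral {s..t} (\<lambda>\<tau>. w \<tau> * (r \<tau> * p \<tau> - f (p \<tau>))) = U (X t) t - U (X s) s"
    by (rule LIMSEQ_unique)
  then show ?thesis using dom(1) by (metis integrable_integral)
qed

lemma g_right: "0 \<le> x \<Longrightarrow> 0 < t \<Longrightarrow> t \<le> T \<Longrightarrow> ((\<lambda>y. g y t) \<longlongrightarrow> w t * f (ur x t)) (at_right x)"
  unfolding g_def by (intro tendsto_mult tendsto_const continuous_on_tendsto_compose[OF f_cont] ur_right) auto

lemma g_left: "0 < x \<Longrightarrow> 0 < t \<Longrightarrow> t \<le> T \<Longrightarrow> ((\<lambda>y. g y t) \<longlongrightarrow> w t * f (ul x t)) (at_left x)"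
  unfolding g_def by (intro tendsto_mult tendsto_const continuous_on_tendsto_compose[OF f_cont] ur_left) auto

lemma along_curve_right:
  assumes X: "L-lipschitz_on UNIV X" and r: "r \<in> borel_measurable borel" "\<And>t. \<bar>r t\<bar> \<le> L"
    "\<And>s t. s \<le> t \<Longrightarrow> (r has_integral (X t - X s)) {s..t}"
    and X_nonneg: "\<And>t. 0 \<le> t \<Longrightarrow> t \<le> T \<Longrightarrow> 0 \<le> X t"
    and st: "0 \<le> s" "s \<le> t" "t \<le> T"
  shows "((\<lambda>\<tau>. w \<tau> * (r \<tau> * ur (X \<tau>) \<tau> - f (ur (X \<tau>) \<tau>))) has_integral (U (X t) t - U (X s) s)) {s..t}"
proof (rule along_curve_limit[OF X r X_nonneg, where h="\<lambda>n. inverse (real (Suc n))"])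
  show "(\<lambda>n. inverse (real (Suc n))) \<longlonglongrightarrow> 0" by (rule LIMSEQ_inverse_real_of_nat)
  show "0 \<le> X t + inverse (real (Suc n))" if "0 \<le> t" "t \<le> T" for n t
    using X_nonneg[OF that] by (intro add_nonneg_nonneg) auto
  fix t assume t: "0 < t" "t \<le> T"
  have x: "0 \<le> X t" using X_nonneg t by simp
  show "(\<lambda>n. (U (X t + inverse (real (Suc n))) t - U (X t) t) / inverse (real (Suc n))) \<longlonglongrightarrow> w t * ur (X t) t"
    using filterlim_compose[OF dx_right[OF x t] inverse_Suc_at_right] by simp
  have "((\<lambda>y. integral {X t..y} (\<lambda>z. g z t) / (y - X t)) \<longlongrightarrow> w t * f (ur (X t) t)) (at_right (X t))"
    using g_integrable(1)[OF x t] by (intro integral_average_right g_right x t)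
  from filterlim_compose[OF this inverse_Suc_at_right]
  have "(\<lambda>n. integral {X t..X t + inverse (real (Suc n))} (\<lambda>z. g z t) / inverse (real (Suc n))) \<longlonglongrightarrow> w t * f (ur (X t) t)"
    by simp
  moreover have "integral {X t..X t + inverse (real (Suc n))} (\<lambda>z. g z t) = G (X t + inverse (real (Suc n))) t - G (X t) t" for n
    using G_diff[OF x _ t, of "X t + inverse (real (Suc n))"] by simp
  ultimately show "(\<lambda>n. (G (X t + inverse (real (Suc n))) t - G (X t) t) / inverse (real (Suc n))) \<longlonglongrightarrow> w t * f (ur (X t) t)"
    by simp
qed (use st in auto)

lemma along_curve_left:
  assumes X: "L-lipschitz_on UNIV X" and r: "r \<in> borel_measurable borel" "\<And>t. \<bar>r t\<bar> \<le> L"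
    "\<And>s t. s \<le> t \<Longrightarrow> (r has_integral (X t - X s)) {s..t}"
    and c: "0 < c" and X_ge: "\<And>t. 0 \<le> t \<Longrightarrow> t \<le> T \<Longrightarrow> c \<le> X t"
    and st: "0 \<le> s" "s \<le> t" "t \<le> T"
  shows "((\<lambda>\<tau>. w \<tau> * (r \<tau> * ul (X \<tau>) \<tau> - f (ul (X \<tau>) \<tau>))) has_integral (U (X t) t - U (X s) s)) {s..t}"
proof -
  \<comment> \<open>The shift has size at most c, so the shifted curve stays in x >= 0.\<close>
  define h where "h n = - c * inverse (real (Suc n))" for n
  have h_le: "- c \<le> h n" "h n < 0" for n
    using c unfolding h_def by (simp_all add: field_simps)
  have h0: "h \<longlonglongrightarrow> 0"
    unfolding h_def using tendsto_mult[OF tendsto_const[of "-c"] LIMSEQ_inverse_real_of_nat] by simp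
  have at_left: "filterlim (\<lambda>n. y + h n) (at_left y) sequentially" for y
    unfolding filterlim_at using tendsto_add[OF tendsto_const[of y] h0] less_imp_neq[OF h_le(2)] h_le(2) by (auto intro!: always_eventually)
  show ?thesis
  proof (rule along_curve_limit[OF X r, where h=h])
    show "h \<longlonglongrightarrow> 0" by (rule h0)
    show "h n \<noteq> 0" for n using h_le(2)[of n] by simp
    show "0 \<le> X t" if "0 \<le> t" "t \<le> T" for t using X_ge[OF that] c by simp
    show h_nonneg: "0 \<le> X t + h n" if "0 \<le> t" "t \<le> T" for n t
      using X_ge[OF that] h_le(1)[of n] by simp
    fix t assume t: "0 < t" "t \<le> T"
    have x: "0 < X t" using X_ge[of t] t c by simp
    show "(\<lambda>n. (U (X t + h n) t - U (X t) t) / h n) \<longlonglongrightarrow> w t * ul (X t) t"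
      using filterlim_compose[OF dx_left[OF x t] at_left] by simp
    have "((\<lambda>y. integral {y..X t} (\<lambda>z. g z t) / (X t - y)) \<longlongrightarrow> w t * f (ul (X t) t)) (at_left (X t))"
      using g_integrable(1)[OF _ t] x by (intro integral_average_left[where c=0] g_left t) auto
    from filterlim_compose[OF this at_left]
    have "(\<lambda>n. integral {X t + h n..X t} (\<lambda>z. g z t) / - h n) \<longlonglongrightarrow> w t * f (ul (X t) t)"
      by simp
    moreover have "integral {X t + h n..X t} (\<lambda>z. g z t) / - h n = (G (X t + h n) t - G (X t) t) / h n" for n
      using G_diff[OF _ _ t, of "X t + h n" "X t"] h_nonneg[of t n] h_le(2)[of n] t by (simp add: field_simps)
    ultimately show "(\<lambda>n. (G (X t + h n) t - G (X t) t) / h n) \<longlonglongrightarrow> w t * f (ul (X t) t)"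
      by simp
  qed (use st in auto)
qed

lemma ae_deriv_along_curve_right:
  assumes X: "L-lipschitz_on UNIV X" and r: "r \<in> borel_measurable borel" "\<And>t. \<bar>r t\<bar> \<le> L"
    "\<And>s t. s \<le> t \<Longrightarrow> (r has_integral (X t - X s)) {s..t}"
    and X_nonneg: "\<And>t. 0 \<le> t \<Longrightarrow> t \<le> T \<Longrightarrow> 0 \<le> X t"
  shows "\<exists>N. negligible N \<and> (\<forall>t. 0 < t \<longrightarrow> t < T \<longrightarrow> t \<notin> N \<longrightarrow>
    ((\<lambda>\<tau>. U (X \<tau>) \<tau>) has_real_derivative w t * (r t * ur (X t) t - f (ur (X t) t))) (at t))"
proof (rule ae_deriv_of_integral[OF along_curve_right[OF X r X_nonneg]], assumption+)
  fix N assume "negligible N" and der: "\<And>t. 0 < t \<Longrightarrow> t < T \<Longrightarrow> t \<notin> N \<Longrightarrow>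
    ((\<lambda>\<tau>. U (X \<tau>) \<tau>) has_real_derivative w t * (r t * ur (X t) t - f (ur (X t) t))) (at t)"
  then show ?thesis by (intro exI[of _ N] conjI allI impI)
qed

lemma ae_deriv_along_curve_left:
  assumes X: "L-lipschitz_on UNIV X" and r: "r \<in> borel_measurable borel" "\<And>t. \<bar>r t\<bar> \<le> L"
    "\<And>s t. s \<le> t \<Longrightarrow> (r has_integral (X t - X s)) {s..t}"
    and c: "0 < c" and X_ge: "\<And>t. 0 \<le> t \<Longrightarrow> t \<le> T \<Longrightarrow> c \<le> X t"
  shows "\<exists>N. negligible N \<and> (\<forall>t. 0 < t \<longrightarrow> t < T \<longrightarrow> t \<notin> N \<longrightarrow>
    ((\<lambda>\<tau>. U (X \<tau>) \<tau>) has_real_derivative w t * (r t * ul (X t) t - f (ul (X t) t))) (at t))"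
proof (rule ae_deriv_of_integral[OF along_curve_left[OF X r c X_ge]], assumption+)
  fix N assume "negligible N" and der: "\<And>t. 0 < t \<Longrightarrow> t < T \<Longrightarrow> t \<notin> N \<Longrightarrow>
    ((\<lambda>\<tau>. U (X \<tau>) \<tau>) has_real_derivative w t * (r t * ul (X t) t - f (ul (X t) t))) (at t)"
  then show ?thesis by (intro exI[of _ N] conjI allI impI)
qed

text \<open>Continuity of the trace in time gives the derivative at this very t, without an
  exceptional set. This is needed off the discontinuity curves, where uncountably many lines of
  constant x are candidates for carrying the maximum.\<close>

lemma deriv_at_continuity_point:
  assumes x: "0 \<le> x" and t: "0 < t" "t < T" and cont: "isCont (ur x) t"
  shows "(U x has_real_derivative - (w t * f (ur x t))) (at t)"
proof -
  have wc: "isCont w t"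
    using w_cont t by (intro continuous_on_interior[of "{0..T}"]) auto
  have gc: "isCont (g x) t"
    unfolding g_def using f_cont
    by (intro continuous_intros wc isCont_o2[OF cont]) (simp add: continuous_on_eq_continuous_at)
  have int: "g x integrable_on {0..T}"
    using dt[of x 0 T] x T by (auto simp: integrable_on_def g_def[abs_def])
  have "((\<lambda>u. integral {0..u} (g x)) has_vector_derivative g x t) (at t within ({0..T} - {}))"
    by (rule integral_has_vector_derivative_continuous_at[OF int])
       (use t gc in \<open>auto intro: continuous_at_imp_continuous_at_within\<close>)
  then have "((\<lambda>u. integral {0..u} (g x)) has_real_derivative g x t) (at t)"
    using t at_within_interior[of t "{0..T}"] by (simp add: has_real_derivative_iff_has_vector_derivative)
  from DERIV_diff[OF DERIV_const[of "U x 0"] this]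
  have der: "((\<lambda>u. U x 0 - integral {0..u} (g x)) has_real_derivative - (w t * f (ur x t))) (at t)"
    by (simp add: g_def)
  show ?thesis
  proof (rule has_field_derivative_transform_within_open[OF der])
    show "open {0<..<T}" "t \<in> {0<..<T}" using t by auto
    show "U x 0 - integral {0..u} (g x) = U x u" if "u \<in> {0<..<T}" for u
      using dt[of x 0 u] x that by (simp add: g_def[abs_def] integral_unique)
  qed
qed

end

section \<open>Maximum principle for the difference of two potentials\<close>

lemma at_right_quotient_nonpos:
  fixes h :: "real \<Rightarrow> real"
  assumes lim: "((\<lambda>y. (h y - h x) / (y - x)) \<longlongrightarrow> l) (at_right x)" and "x < b"
    and max: "\<And>y. x < y \<Longrightarrow> y < b \<Longrightarrow> h y \<le> h x"
  shows "l \<le> 0"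
proof (rule tendsto_upperbound[OF lim])
  show "\<forall>\<^sub>F y in at_right x. (h y - h x) / (y - x) \<le> 0"
    using max \<open>x < b\<close> unfolding eventually_at_right_field by (intro exI[of _ b]) (auto simp: divide_nonpos_pos)
qed simp

lemma at_left_quotient_nonneg:
  fixes h :: "real \<Rightarrow> real"
  assumes lim: "((\<lambda>y. (h y - h x) / (y - x)) \<longlongrightarrow> l) (at_left x)" and "a < x"
    and max: "\<And>y. a < y \<Longrightarrow> y < x \<Longrightarrow> h y \<le> h x"
  shows "0 \<le> l"
proof (rule tendsto_lowerbound[OF lim])
  show "\<forall>\<^sub>F y in at_left x. 0 \<le> (h y - h x) / (y - x)"
    using max \<open>a < x\<close> unfolding eventually_at_left_field by (intro exI[of _ a]) (auto simp: divide_nonpos_neg)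
qed simp

text \<open>The function f - s id is convex and has equal values at both ends of [a, c], so it
  cannot exceed them in between.\<close>

lemma convex_below_chord:
  fixes f :: "real \<Rightarrow> real"
  assumes f: "convex_on UNIV f" and abc: "a \<le> b" "b \<le> c" and eq: "f c - s * c = f a - s * a"
  shows "f b - s * b \<le> f a - s * a"
proof (cases "a = c")
  case False
  define l where "l = (b - a) / (c - a)"
  have l: "0 \<le> l" "l \<le> 1" "b = (1 - l) * a + l * c"
  proof -
    have "a + l * (c - a) = b" using abc False by (simp add: l_def)
    then show "b = (1 - l) * a + l * c" by (simp add: algebra_simps)
  qed (use abc False in \<open>auto simp: l_def divide_le_eq\<close>)
  have "f b \<le> (1 - l) * f a + l * f c"
    using convex_onD[OF f l(1,2), of a c] l(3) by simp
  also have "f c = f a + s * (c - a)" using eq by (simp add: algebra_simps)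
  finally show ?thesis unfolding l(3) by (simp add: algebra_simps)
qed (use abc in auto)

text \<open>
  At a spatial maximum of \<open>U - V\<close> in the interior, the jump of \<open>v\<close> is nested in the jump of \<open>u\<close>.
  Along the curve of discontinuity of slope \<open>s\<close> the maximum then grows at rate
  \<open>(f (v+) - s v+) - (f (u+) - s u+)\<close>, which is nonpositive because, by Rankine-Hugoniot,
  \<open>f - s id\<close> takes the same value at both ends of the jump of \<open>u\<close>.
\<close>

lemma potential_comparison:
  assumes PU: "potential f w U ul ur T B" and PV: "potential f w V vl vr T B"
    and init: "\<And>x. 0 \<le> x \<Longrightarrow> U x 0 = V x 0"
    and f_convex: "convex_on UNIV f"
    and f_lip: "\<And>a b. \<bar>a\<bar> \<le> C \<Longrightarrow> \<bar>b\<bar> \<le> C \<Longrightarrow> \<bar>f a - f b\<bar> \<le> \<kappa> * \<bar>a - b\<bar>" and \<kappa>: "0 \<le> \<kappa>"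
    and bd: "\<And>x t. 0 < x \<Longrightarrow> 0 < t \<Longrightarrow> \<bar>ul x t\<bar> \<le> C" "\<And>x t. 0 < x \<Longrightarrow> 0 < t \<Longrightarrow> \<bar>vl x t\<bar> \<le> C"
    and N: "negligible N"
    and boundary: "\<And>t. 0 < t \<Longrightarrow> t < T \<Longrightarrow> t \<notin> N \<Longrightarrow> ur 0 t \<le> vr 0 t \<Longrightarrow> f (vr 0 t) \<le> f (ur 0 t)"
    and \<X>: "countable \<X>" "\<And>X. X \<in> \<X> \<Longrightarrow> \<exists>L. L-lipschitz_on UNIV X" "\<And>X. X \<in> \<X> \<Longrightarrow> \<exists>c>0. \<forall>t. c \<le> X t"
    and entropy: "\<And>x t. 0 < x \<Longrightarrow> 0 < t \<Longrightarrow> t < T \<Longrightarrow> t \<notin> N \<Longrightarrow> vr x t \<le> vl x t"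
    and regular: "\<And>x t. 0 < x \<Longrightarrow> 0 < t \<Longrightarrow> t < T \<Longrightarrow> t \<notin> N \<Longrightarrow> (\<forall>X\<in>\<X>. X t \<noteq> x) \<Longrightarrow>
      ul x t = ur x t \<and> isCont (ur x) t \<and> isCont (vr x) t"
    and x0: "0 \<le> x0" and t0: "0 \<le> t0" "t0 < T"
  shows "U x0 t0 \<le> V x0 t0"
proof -
  interpret U: potential f w U ul ur T B by (rule PU)
  interpret V: potential f w V vl vr T B by (rule PV)
  define W where "W x t = U x t - V x t" for x t
  \<comment> \<open>The domain [0, \<open>\<rho> t\<close>] shrinks at speed \<kappa>. Up to time T
    it reaches at least to x0 + 1, so it contains x0 and its right end stays away from x =
    0.\<close>
  define \<rho> where "\<rho> t = x0 + 1 + \<kappa> * (T - t)" for t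
  have \<rho>_ge: "x0 + 1 \<le> \<rho> t" if "t \<le> T" for t using \<kappa> that by (simp add: \<rho>_def)
  have \<rho>_anti: "\<rho> t \<le> \<rho> s" if "s \<le> t" for s t using \<kappa> that by (simp add: \<rho>_def mult_left_mono)
  have \<rho>_lip: "\<kappa>-lipschitz_on UNIV \<rho>"
  proof (rule lipschitz_onI)
    fix s t :: real
    have "\<rho> s - \<rho> t = \<kappa> * (t - s)" by (simp add: \<rho>_def algebra_simps)
    then show "dist (\<rho> s) (\<rho> t) \<le> \<kappa> * dist s t"
      using \<kappa> by (simp add: dist_real_def abs_mult abs_minus_commute)
  qed (rule \<kappa>)
  have \<rho>_rep: "((\<lambda>_. - \<kappa>) has_integral (\<rho> t - \<rho> s)) {s..t}" if "s \<le> t" for s t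
  proof -
    have "\<rho> t - \<rho> s = - \<kappa> * (t - s)" by (simp add: \<rho>_def algebra_simps)
    then show ?thesis using has_integral_const_real[of "- \<kappa>" s t] that by (simp add: mult.commute)
  qed
  have zero_lip: "0-lipschitz_on UNIV (\<lambda>_::real. 0::real)" by (rule lipschitz_onI) auto
  have zero_rep: "((\<lambda>_::real. 0) has_integral (0 - 0 :: real)) {s..t}" for s t :: real by simp
  obtain NU0 where NU0: "negligible NU0" "\<And>t. 0 < t \<Longrightarrow> t < T \<Longrightarrow> t \<notin> NU0 \<Longrightarrow>
      ((\<lambda>\<tau>. U 0 \<tau>) has_real_derivative w t * (0 * ur 0 t - f (ur 0 t))) (at t)"
    using U.ae_deriv_along_curve_right[OF zero_lip, of "\<lambda>_. 0"] zero_rep by auto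
  obtain NV0 where NV0: "negligible NV0" "\<And>t. 0 < t \<Longrightarrow> t < T \<Longrightarrow> t \<notin> NV0 \<Longrightarrow>
      ((\<lambda>\<tau>. V 0 \<tau>) has_real_derivative w t * (0 * vr 0 t - f (vr 0 t))) (at t)"
    using V.ae_deriv_along_curve_right[OF zero_lip, of "\<lambda>_. 0"] zero_rep by auto
  have \<rho>_pos: "0 < x0 + 1" using x0 by simp
  obtain NUr where NUr: "negligible NUr" "\<And>t. 0 < t \<Longrightarrow> t < T \<Longrightarrow> t \<notin> NUr \<Longrightarrow>
      ((\<lambda>\<tau>. U (\<rho> \<tau>) \<tau>) has_real_derivative w t * (- \<kappa> * ul (\<rho> t) t - f (ul (\<rho> t) t))) (at t)"
    using U.ae_deriv_along_curve_left[OF \<rho>_lip _ _ \<rho>_rep \<rho>_pos \<rho>_ge] \<kappa> by (auto simp: abs_of_nonneg)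
  obtain NVr where NVr: "negligible NVr" "\<And>t. 0 < t \<Longrightarrow> t < T \<Longrightarrow> t \<notin> NVr \<Longrightarrow>
      ((\<lambda>\<tau>. V (\<rho> \<tau>) \<tau>) has_real_derivative w t * (- \<kappa> * vl (\<rho> t) t - f (vl (\<rho> t) t))) (at t)"
    using V.ae_deriv_along_curve_left[OF \<rho>_lip _ _ \<rho>_rep \<rho>_pos \<rho>_ge] \<kappa> by (auto simp: abs_of_nonneg)
  \<comment> \<open>One null set per curve, and a common slope s for both traces of u and the right
    trace of v. Equality of the two expressions for the derivative of U is the Rankine-Hugoniot
    condition.\<close>
  have "\<exists>M. negligible M \<and> (\<forall>t. 0 < t \<longrightarrow> t < T \<longrightarrow> t \<notin> M \<longrightarrow> (\<exists>s.
      ((\<lambda>\<tau>. U (X \<tau>) \<tau>) has_real_derivative w t * (s * ur (X t) t - f (ur (X t) t))) (at t) \<and>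
      ((\<lambda>\<tau>. U (X \<tau>) \<tau>) has_real_derivative w t * (s * ul (X t) t - f (ul (X t) t))) (at t) \<and>
      ((\<lambda>\<tau>. V (X \<tau>) \<tau>) has_real_derivative w t * (s * vr (X t) t - f (vr (X t) t))) (at t)))"
    if X_in: "X \<in> \<X>" for X
  proof -
    obtain L where L: "L-lipschitz_on UNIV X" using \<X>(2)[OF X_in] by blast
    obtain c where c: "0 < c" "\<And>t. c \<le> X t" using \<X>(3)[OF X_in] by blast
    have X0: "0 \<le> X t" for t using c(1) c(2)[of t] by simp
    obtain r where r: "r \<in> borel_measurable borel" "\<And>t. \<bar>r t\<bar> \<le> L"
      "\<And>s t. s \<le> t \<Longrightarrow> (r has_integral (X t - X s)) {s..t}"
      using lipschitz_integral_rep[OF L] by blast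
    from U.ae_deriv_along_curve_right[OF L r X0]
    obtain N1 where N1: "negligible N1 \<and> (\<forall>t. 0 < t \<longrightarrow> t < T \<longrightarrow> t \<notin> N1 \<longrightarrow>
      ((\<lambda>\<tau>. U (X \<tau>) \<tau>) has_real_derivative w t * (r t * ur (X t) t - f (ur (X t) t))) (at t))" ..
    from U.ae_deriv_along_curve_left[OF L r c]
    obtain N2 where N2: "negligible N2 \<and> (\<forall>t. 0 < t \<longrightarrow> t < T \<longrightarrow> t \<notin> N2 \<longrightarrow>
      ((\<lambda>\<tau>. U (X \<tau>) \<tau>) has_real_derivative w t * (r t * ul (X t) t - f (ul (X t) t))) (at t))" ..
    from V.ae_deriv_along_curve_right[OF L r X0]
    obtain N3 where N3: "negligible N3 \<and> (\<forall>t. 0 < t \<longrightarrow> t < T \<longrightarrow> t \<notin> N3 \<longrightarrow>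
      ((\<lambda>\<tau>. V (X \<tau>) \<tau>) has_real_derivative w t * (r t * vr (X t) t - f (vr (X t) t))) (at t))" ..
    show ?thesis
    proof (intro exI[of _ "N1 \<union> N2 \<union> N3"] conjI allI impI)
      show "negligible (N1 \<union> N2 \<union> N3)" using N1 N2 N3 by simp
      fix t assume "0 < t" "t < T" "t \<notin> N1 \<union> N2 \<union> N3"
      then show "\<exists>s. ((\<lambda>\<tau>. U (X \<tau>) \<tau>) has_real_derivative w t * (s * ur (X t) t - f (ur (X t) t))) (at t) \<and>
        ((\<lambda>\<tau>. U (X \<tau>) \<tau>) has_real_derivative w t * (s * ul (X t) t - f (ul (X t) t))) (at t) \<and>
        ((\<lambda>\<tau>. V (X \<tau>) \<tau>) has_real_derivative w t * (s * vr (X t) t - f (vr (X t) t))) (at t)"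
        using N1 N2 N3 by (intro exI[of _ "r t"]) auto
    qed
  qed
  then have "\<forall>X\<in>\<X>. \<exists>M. negligible M \<and> (\<forall>t. 0 < t \<longrightarrow> t < T \<longrightarrow> t \<notin> M \<longrightarrow> (\<exists>s.
      ((\<lambda>\<tau>. U (X \<tau>) \<tau>) has_real_derivative w t * (s * ur (X t) t - f (ur (X t) t))) (at t) \<and>
      ((\<lambda>\<tau>. U (X \<tau>) \<tau>) has_real_derivative w t * (s * ul (X t) t - f (ul (X t) t))) (at t) \<and>
      ((\<lambda>\<tau>. V (X \<tau>) \<tau>) has_real_derivative w t * (s * vr (X t) t - f (vr (X t) t))) (at t)))" by blast
  from bchoice[OF this] obtain NX where NX: "\<forall>X\<in>\<X>. negligible (NX X) \<and> (\<forall>t. 0 < t \<longrightarrow> t < T \<longrightarrow> t \<notin> NX X \<longrightarrow> (\<exists>s.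
      ((\<lambda>\<tau>. U (X \<tau>) \<tau>) has_real_derivative w t * (s * ur (X t) t - f (ur (X t) t))) (at t) \<and>
      ((\<lambda>\<tau>. U (X \<tau>) \<tau>) has_real_derivative w t * (s * ul (X t) t - f (ul (X t) t))) (at t) \<and>
      ((\<lambda>\<tau>. V (X \<tau>) \<tau>) has_real_derivative w t * (s * vr (X t) t - f (vr (X t) t))) (at t)))" ..
  define Bad where "Bad = N \<union> NU0 \<union> NV0 \<union> NUr \<union> NVr \<union> \<Union>(NX ` \<X>)"
  have "negligible (\<Union>(NX ` \<X>))" using \<X>(1) NX by (intro negligible_countable_Union) auto
  then have Bad: "negligible Bad" using N NU0(1) NV0(1) NUr(1) NVr(1) by (simp add: Bad_def)

  define M where "M t = Sup ((\<lambda>x. W x t) ` {0..\<rho> t})" for t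
  have W_cont: "continuous_on {0..\<rho> t} (\<lambda>x. W x t)" if "0 \<le> t" "t \<le> T" for t
    unfolding W_def using that by (intro continuous_intros U.U_cont_comp V.U_cont_comp) auto
  have attain: "\<exists>y\<in>{0..\<rho> t}. (\<forall>x\<in>{0..\<rho> t}. W x t \<le> W y t) \<and> M t = W y t" if "0 \<le> t" "t \<le> T" for t
  proof -
    have "{0..\<rho> t} \<noteq> {}" using \<rho>_ge[OF that(2)] x0 by auto
    from continuous_attains_sup[OF compact_Icc this W_cont[OF that]]
    obtain y where y: "y \<in> {0..\<rho> t}" "\<And>x. x \<in> {0..\<rho> t} \<Longrightarrow> W x t \<le> W y t" by blast
    moreover have "M t = W y t" unfolding M_def by (rule cSup_eq_maximum) (use y in auto)
    ultimately show ?thesis by blast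
  qed
  have M_upper: "W x t \<le> M t" if "0 \<le> x" "x \<le> \<rho> t" "0 \<le> t" "t \<le> T" for x t
    using attain[OF that(3,4)] that(1,2) by auto
  have W_dt: "W x t \<le> W x s + 2 * B * (t - s)" if "0 \<le> x" "0 \<le> s" "s \<le> t" "t \<le> T" for x s t
    using U.lip[of x x t s] V.lip[of x x t s] that unfolding W_def by (simp add: abs_le_iff)
  have "M t0 \<le> M 0"
  proof (rule antimono_if_left_dini_nonpos[where T=t0 and N=Bad and B="2 * B"])
    show "0 \<le> 2 * B" using U.B_nonneg by simp
    show "negligible Bad" by (rule Bad)
    show "0 \<le> t0" by (rule t0(1))
    show "M t \<le> M s + 2 * B * (t - s)" if st: "0 \<le> s" "s \<le> t" "t \<le> t0" for s t
    proof -
      obtain y where y: "y \<in> {0..\<rho> t}" "M t = W y t" using attain[of t] st t0 by auto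
      have "W y s \<le> M s" using y(1) \<rho>_anti[OF st(2)] st t0 by (intro M_upper) auto
      then show ?thesis using W_dt[of y s t] y st t0 by auto
    qed
    fix t e :: real assume t: "0 < t" "t \<le> t0" "t \<notin> Bad" and e: "0 < e"
    have tT: "t < T" using t t0 by simp
    have w: "0 < w t" using U.w_pos[of t] t tT by simp
    have NN: "t \<notin> N" "t \<notin> NU0" "t \<notin> NV0" "t \<notin> NUr" "t \<notin> NVr" using t(3) by (auto simp: Bad_def)
    obtain y where y: "0 \<le> y" "y \<le> \<rho> t" "\<And>x. 0 \<le> x \<Longrightarrow> x \<le> \<rho> t \<Longrightarrow> W x t \<le> W y t" "M t = W y t"
      using attain[of t] t tT by auto
    have W_quot: "(W z t - W y t) / (z - y) = (U z t - U y t) / (z - y) - (V z t - V y t) / (z - y)" for z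
      unfolding diff_divide_distrib[symmetric] W_def by (rule arg_cong[of _ _ "\<lambda>a. a / (z - y)"]) simp
    have right: "ur y t \<le> vr y t" if "y < \<rho> t"
    proof -
      have "((\<lambda>z. (U z t - U y t) / (z - y) - (V z t - V y t) / (z - y)) \<longlongrightarrow> w t * ur y t - w t * vr y t) (at_right y)"
        using y(1) t tT by (intro tendsto_diff U.dx_right V.dx_right) auto
      then have "((\<lambda>z. (W z t - W y t) / (z - y)) \<longlongrightarrow> w t * (ur y t - vr y t)) (at_right y)"
        unfolding W_quot by (simp add: right_diff_distrib)
      then have "w t * (ur y t - vr y t) \<le> 0"
        by (rule at_right_quotient_nonpos[OF _ that]) (use y in auto)
      then show ?thesis using w by (simp add: mult_le_0_iff)
    qed
    have left: "vl y t \<le> ul y t" if "0 < y"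
    proof -
      have "((\<lambda>z. (U z t - U y t) / (z - y) - (V z t - V y t) / (z - y)) \<longlongrightarrow> w t * ul y t - w t * vl y t) (at_left y)"
        using that t tT by (intro tendsto_diff U.dx_left V.dx_left) auto
      then have "((\<lambda>z. (W z t - W y t) / (z - y)) \<longlongrightarrow> w t * (ul y t - vl y t)) (at_left y)"
        unfolding W_quot by (simp add: right_diff_distrib)
      then have "0 \<le> w t * (ul y t - vl y t)"
        by (rule at_left_quotient_nonneg[OF _ that]) (use y in auto)
      then show ?thesis using w by (simp add: zero_le_mult_iff)
    qed
    \<comment> \<open>It suffices to find a curve through the maximum point that lies in the domain
      shortly before t and along which \<open>W\<close> has nonpositive derivative, since earlier
      values of \<open>W\<close> on the curve are bounded by the earlier maximum.\<close>
    have "\<exists>Y D. Y t = y \<and> D \<le> 0 \<and> ((\<lambda>\<tau>. W (Y \<tau>) \<tau>) has_real_derivative D) (at t) \<and>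
      (\<exists>d>0. \<forall>s. t - d < s \<longrightarrow> s < t \<longrightarrow> 0 \<le> Y s \<and> Y s \<le> \<rho> s)"
    proof -
      have witness: ?thesis
        if "Y t = y" "D \<le> 0" "((\<lambda>\<tau>. W (Y \<tau>) \<tau>) has_real_derivative D) (at t)"
          "\<exists>d>0. \<forall>s. t - d < s \<longrightarrow> s < t \<longrightarrow> 0 \<le> Y s \<and> Y s \<le> \<rho> s" for Y D
        by (intro exI[of _ Y] exI[of _ D] conjI that)
      consider (zero) "y = 0" | (right_end) "y = \<rho> t" "0 < y" | (interior) "0 < y" "y < \<rho> t" using y(1,2) by linarith
      then show ?thesis
      proof cases
        case zero
        \<comment> \<open>At x = 0 only the slope to the right is available; the boundary hypothesis
          turns the resulting order of the traces into an order of the inflows.\<close>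
        have "f (vr 0 t) \<le> f (ur 0 t)"
          using right \<rho>_ge[of t] x0 tT zero t NN by (intro boundary) auto
        then have "w t * (0 * ur 0 t - f (ur 0 t)) - w t * (0 * vr 0 t - f (vr 0 t)) \<le> 0" using w by simp
        moreover have "((\<lambda>\<tau>. W 0 \<tau>) has_real_derivative w t * (0 * ur 0 t - f (ur 0 t)) - w t * (0 * vr 0 t - f (vr 0 t))) (at t)"
          unfolding W_def using NU0(2) NV0(2) t tT NN by (intro DERIV_diff) auto
        moreover have "0 \<le> \<rho> s" if "s < t" for s using \<rho>_ge[of s] that tT x0 by simp
        ultimately show ?thesis using zero by (intro witness[of "\<lambda>_. 0"]) (auto intro: exI[of _ 1])
      next
        case right_end
        define p where "p = ul y t"
        define q where "q = vl y t"
        \<comment> \<open>Along the moving end the rate is w times the difference of the values at p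
          and q of - \<kappa> z - f z. This function is nonincreasing on [-C, C], and
          \<open>left\<close> gives q <= p.\<close>
        have "\<bar>f p - f q\<bar> \<le> \<kappa> * \<bar>p - q\<bar>"
          unfolding p_def q_def using right_end(2) t bd by (intro f_lip) auto
        then have "- \<kappa> * p - f p - (- \<kappa> * q - f q) \<le> 0"
          using left[OF right_end(2)] unfolding p_def q_def by (simp add: abs_le_iff algebra_simps)
        then have "w t * (- \<kappa> * p - f p - (- \<kappa> * q - f q)) \<le> 0" using w by (simp add: mult_nonneg_nonpos)
        then have "w t * (- \<kappa> * p - f p) - w t * (- \<kappa> * q - f q) \<le> 0" by (simp add: right_diff_distrib)
        moreover have "((\<lambda>\<tau>. W (\<rho> \<tau>) \<tau>) has_real_derivative w t * (- \<kappa> * p - f p) - w t * (- \<kappa> * q - f q)) (at t)"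
          unfolding W_def p_def q_def right_end(1) using NUr(2) NVr(2) t tT NN by (intro DERIV_diff) auto
        moreover have "0 \<le> \<rho> s" if "s < t" for s using \<rho>_ge[of s] that tT x0 by simp
        ultimately show ?thesis using right_end by (intro witness[of \<rho>]) (auto intro: exI[of _ 1])
      next
        case interior
        have nest: "ur y t \<le> vr y t" "vr y t \<le> vl y t" "vl y t \<le> ul y t"
          using right left interior entropy[OF interior(1)] t tT NN by auto
        have near: "\<exists>d>0. \<forall>s. t - d < s \<longrightarrow> s < t \<longrightarrow> 0 \<le> Y s \<and> Y s \<le> \<rho> s" if "isCont Y t" "Y t = y" for Y
        proof -
          have "isCont \<rho> t" using lipschitz_on_continuous_on[OF \<rho>_lip] by (simp add: continuous_on_eq_continuous_at)
          then have "isCont (\<lambda>s. min (Y s) (\<rho> s - Y s)) t" using that(1) by (intro continuous_intros)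
          then have "\<forall>\<^sub>F s in at t. 0 < min (Y s) (\<rho> s - Y s)"
            using interior that(2) by (intro order_tendstoD(1)[of _ "min y (\<rho> t - y)"]) (auto simp: isCont_def)
          then have "\<forall>\<^sub>F s in at_left t. 0 < min (Y s) (\<rho> s - Y s)"
            by (rule filter_leD[OF at_le, rotated]) simp
          then obtain b where "b < t" "\<forall>s>b. s < t \<longrightarrow> 0 < min (Y s) (\<rho> s - Y s)"
            unfolding eventually_at_left_field by blast
          then show ?thesis by (intro exI[of _ "t - b"]) auto
        qed
        show ?thesis
        proof (cases "\<exists>X\<in>\<X>. X t = y")
          case True
          then obtain X where X: "X \<in> \<X>" "X t = y" by blast
          have "t \<notin> NX X" using t(3) X(1) by (auto simp: Bad_def)
          then obtain s where
            s: "((\<lambda>\<tau>. U (X \<tau>) \<tau>) has_real_derivative w t * (s * ur y t - f (ur y t))) (at t)"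
              "((\<lambda>\<tau>. U (X \<tau>) \<tau>) has_real_derivative w t * (s * ul y t - f (ul y t))) (at t)"
              "((\<lambda>\<tau>. V (X \<tau>) \<tau>) has_real_derivative w t * (s * vr y t - f (vr y t))) (at t)"
            using NX X t tT by blast
          have "w t * (s * ur y t - f (ur y t)) = w t * (s * ul y t - f (ul y t))"
            using s(1,2) by (rule DERIV_unique)
          then have "f (ul y t) - s * ul y t = f (ur y t) - s * ur y t" using w by simp
          then have "f (vr y t) - s * vr y t \<le> f (ur y t) - s * ur y t"
            using nest by (intro convex_below_chord[OF f_convex, where c="ul y t"]) auto
          then have "w t * (s * ur y t - f (ur y t)) \<le> w t * (s * vr y t - f (vr y t))" using w by simp
          moreover have "((\<lambda>\<tau>. W (X \<tau>) \<tau>) has_real_derivative w t * (s * ur y t - f (ur y t)) - w t * (s * vr y t - f (vr y t))) (at t)"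
            unfolding W_def by (rule DERIV_diff[OF s(1,3)])
          moreover obtain L where L: "L-lipschitz_on UNIV X" using \<X>(2)[OF X(1)] by blast
          have "isCont X t" using lipschitz_on_continuous_on[OF L] by (simp add: continuous_on_eq_continuous_at)
          ultimately show ?thesis using near[of X] X(2)
            by (intro witness[of X "w t * (s * ur y t - f (ur y t)) - w t * (s * vr y t - f (vr y t))"]) auto
        next
          case False
          \<comment> \<open>Off the curves u has no jump, so the nesting makes all four traces
            equal, and both potentials have the same derivative in t.\<close>
          then have reg: "ul y t = ur y t" "isCont (ur y) t" "isCont (vr y) t"
            using regular[OF interior(1)] t tT NN by auto
          then have "ur y t = vr y t" using nest by simp
          moreover have "((\<lambda>\<tau>. W y \<tau>) has_real_derivative - (w t * f (ur y t)) - - (w t * f (vr y t))) (at t)"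
            unfolding W_def using y(1) t tT reg
            by (intro DERIV_diff U.deriv_at_continuity_point V.deriv_at_continuity_point) auto
          ultimately show ?thesis using near[of "\<lambda>_. y"] by (intro witness[of "\<lambda>_. y" 0]) auto
        qed
      qed
    qed
    then obtain Y D where YD: "Y t = y \<and> D \<le> 0 \<and> ((\<lambda>\<tau>. W (Y \<tau>) \<tau>) has_real_derivative D) (at t) \<and>
      (\<exists>d>0. \<forall>s. t - d < s \<longrightarrow> s < t \<longrightarrow> 0 \<le> Y s \<and> Y s \<le> \<rho> s)" by (elim exE)
    then obtain d1 where d1: "d1 > 0" "\<forall>s. t - d1 < s \<longrightarrow> s < t \<longrightarrow> 0 \<le> Y s \<and> Y s \<le> \<rho> s" by (elim conjE exE)
    have Y: "Y t = y" "D \<le> 0" "((\<lambda>\<tau>. W (Y \<tau>) \<tau>) has_real_derivative D) (at t)" using YD by simp_all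
    obtain d2 where d2: "d2 > 0" "\<And>s. norm (s - t) < d2 \<Longrightarrow>
        norm (W (Y s) s - W (Y t) t - D * (s - t)) \<le> e * norm (s - t)"
      using Y(3) e unfolding has_field_derivative_def has_derivative_at_alt by blast
    have "M t \<le> M s + e * (t - s)" if s: "t - min d1 d2 < s" "s < t" "0 \<le> s" for s
    proof -
      have "0 \<le> D * (s - t)" using Y(2) s by (intro mult_nonpos_nonpos) auto
      moreover have "\<bar>W (Y s) s - W (Y t) t - D * (s - t)\<bar> \<le> e * (t - s)" using d2(2)[of s] s by simp
      ultimately have "W (Y t) t \<le> W (Y s) s + e * (t - s)" by linarith
      moreover have "W (Y s) s \<le> M s" using d1(2)[rule_format, of s] s tT by (intro M_upper) auto
      ultimately show ?thesis using y(4) Y(1) by simp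
    qed
    then show "\<exists>d>0. \<forall>s. t - d < s \<and> s < t \<and> 0 \<le> s \<longrightarrow> M t \<le> M s + e * (t - s)"
      using d1(1) d2(1) by (intro exI[of _ "min d1 d2"]) auto
  qed
  moreover have "M 0 = 0"
    using attain[of 0] U.T init by (auto simp: W_def)
  moreover have "W x0 t0 \<le> M t0"
    using x0 \<rho>_ge[of t0] t0 by (intro M_upper) auto
  ultimately show ?thesis by (simp add: W_def)
qed

section \<open>From the weak formulation to the potential\<close>

lemma bounded_measurable_integrable:
  fixes g :: "real \<Rightarrow> real"
  assumes "g \<in> borel_measurable lebesgue" "\<And>x. a \<le> x \<Longrightarrow> x \<le> b \<Longrightarrow> \<bar>g x\<bar> \<le> M"
  shows "g integrable_on {a..b}"
  by (rule measurable_bounded_by_integrable_imp_integrable_real[where g="\<lambda>_. M"])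
     (use assms in \<open>auto intro: measurable_restrict_space1\<close>)

text \<open>The coefficient \<alpha> is merely bounded and measurable, so m' = \<Phi> + \<alpha> m
  holds almost everywhere only. The integrating factor times m, minus the integrated source, is
  Lipschitz with derivative zero almost everywhere and is therefore constant.\<close>

lemma linear_ode_gauge:
  fixes \<alpha> \<Phi> m :: "real \<Rightarrow> real"
  assumes \<alpha>: "\<alpha> \<in> borel_measurable lebesgue" "\<And>t. \<bar>\<alpha> t\<bar> \<le> K"
    and \<Phi>: "continuous_on {0..T} \<Phi>" and m: "continuous_on {0..T} m"
    and eq: "\<And>t. 0 \<le> t \<Longrightarrow> t \<le> T \<Longrightarrow> m t = m0 + integral {0..t} (\<lambda>\<tau>. \<Phi> \<tau> + \<alpha> \<tau> * m \<tau>)"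
    and T: "0 \<le> T"
  shows "exp (- integral {0..T} \<alpha>) * m T = m0 + integral {0..T} (\<lambda>t. exp (- integral {0..t} \<alpha>) * \<Phi> t)"
proof -
  define A where "A t = integral {0..t} \<alpha>" for t
  define w where "w t = exp (- A t)" for t
  define I where "I t = integral {0..t} (\<lambda>\<tau>. w \<tau> * \<Phi> \<tau>)" for t
  define P where "P t = w t * m t - I t" for t
  have K: "0 \<le> K" using \<alpha>(2)[of 0] by simp
  have \<alpha>_int: "\<alpha> integrable_on {a..b}" for a b
    using \<alpha> by (rule bounded_measurable_integrable)
  have A_diff: "(\<alpha> has_integral (A t - A s)) {s..t}" if "0 \<le> s" "s \<le> t" for s t
    using Henstock_Kurzweil_Integration.integral_combine[of 0 s t \<alpha>] \<alpha>_int that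
    by (simp add: A_def has_integral_integrable_integral)
  have A_lip: "\<bar>A t - A s\<bar> \<le> K * (t - s)" if "0 \<le> s" "s \<le> t" for s t
    using integral_close_to_const[OF \<alpha>_int that(2) K, of 0] \<alpha>(2) A_diff[OF that] by (simp add: integral_unique)
  have A_bd: "\<bar>A t\<bar> \<le> K * T" if "0 \<le> t" "t \<le> T" for t
    using A_lip[of 0 t] that K mult_left_mono[of t T K] by (simp add: A_def)
  have A_cont: "continuous_on {0..T} A"
    unfolding A_def using \<alpha>_int by (rule indefinite_integral_continuous_1)
  have w_cont: "continuous_on {0..T} w" unfolding w_def by (intro continuous_intros A_cont)
  define E where "E = exp (K * T)"
  have w_bd: "0 < w t" "w t \<le> E" if "0 \<le> t" "t \<le> T" for t
    using A_bd[OF that] by (auto simp: w_def E_def)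
  have w_lip: "\<bar>w t - w s\<bar> \<le> E * (K * (t - s))" if st: "0 \<le> s" "s \<le> t" "t \<le> T" for s t
  proof -
    have ex: "exp x - exp y \<le> E * \<bar>x - y\<bar>" if "exp x \<le> E" for x y :: real
    proof -
      have "1 + (y - x) \<le> exp (y - x)" by (rule exp_ge_add_one_self)
      then have "exp x * (1 + (y - x)) \<le> exp x * exp (y - x)" by (rule mult_left_mono) simp
      then have "exp x - exp y \<le> exp x * (x - y)" by (simp add: exp_add[symmetric] algebra_simps)
      also have "\<dots> \<le> exp x * \<bar>x - y\<bar>" by (rule mult_left_mono) auto
      also have "\<dots> \<le> E * \<bar>x - y\<bar>" using that by (rule mult_right_mono) simp
      finally show ?thesis .
    qed
    have "\<bar>w t - w s\<bar> \<le> E * \<bar>A t - A s\<bar>"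
      using ex[of "- A t" "- A s"] ex[of "- A s" "- A t"] w_bd[of t] w_bd[of s] st
      by (auto simp: w_def abs_le_iff abs_minus_commute)
    also have "\<dots> \<le> E * (K * (t - s))" using A_lip[of s t] st by (intro mult_left_mono) (auto simp: E_def)
    finally show ?thesis .
  qed
  have "bounded (\<Phi> ` {0..T})" "bounded (m ` {0..T})"
    using compact_imp_bounded[OF compact_continuous_image[OF \<Phi> compact_Icc]]
      compact_imp_bounded[OF compact_continuous_image[OF m compact_Icc]] by auto
  then obtain F M where F0: "\<forall>y\<in>\<Phi> ` {0..T}. norm y \<le> F" and M0: "\<forall>y\<in>m ` {0..T}. norm y \<le> M"
    unfolding bounded_iff by blast
  have F: "\<bar>\<Phi> t\<bar> \<le> F" if "0 \<le> t" "t \<le> T" for t using bspec[OF F0 imageI[of t]] that by simp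
  have M: "\<bar>m t\<bar> \<le> M" if "0 \<le> t" "t \<le> T" for t using bspec[OF M0 imageI[of t]] that by simp
  have FM: "0 \<le> F" "0 \<le> M" using F[of 0] M[of 0] T by auto
  have \<alpha>m: "(\<lambda>\<tau>. \<alpha> \<tau> * m \<tau>) integrable_on {a..b}" if "0 \<le> a" "b \<le> T" for a b
  proof (rule set_lebesgue_integral_eq_integral(1), rule absolutely_integrable_bounded_measurable_product_real)
    show "\<alpha> \<in> borel_measurable (lebesgue_on {a..b})" using \<alpha>(1) by (rule measurable_restrict_space1)
    show "bounded (\<alpha> ` {a..b})" using \<alpha>(2) by (auto simp: bounded_iff)
    show "m absolutely_integrable_on {a..b}"
      using that by (intro absolutely_integrable_continuous_real continuous_on_subset[OF m]) auto
  qed simp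
  have \<Phi>_int: "\<Phi> integrable_on {a..b}" if "0 \<le> a" "b \<le> T" for a b
    using that by (intro integrable_continuous_real continuous_on_subset[OF \<Phi>]) auto
  have w\<Phi>_int: "(\<lambda>\<tau>. w \<tau> * \<Phi> \<tau>) integrable_on {a..b}" if "0 \<le> a" "b \<le> T" for a b
    using that by (intro integrable_continuous_real continuous_intros continuous_on_subset[OF \<Phi>] continuous_on_subset[OF w_cont]) auto
  have m_diff: "((\<lambda>\<tau>. \<Phi> \<tau> + \<alpha> \<tau> * m \<tau>) has_integral (m t - m s)) {s..t}" if "0 \<le> s" "s \<le> t" "t \<le> T" for s t
  proof -
    have int: "(\<lambda>\<tau>. \<Phi> \<tau> + \<alpha> \<tau> * m \<tau>) integrable_on {a..b}" if "0 \<le> a" "b \<le> T" for a b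
      using \<Phi>_int[OF that] \<alpha>m[OF that] by (rule integrable_add)
    show ?thesis
      using Henstock_Kurzweil_Integration.integral_combine[of 0 s t "\<lambda>\<tau>. \<Phi> \<tau> + \<alpha> \<tau> * m \<tau>"] int[of 0 t] int[of s t] that
        eq[of s] eq[of t] by (simp add: has_integral_integrable_integral)
  qed
  have I_diff: "((\<lambda>\<tau>. w \<tau> * \<Phi> \<tau>) has_integral (I t - I s)) {s..t}" if "0 \<le> s" "s \<le> t" "t \<le> T" for s t
    using Henstock_Kurzweil_Integration.integral_combine[of 0 s t "\<lambda>\<tau>. w \<tau> * \<Phi> \<tau>"] w\<Phi>_int[of 0 t] w\<Phi>_int[of s t] that
    by (simp add: I_def has_integral_integrable_integral)
  have E: "0 < E" by (simp add: E_def)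
  have m_lip: "\<bar>m t - m s\<bar> \<le> (F + K * M) * (t - s)" if st: "0 \<le> s" "s \<le> t" "t \<le> T" for s t
  proof -
    have "\<bar>\<Phi> z + \<alpha> z * m z - 0\<bar> \<le> F + K * M" if "s < z" "z < t" for z
    proof -
      have "\<bar>\<alpha> z * m z\<bar> \<le> K * M" unfolding abs_mult using \<alpha>(2) M[of z] that st K by (intro mult_mono) auto
      then show ?thesis using F[of z] that st by simp
    qed
    then show ?thesis
      using integral_close_to_const[OF has_integral_integrable[OF m_diff[OF st]] st(2), of "F + K * M" 0] FM K
        integral_unique[OF m_diff[OF st]] by simp
  qed
  have I_lip: "\<bar>I t - I s\<bar> \<le> (E * F) * (t - s)" if st: "0 \<le> s" "s \<le> t" "t \<le> T" for s t
  proof -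
    have "\<bar>w z * \<Phi> z - 0\<bar> \<le> E * F" if "s < z" "z < t" for z
      using w_bd[of z] F[of z] that st E unfolding diff_zero abs_mult by (intro mult_mono) auto
    then show ?thesis
      using integral_close_to_const[OF has_integral_integrable[OF I_diff[OF st]] st(2), of "E * F" 0] FM E
        integral_unique[OF I_diff[OF st]] by simp
  qed
  have P_lip: "\<bar>P t - P s\<bar> \<le> (E * (F + K * M) + M * (E * K) + E * F) * (t - s)" if st: "0 \<le> s" "s \<le> t" "t \<le> T" for s t
  proof -
    have "P t - P s = w t * (m t - m s) + m s * (w t - w s) - (I t - I s)"
      by (simp add: P_def algebra_simps)
    moreover have "\<bar>w t * (m t - m s)\<bar> \<le> E * ((F + K * M) * (t - s))"
      unfolding abs_mult using w_bd[of t] m_lip[OF st] st E by (intro mult_mono) auto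
    moreover have "\<bar>m s * (w t - w s)\<bar> \<le> M * (E * (K * (t - s)))"
      unfolding abs_mult using M[of s] w_lip[OF st] st FM by (intro mult_mono) auto
    ultimately show ?thesis using I_lip[OF st] by (simp add: distrib_right mult.assoc)
  qed
  obtain N1 where N1: "negligible N1" "\<And>t. 0 < t \<Longrightarrow> t < T \<Longrightarrow> t \<notin> N1 \<Longrightarrow> (A has_real_derivative \<alpha> t) (at t)"
    using ae_deriv_of_integral[of 0 T \<alpha> A] A_diff by blast
  obtain N2 where N2: "negligible N2" "\<And>t. 0 < t \<Longrightarrow> t < T \<Longrightarrow> t \<notin> N2 \<Longrightarrow> (m has_real_derivative \<Phi> t + \<alpha> t * m t) (at t)"
    using ae_deriv_of_integral[of 0 T "\<lambda>\<tau>. \<Phi> \<tau> + \<alpha> \<tau> * m \<tau>" m] m_diff by blast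
  obtain N3 where N3: "negligible N3" "\<And>t. 0 < t \<Longrightarrow> t < T \<Longrightarrow> t \<notin> N3 \<Longrightarrow> (I has_real_derivative w t * \<Phi> t) (at t)"
    using ae_deriv_of_integral[of 0 T "\<lambda>\<tau>. w \<tau> * \<Phi> \<tau>" I] I_diff by blast
  have "P T = P 0"
  proof (rule const_if_lipschitz_ae_deriv_zero[OF P_lip, where N="N1 \<union> N2 \<union> N3"])
    show "negligible (N1 \<union> N2 \<union> N3)" using N1(1) N2(1) N3(1) by simp
    fix t assume t: "0 < t" "t < T" "t \<notin> N1 \<union> N2 \<union> N3"
    have "(w has_real_derivative exp (- A t) * - \<alpha> t) (at t)"
      unfolding w_def using N1(2)[of t] t by (intro DERIV_chain2[OF DERIV_exp] DERIV_minus) auto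
    then have "(P has_real_derivative (exp (- A t) * - \<alpha> t) * m t + (\<Phi> t + \<alpha> t * m t) * w t - w t * \<Phi> t) (at t)"
      unfolding P_def using N2(2)[of t] N3(2)[of t] t by (intro DERIV_diff DERIV_mult) auto
    then show "(P has_real_derivative 0) (at t)"
      by (rule DERIV_cong) (simp add: w_def algebra_simps)
  qed (assumption | rule T)+
  moreover have "P 0 = m0" using eq[of 0] T by (simp add: P_def w_def A_def I_def)
  ultimately have "w T * m T = m0 + I T" by (simp add: P_def)
  then show ?thesis by (simp add: w_def A_def I_def)
qed

text \<open>The kernels are one-sided, so that a mollified function converges to its right limit.\<close>

lemma mollified_right_limit:
  fixes k :: "real \<Rightarrow> real"
  assumes H: "smooth_derivs H" "\<And>x. x \<le> 0 \<Longrightarrow> H 0 x = 0" "\<And>x. 1 \<le> x \<Longrightarrow> H 0 x = 1"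
    "\<And>x. 0 \<le> H 1 x" "\<And>x. x \<le> 0 \<or> 1 \<le> x \<Longrightarrow> H 1 x = 0"
    and ac: "a + 1 \<le> c" and k: "(k \<longlongrightarrow> l) (at_right a)"
    and int: "\<And>n. (\<lambda>x. k x * (real (Suc n) * H 1 (real (Suc n) * x + - (real (Suc n) * a)))) integrable_on {a..c}"
  shows "(\<lambda>n. integral {a..c} (\<lambda>x. k x * (real (Suc n) * H 1 (real (Suc n) * x + - (real (Suc n) * a))))) \<longlonglongrightarrow> l"
proof (rule tendstoI)
  fix e :: real assume e: "0 < e"
  define h where "h n x = real (Suc n) * H 1 (real (Suc n) * x + - (real (Suc n) * a))" for n x
  have h_int: "(h n has_integral 1) {a..c}" for n
  proof -
    have "(h n has_integral (H 0 (real (Suc n) * c + - (real (Suc n) * a)) - H 0 (real (Suc n) * a + - (real (Suc n) * a)))) {a..c}"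
    proof (rule fundamental_theorem_of_calculus)
      fix x
      have "((\<lambda>x. H 0 (real (Suc n) * x + - (real (Suc n) * a))) has_real_derivative h n x) (at x)"
        using smooth_derivsD[OF smooth_derivs_affine[OF H(1), of "real (Suc n)" "- (real (Suc n) * a)"], of 0 x]
        by (simp add: h_def)
      then show "((\<lambda>x. H 0 (real (Suc n) * x + - (real (Suc n) * a))) has_vector_derivative h n x) (at x within {a..c})"
        by (simp add: has_real_derivative_iff_has_vector_derivative has_vector_derivative_at_within)
    qed (use ac in simp)
    moreover have "1 \<le> real (Suc n) * c + - (real (Suc n) * a)"
    proof -
      have "1 * 1 \<le> real (Suc n) * (c - a)" using ac by (intro mult_mono) auto
      then show ?thesis by (simp add: right_diff_distrib)
    qed
    ultimately show ?thesis using H(2,3) by simp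
  qed
  have h_nonneg: "0 \<le> h n x" for n x unfolding h_def using H(4) by simp
  have h_zero: "h n x = 0" if "x \<le> a \<or> a + inverse (real (Suc n)) \<le> x" for n x
  proof -
    have "real (Suc n) * x + - (real (Suc n) * a) = real (Suc n) * (x - a)" by (simp add: algebra_simps)
    moreover have "real (Suc n) * (x - a) \<le> 0" if "x \<le> a" using that by (simp add: mult_nonneg_nonpos)
    moreover have "1 \<le> real (Suc n) * (x - a)" if "a + inverse (real (Suc n)) \<le> x"
    proof -
      have "inverse (real (Suc n)) \<le> x - a" using that by simp
      then have "real (Suc n) * inverse (real (Suc n)) \<le> real (Suc n) * (x - a)" by (rule mult_left_mono) simp
      then show ?thesis by simp
    qed
    ultimately show ?thesis using that H(5) unfolding h_def by (metis mult_zero_right)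
  qed
  have "\<forall>\<^sub>F y in at_right a. dist (k y) l < e / 2" using k e by (intro tendstoD) auto
  then obtain d where d: "d > a" "\<And>y. a < y \<Longrightarrow> y < d \<Longrightarrow> \<bar>k y - l\<bar> < e / 2"
    unfolding eventually_at_right_field by (auto simp: dist_real_def)
  have "\<forall>\<^sub>F n in sequentially. inverse (real (Suc n)) < d - a"
    using LIMSEQ_inverse_real_of_nat d(1) by (intro order_tendstoD(2)) auto
  then show "\<forall>\<^sub>F n in sequentially. dist (integral {a..c} (\<lambda>x. k x * (real (Suc n) * H 1 (real (Suc n) * x + - (real (Suc n) * a))))) l < e"
  proof eventually_elim
    case (elim n)
    have kh: "(\<lambda>x. k x * h n x) integrable_on {a..c}" using int[of n] by (simp add: h_def)
    have lh: "((\<lambda>x. l * h n x) has_integral l) {a..c}" using has_integral_mult_right[OF h_int, of l n] by simp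
    have "norm (integral {a..c} (\<lambda>x. k x * h n x - l * h n x)) \<le> integral {a..c} (\<lambda>x. e / 2 * h n x)"
    proof (rule integral_norm_bound_integral)
      show "(\<lambda>x. k x * h n x - l * h n x) integrable_on {a..c}"
        using kh lh by (intro integrable_diff) (auto simp: integrable_on_def)
      show "(\<lambda>x. e / 2 * h n x) integrable_on {a..c}"
        using has_integral_mult_right[OF h_int, of "e / 2" n] by (auto simp: integrable_on_def)
      fix x assume "x \<in> {a..c}"
      show "norm (k x * h n x - l * h n x) \<le> e / 2 * h n x"
      proof (cases "x \<le> a \<or> a + inverse (real (Suc n)) \<le> x")
        case True
        then show ?thesis using h_zero by simp
      next
        case False
        then have "\<bar>k x - l\<bar> \<le> e / 2" using d(2)[of x] elim by simp
        then have "\<bar>k x - l\<bar> * h n x \<le> e / 2 * h n x" using h_nonneg by (rule mult_right_mono)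
        then show ?thesis using h_nonneg[of n x] by (simp add: abs_mult flip: left_diff_distrib)
      qed
    qed
    also have "\<dots> = e / 2" using integral_unique[OF has_integral_mult_right[OF h_int, of "e / 2" n]] by simp
    also have "integral {a..c} (\<lambda>x. k x * h n x - l * h n x) = integral {a..c} (\<lambda>x. k x * h n x) - l"
      using Henstock_Kurzweil_Integration.integral_diff[OF kh has_integral_integrable[OF lh]] integral_unique[OF lh] by (simp only:)
    finally show ?case using e unfolding h_def dist_real_def by simp
  qed
qed

text \<open>The bound on u holds at every point rather than almost everywhere, so that compositions
  with f need no exceptional sets; \<open>clamp_to\<close> will supply such a representative.
  Continuity in time is measured in L^1 on compact intervals away from x = 0.\<close>

locale bounded_flow =
  fixes f \<alpha> :: "real \<Rightarrow> real" and u :: "real \<Rightarrow> real \<Rightarrow> real" and C K \<kappa> :: real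
  assumes f_cont: "continuous_on UNIV f"
    and f_lip: "\<And>p q. \<bar>p\<bar> \<le> C \<Longrightarrow> \<bar>q\<bar> \<le> C \<Longrightarrow> \<bar>f p - f q\<bar> \<le> \<kappa> * \<bar>p - q\<bar>" and \<kappa>: "0 \<le> \<kappa>"
    and u_bd: "\<And>x t. \<bar>u x t\<bar> \<le> C"
    and u_meas: "\<And>t. 0 \<le> t \<Longrightarrow> (\<lambda>x. u x t) \<in> borel_measurable lebesgue"
    and u_L1: "\<And>a b t. 0 < a \<Longrightarrow> a < b \<Longrightarrow> 0 \<le> t \<Longrightarrow>
      ((\<lambda>s. integral {a..b} (\<lambda>x. \<bar>u x s - u x t\<bar>)) \<longlongrightarrow> 0) (at t within {0..})"
    and \<alpha>: "\<alpha> \<in> borel_measurable lebesgue" "\<And>t. \<bar>\<alpha> t\<bar> \<le> K"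
begin

lemma C_nonneg: "0 \<le> C" using u_bd[of 0 0] by simp

lemma comp_bounded:
  assumes "continuous_on UNIV k"
  obtains B where "0 \<le> B" "\<And>p. \<bar>p\<bar> \<le> C \<Longrightarrow> \<bar>k p\<bar> \<le> (B::real)"
proof -
  have "bounded (k ` {-C..C})"
    by (rule compact_imp_bounded[OF compact_continuous_image[OF continuous_on_subset[OF assms subset_UNIV] compact_Icc]])
  then obtain B where B: "\<forall>y\<in>k ` {-C..C}. norm y \<le> B" unfolding bounded_iff by blast
  have "\<bar>k p\<bar> \<le> B" if "\<bar>p\<bar> \<le> C" for p using bspec[OF B imageI[of p]] that by (simp add: abs_le_iff)
  moreover from this[of 0] C_nonneg have "0 \<le> B" by simp
  ultimately show ?thesis using that by blast
qed

lemma comp_measurable: "continuous_on UNIV k \<Longrightarrow> 0 \<le> t \<Longrightarrow> (\<lambda>x. k (u x t)) \<in> borel_measurable lebesgue"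
  by (rule borel_measurable_continuous_on[OF _ u_meas])

lemma continuous_bounded_Icc:
  fixes \<xi> :: "real \<Rightarrow> real"
  assumes "continuous_on UNIV \<xi>"
  obtains B where "0 \<le> B" "\<And>x. a \<le> x \<Longrightarrow> x \<le> b \<Longrightarrow> \<bar>\<xi> x\<bar> \<le> (B::real)"
proof -
  have "bounded (\<xi> ` {a..b})"
    by (rule compact_imp_bounded[OF compact_continuous_image[OF continuous_on_subset[OF assms subset_UNIV] compact_Icc]])
  then obtain B where B: "\<forall>y\<in>\<xi> ` {a..b}. norm y \<le> B" unfolding bounded_iff by blast
  have "\<bar>\<xi> x\<bar> \<le> \<bar>B\<bar>" if "a \<le> x" "x \<le> b" for x using bspec[OF B imageI[of x]] that by simp
  then show ?thesis using that[of "\<bar>B\<bar>"] by simp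
qed

lemma comp_weight_integrable:
  assumes k: "continuous_on UNIV k" and \<xi>: "continuous_on UNIV \<xi>" and t: "0 \<le> t"
  shows "(\<lambda>x. k (u x t) * \<xi> x :: real) integrable_on {a..b}"
proof -
  obtain B where B: "0 \<le> B" "\<And>p. \<bar>p\<bar> \<le> C \<Longrightarrow> \<bar>k p\<bar> \<le> B" using comp_bounded[OF k] by blast
  obtain D where D: "0 \<le> D" "\<And>x. a \<le> x \<Longrightarrow> x \<le> b \<Longrightarrow> \<bar>\<xi> x\<bar> \<le> D" using continuous_bounded_Icc[OF \<xi>, of a b] by blast
  show ?thesis
  proof (rule bounded_measurable_integrable)
    have "\<xi> \<in> borel_measurable lebesgue"
      using \<xi> by (intro measurable_completion) (simp add: borel_measurable_continuous_onI)
    then show "(\<lambda>x. k (u x t) * \<xi> x) \<in> borel_measurable lebesgue"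
      using comp_measurable[OF k t] by (rule borel_measurable_times[rotated])
    show "\<bar>k (u x t) * \<xi> x\<bar> \<le> B * D" if "a \<le> x" "x \<le> b" for x
      unfolding abs_mult using B D that u_bd by (intro mult_mono) auto
  qed
qed

lemma comp_integrable:
  assumes "continuous_on UNIV k" "0 \<le> t" shows "(\<lambda>x. k (u x t) :: real) integrable_on {a..b}"
  using comp_weight_integrable[OF assms(1) continuous_on_const[of _ 1] assms(2), of a b] by simp

lemma u_int: "0 \<le> t \<Longrightarrow> (\<lambda>x. u x t) integrable_on {a..b}"
  using comp_integrable[OF continuous_on_id] by simp

text \<open>Continuity in time in the L^1 sense survives composition with k, because k is Lipschitz
  on the range [-C, C] of u, and multiplication by a weight that is bounded on [a, b].\<close>

lemma comp_weight_integral_continuous: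
  assumes k: "continuous_on UNIV k" "\<And>p q. \<bar>p\<bar> \<le> C \<Longrightarrow> \<bar>q\<bar> \<le> C \<Longrightarrow> \<bar>k p - k q\<bar> \<le> L * \<bar>p - q\<bar>" and L: "0 \<le> L"
    and \<xi>: "continuous_on UNIV \<xi>" and ab: "0 < a" "a < b"
  shows "continuous_on {0..} (\<lambda>t. integral {a..b} (\<lambda>x. k (u x t) * \<xi> x))"
proof -
  obtain D where D: "0 \<le> D" "\<And>x. a \<le> x \<Longrightarrow> x \<le> b \<Longrightarrow> \<bar>\<xi> x\<bar> \<le> D" using continuous_bounded_Icc[OF \<xi>, of a b] by blast
  show ?thesis unfolding continuous_on_def
  proof
    fix t :: real assume "t \<in> {0..}"
    then have t: "0 \<le> t" by simp
    have bd: "\<bar>integral {a..b} (\<lambda>x. k (u x s) * \<xi> x) - integral {a..b} (\<lambda>x. k (u x t) * \<xi> x)\<bar>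
        \<le> L * D * integral {a..b} (\<lambda>x. \<bar>u x s - u x t\<bar>)" if s: "0 \<le> s" for s
    proof -
      have "norm (integral {a..b} (\<lambda>x. k (u x s) * \<xi> x - k (u x t) * \<xi> x)) \<le> integral {a..b} (\<lambda>x. L * D * \<bar>u x s - u x t\<bar>)"
      proof (rule integral_norm_bound_integral)
        show "(\<lambda>x. k (u x s) * \<xi> x - k (u x t) * \<xi> x) integrable_on {a..b}"
          using s t by (intro integrable_diff comp_weight_integrable k \<xi>)
        have "(\<lambda>x. \<bar>u x s - u x t\<bar>) integrable_on {a..b}"
        proof (rule bounded_measurable_integrable)
          show "(\<lambda>x. \<bar>u x s - u x t\<bar>) \<in> borel_measurable lebesgue" using u_meas[OF s] u_meas[OF t] by measurable
          show "\<bar>\<bar>u x s - u x t\<bar>\<bar> \<le> 2 * C" for x using u_bd[of x s] u_bd[of x t] by simp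
        qed
        then show "(\<lambda>x. L * D * \<bar>u x s - u x t\<bar>) integrable_on {a..b}" by (rule integrable_on_mult_right)
        fix x assume x: "x \<in> {a..b}"
        have "\<bar>k (u x s) - k (u x t)\<bar> * \<bar>\<xi> x\<bar> \<le> (L * \<bar>u x s - u x t\<bar>) * D"
          using k(2)[OF u_bd u_bd, of x s x t] D x L by (intro mult_mono) auto
        then show "norm (k (u x s) * \<xi> x - k (u x t) * \<xi> x) \<le> L * D * \<bar>u x s - u x t\<bar>"
          by (simp add: abs_mult mult_ac flip: right_diff_distrib)
      qed
      then show ?thesis
        using Henstock_Kurzweil_Integration.integral_diff[OF comp_weight_integrable[OF k(1) \<xi> s] comp_weight_integrable[OF k(1) \<xi> t], of a b] by simp
    qed
    have "((\<lambda>s. L * D * integral {a..b} (\<lambda>x. \<bar>u x s - u x t\<bar>)) \<longlongrightarrow> L * D * 0) (at t within {0..})"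
      by (intro tendsto_mult tendsto_const u_L1 ab t)
    then have lim: "((\<lambda>s. L * D * integral {a..b} (\<lambda>x. \<bar>u x s - u x t\<bar>)) \<longlongrightarrow> 0) (at t within {0..})" by simp
    show "((\<lambda>t. integral {a..b} (\<lambda>x. k (u x t) * \<xi> x)) \<longlongrightarrow> integral {a..b} (\<lambda>x. k (u x t) * \<xi> x)) (at t within {0..})"
    proof (rule LIM_zero_cancel, rule Lim_null_comparison[OF _ lim])
      show "\<forall>\<^sub>F s in at t within {0..}. norm (integral {a..b} (\<lambda>x. k (u x s) * \<xi> x) - integral {a..b} (\<lambda>x. k (u x t) * \<xi> x))
          \<le> L * D * integral {a..b} (\<lambda>x. \<bar>u x s - u x t\<bar>)"
        unfolding eventually_at_filter using bd by (intro always_eventually allI impI) simp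
    qed
  qed
qed

text \<open>When \<xi>' is the derivative of a cutoff \<xi>, the balance law tested against \<xi>
  becomes m' = \<Phi> + \<alpha> m in integrated form.\<close>

definition m where "m \<xi> a b t = integral {a..b} (\<lambda>x. u x t * \<xi> x)" for \<xi> :: "real \<Rightarrow> real"
definition \<Phi> where "\<Phi> \<xi>' a b t = integral {a..b} (\<lambda>x. f (u x t) * \<xi>' x)" for \<xi>' :: "real \<Rightarrow> real"

lemma m_cont: "continuous_on UNIV \<xi> \<Longrightarrow> 0 < a \<Longrightarrow> a < b \<Longrightarrow> continuous_on {0..} (m \<xi> a b)"
  unfolding m_def[abs_def] using comp_weight_integral_continuous[of "\<lambda>p. p" 1] by simp

lemma \<Phi>_cont: "continuous_on UNIV \<xi> \<Longrightarrow> 0 < a \<Longrightarrow> a < b \<Longrightarrow> continuous_on {0..} (\<Phi> \<xi> a b)"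
  unfolding \<Phi>_def[abs_def] using comp_weight_integral_continuous[OF f_cont f_lip \<kappa>] by simp

lemma \<alpha>_mult_int:
  assumes "continuous_on {a..b} h" shows "(\<lambda>t. \<alpha> t * h t) integrable_on {a..b}"
proof (rule set_lebesgue_integral_eq_integral(1), rule absolutely_integrable_bounded_measurable_product_real)
  show "\<alpha> \<in> borel_measurable (lebesgue_on {a..b})" using \<alpha>(1) by (rule measurable_restrict_space1)
  show "bounded (\<alpha> ` {a..b})" using \<alpha>(2) by (auto simp: bounded_iff)
  show "h absolutely_integrable_on {a..b}" using assms by (rule absolutely_integrable_continuous_real)
qed simp

end

text \<open>The weak formulation is recorded for products of a cutoff \<xi> in x and a cutoff
  \<omega> in t, as iterated one-dimensional integrals. \<open>H\<close> is a fixed smooth step from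
  which all cutoffs are obtained by scaling and translation.\<close>

locale balance_law = bounded_flow f \<alpha> u C K \<kappa>
  for f \<alpha> :: "real \<Rightarrow> real" and u :: "real \<Rightarrow> real \<Rightarrow> real" and C K \<kappa> :: real +
  fixes u0 :: "real \<Rightarrow> real" and H :: "nat \<Rightarrow> real \<Rightarrow> real"
  assumes u0: "u0 absolutely_integrable_on {0..}"
    and weak: "\<And>\<xi> \<omega> a b S. smooth_derivs \<xi> \<Longrightarrow> smooth_derivs \<omega> \<Longrightarrow> 0 < a \<Longrightarrow> a < b \<Longrightarrow> 0 < S \<Longrightarrow>
      (\<And>x. x \<le> a \<or> b \<le> x \<Longrightarrow> \<xi> 0 x = 0 \<and> \<xi> 1 x = 0) \<Longrightarrow> (\<And>t. S \<le> t \<Longrightarrow> \<omega> 0 t = 0 \<and> \<omega> 1 t = 0) \<Longrightarrow>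
      integral {0..S} (\<lambda>t. \<omega> 1 t * integral {a..b} (\<lambda>x. u x t * \<xi> 0 x) + \<omega> 0 t *
        (integral {a..b} (\<lambda>x. f (u x t) * \<xi> 1 x) + \<alpha> t * integral {a..b} (\<lambda>x. u x t * \<xi> 0 x)))
      + \<omega> 0 0 * integral {a..b} (\<lambda>x. u0 x * \<xi> 0 x) = 0"
    and right_lim: "\<And>x t. 0 \<le> x \<Longrightarrow> 0 < t \<Longrightarrow> \<exists>l. ((\<lambda>y. u y t) \<longlongrightarrow> l) (at_right x)"
    and left_lim: "\<And>x t. 0 < x \<Longrightarrow> 0 < t \<Longrightarrow> \<exists>l. ((\<lambda>y. u y t) \<longlongrightarrow> l) (at_left x)"
    and H: "smooth_derivs H" "\<And>x. x \<le> 0 \<Longrightarrow> H 0 x = 0" "\<And>x. 1 \<le> x \<Longrightarrow> H 0 x = 1"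
      "\<And>x. 0 \<le> H 1 x" "\<And>x. x \<le> 0 \<or> 1 \<le> x \<Longrightarrow> H 1 x = 0" "\<And>x. 0 \<le> H 0 x \<and> H 0 x \<le> 1"
begin

abbreviation N :: "nat \<Rightarrow> real" where "N n \<equiv> real (Suc n)"

definition ur where "ur x t = Lim (at_right x) (\<lambda>y. u y t)"
definition ul where "ul x t = Lim (at_left x) (\<lambda>y. u y t)"

lemma u_right: "0 \<le> x \<Longrightarrow> 0 < t \<Longrightarrow> ((\<lambda>y. u y t) \<longlongrightarrow> ur x t) (at_right x)"
  using right_lim[of x t] tendsto_Lim[of "at_right x" "\<lambda>y. u y t"] unfolding ur_def by force

lemma u_left: "0 < x \<Longrightarrow> 0 < t \<Longrightarrow> ((\<lambda>y. u y t) \<longlongrightarrow> ul x t) (at_left x)"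
  using left_lim[of x t] tendsto_Lim[of "at_left x" "\<lambda>y. u y t"] unfolding ul_def by force

lemma ur_bd: "0 \<le> x \<Longrightarrow> 0 < t \<Longrightarrow> \<bar>ur x t\<bar> \<le> C"
  by (rule tendsto_upperbound[OF tendsto_rabs[OF u_right]]) (auto simp: u_bd)

lemma ul_bd: "0 < x \<Longrightarrow> 0 < t \<Longrightarrow> \<bar>ul x t\<bar> \<le> C"
  by (rule tendsto_upperbound[OF tendsto_rabs[OF u_left]]) (auto simp: u_bd)

text \<open>A right trace at y is a limit of values of u just to the right of y, so closeness of u
  to its limit at x is inherited by nearby traces.\<close>

lemma ur_right:
  assumes "0 \<le> x" "0 < t" shows "((\<lambda>y. ur y t) \<longlongrightarrow> ur x t) (at_right x)"
proof (rule tendstoI)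
  fix e :: real assume e: "0 < e"
  have "\<forall>\<^sub>F y in at_right x. dist (u y t) (ur x t) < e / 2" using u_right[OF assms] e by (intro tendstoD) auto
  then obtain d where d: "d > x" "\<And>y. x < y \<Longrightarrow> y < d \<Longrightarrow> \<bar>u y t - ur x t\<bar> < e / 2"
    unfolding eventually_at_right_field by (auto simp: dist_real_def)
  have "dist (ur y t) (ur x t) < e" if y: "x < y" "y < d" for y
  proof -
    have "\<bar>ur y t - ur x t\<bar> \<le> e / 2"
    proof (rule tendsto_upperbound[OF tendsto_rabs[OF tendsto_diff[OF u_right tendsto_const]]])
      show "\<forall>\<^sub>F z in at_right y. \<bar>u z t - ur x t\<bar> \<le> e / 2"
        unfolding eventually_at_right_field using d(2) y by (intro exI[of _ d]) (auto intro!: less_imp_le)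
    qed (use assms y in auto)
    then show ?thesis using e by (simp add: dist_real_def)
  qed
  then show "\<forall>\<^sub>F y in at_right x. dist (ur y t) (ur x t) < e"
    unfolding eventually_at_right_field using d(1) by blast
qed

lemma ur_left:
  assumes "0 < x" "0 < t" shows "((\<lambda>y. ur y t) \<longlongrightarrow> ul x t) (at_left x)"
proof (rule tendstoI)
  fix e :: real assume e: "0 < e"
  have "\<forall>\<^sub>F y in at_left x. dist (u y t) (ul x t) < e / 2" using u_left[OF assms] e by (intro tendstoD) auto
  then obtain d where d: "d < x" "\<And>y. d < y \<Longrightarrow> y < x \<Longrightarrow> \<bar>u y t - ul x t\<bar> < e / 2"
    unfolding eventually_at_left_field by (auto simp: dist_real_def)
  have "dist (ur y t) (ul x t) < e" if y: "max 0 d < y" "y < x" for y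
  proof -
    have "\<bar>ur y t - ul x t\<bar> \<le> e / 2"
    proof (rule tendsto_upperbound[OF tendsto_rabs[OF tendsto_diff[OF u_right tendsto_const]]])
      show "\<forall>\<^sub>F z in at_right y. \<bar>u z t - ul x t\<bar> \<le> e / 2"
        unfolding eventually_at_right_field using d(2) y by (intro exI[of _ x]) (auto intro!: less_imp_le)
    qed (use assms y in auto)
    then show ?thesis using e by (simp add: dist_real_def)
  qed
  then show "\<forall>\<^sub>F y in at_left x. dist (ur y t) (ul x t) < e"
    unfolding eventually_at_left_field using d(1) assms by (intro exI[of _ "max 0 d"]) auto
qed

text \<open>An approximate identity supported in [a, a + 1 / (n + 1)], to the right of a. It is the
  derivative of \<open>ramp\<close>, which approximates the indicator of x > a.\<close>

definition kern where "kern n a x = N n * H 1 (N n * x + - (N n * a))"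

lemma kern_cont: "continuous_on S (kern n a)"
  unfolding kern_def[abs_def]
  by (intro continuous_intros continuous_on_compose2[OF smooth_derivs_imp_continuous[OF H(1), of UNIV]]) auto

lemma kern_zero: "x \<le> a \<or> a + 1 \<le> x \<Longrightarrow> kern n a x = 0"
proof -
  assume *: "x \<le> a \<or> a + 1 \<le> x"
  have "N n * x + - (N n * a) = N n * (x - a)" by (simp add: algebra_simps)
  moreover have "N n * (x - a) \<le> 0" if "x \<le> a" using that by (simp add: mult_nonneg_nonpos)
  moreover have "1 \<le> N n * (x - a)" if "a + 1 \<le> x"
  proof -
    have "1 * 1 \<le> N n * (x - a)" using that by (intro mult_mono) auto
    then show ?thesis by simp
  qed
  ultimately show "kern n a x = 0" using H(5) * unfolding kern_def by (metis mult_zero_right)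
qed

lemma kern_lim:
  assumes "a + 1 \<le> c" "(k \<longlongrightarrow> l) (at_right a)" "\<And>n. (\<lambda>x. k x * kern n a x) integrable_on {a..c}"
  shows "(\<lambda>n. integral {a..c} (\<lambda>x. k x * kern n a x)) \<longlonglongrightarrow> l"
  using mollified_right_limit[OF H(1-5) assms[unfolded kern_def]] unfolding kern_def .

definition ramp where "ramp n a x = H 0 (N n * x + - (N n * a))"

lemma ramp_bd: "0 \<le> ramp n a x" "ramp n a x \<le> 1" using H(6) by (simp_all add: ramp_def)

lemma ramp_below: "x \<le> a \<Longrightarrow> ramp n a x = 0"
proof -
  assume "x \<le> a"
  then have "N n * x + - (N n * a) \<le> 0" by simp
  then show ?thesis unfolding ramp_def by (rule H(2))
qed

lemma ramp_above: "a + inverse (N n) \<le> x \<Longrightarrow> ramp n a x = 1"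
proof -
  assume *: "a + inverse (N n) \<le> x"
  then have "N n * inverse (N n) \<le> N n * (x - a)" by (intro mult_left_mono) auto
  then have "1 \<le> N n * x + - (N n * a)" by (simp add: right_diff_distrib)
  then show ?thesis unfolding ramp_def by (rule H(3))
qed

lemma ramp_lim: "(\<lambda>n. ramp n a x) \<longlonglongrightarrow> (if x \<le> a then 0 else 1)"
proof (cases "x \<le> a")
  case False
  then have "\<forall>\<^sub>F n in sequentially. inverse (N n) < x - a"
    using LIMSEQ_inverse_real_of_nat by (intro order_tendstoD(2)) auto
  then have "\<forall>\<^sub>F n in sequentially. ramp n a x = 1"
    by eventually_elim (simp add: ramp_above del: of_nat_Suc)
  then show ?thesis using False by (simp add: tendsto_eventually)
qed (simp add: ramp_below)

lemma ramp_smooth: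
  obtains D where "smooth_derivs D" "D 0 = ramp n a" "D 1 = kern n a"
proof -
  have "smooth_derivs (\<lambda>k x. N n ^ k * H k (N n * x + - (N n * a)))" by (rule smooth_derivs_affine[OF H(1)])
  then show ?thesis by (rule that) (auto simp: ramp_def kern_def)
qed

text \<open>The cutoff in time is one minus a ramp at \<open>t\<close>, so that its derivative samples the values just after \<open>t\<close>.\<close>

lemma weak_at_time:
  assumes \<xi>: "smooth_derivs \<xi>" "\<And>x. x \<le> a \<or> b \<le> x \<Longrightarrow> \<xi> 0 x = 0 \<and> \<xi> 1 x = 0" and ab: "0 < a" "a < b"
    and t: "0 < t"
  shows "m (\<xi> 0) a b t = integral {a..b} (\<lambda>x. u0 x * \<xi> 0 x) + integral {0..t} (\<lambda>\<tau>. \<Phi> (\<xi> 1) a b \<tau> + \<alpha> \<tau> * m (\<xi> 0) a b \<tau>)"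
proof -
  define M0 where "M0 = integral {a..b} (\<lambda>x. u0 x * \<xi> 0 x)"
  define h where "h \<tau> = \<Phi> (\<xi> 1) a b \<tau> + \<alpha> \<tau> * m (\<xi> 0) a b \<tau>" for \<tau>
  have mc: "continuous_on {0..} (m (\<xi> 0) a b)" and \<Phi>c: "continuous_on {0..} (\<Phi> (\<xi> 1) a b)"
    using smooth_derivs_imp_continuous[OF \<xi>(1)] ab by (auto intro: m_cont \<Phi>_cont)
  have h_int: "(\<lambda>\<tau>. h \<tau> * p \<tau>) integrable_on {0..t+1}" if "continuous_on UNIV p" for p
  proof -
    have "(\<lambda>\<tau>. \<Phi> (\<xi> 1) a b \<tau> * p \<tau> + \<alpha> \<tau> * (m (\<xi> 0) a b \<tau> * p \<tau>)) integrable_on {0..t+1}"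
      by (intro integrable_add integrable_continuous_real \<alpha>_mult_int continuous_intros
          continuous_on_subset[OF \<Phi>c] continuous_on_subset[OF mc] continuous_on_subset[OF that]) auto
    then show ?thesis unfolding h_def by (simp add: distrib_right mult.assoc)
  qed
  have mk_int: "(\<lambda>\<tau>. m (\<xi> 0) a b \<tau> * kern n t \<tau>) integrable_on {c..t+1}" if "0 \<le> c" for n c
    using that by (intro integrable_continuous_real continuous_intros continuous_on_subset[OF mc] kern_cont) auto
  have ramp_cont: "continuous_on UNIV (ramp n t)" for n
    by (rule ramp_smooth[of n t]) (metis smooth_derivs_imp_continuous)
  have id: "integral {t..t+1} (\<lambda>\<tau>. m (\<xi> 0) a b \<tau> * kern n t \<tau>) = integral {0..t+1} (\<lambda>\<tau>. h \<tau> * (1 - ramp n t \<tau>)) + M0" for n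
  proof -
    obtain D where D: "smooth_derivs D" "D 0 = ramp n t" "D 1 = kern n t" by (rule ramp_smooth)
    \<comment> \<open>The derivatives of one minus the ramp: the constant 1 contributes in order
      zero only.\<close>
    define \<omega> where "\<omega> k \<tau> = (if k = 0 then 1 else 0) - D k \<tau>" for k and \<tau> :: real
    have \<omega>: "smooth_derivs \<omega>"
      unfolding \<omega>_def by (rule smooth_derivs_diff[OF _ D(1)]) (auto simp: smooth_derivs_def)
    have inv: "inverse (N n) \<le> 1" by (simp add: field_simps)
    have \<omega>0: "\<omega> 0 \<tau> = 1 - ramp n t \<tau>" "\<omega> 1 \<tau> = - kern n t \<tau>" for \<tau> unfolding \<omega>_def D by simp_all
    have "\<omega> 0 \<tau> = 0 \<and> \<omega> 1 \<tau> = 0" if "t + 1 \<le> \<tau>" for \<tau>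
      unfolding \<omega>0 using that inv ramp_above[of t n \<tau>] kern_zero[of \<tau> t n] by simp
    from weak[OF \<xi>(1) \<omega> ab _ \<xi>(2) this] t
    have "integral {0..t+1} (\<lambda>\<tau>. \<omega> 1 \<tau> * m (\<xi> 0) a b \<tau> + \<omega> 0 \<tau> * h \<tau>) + \<omega> 0 0 * M0 = 0"
      by (simp add: m_def \<Phi>_def h_def M0_def)
    moreover have "\<omega> 0 0 = 1" unfolding \<omega>0 using t by (simp add: ramp_below)
    moreover have "integral {0..t+1} (\<lambda>\<tau>. \<omega> 1 \<tau> * m (\<xi> 0) a b \<tau> + \<omega> 0 \<tau> * h \<tau>)
        = integral {0..t+1} (\<lambda>\<tau>. h \<tau> * (1 - ramp n t \<tau>)) - integral {0..t+1} (\<lambda>\<tau>. m (\<xi> 0) a b \<tau> * kern n t \<tau>)"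
    proof -
      have "(\<lambda>\<tau>. h \<tau> * (1 - ramp n t \<tau>)) integrable_on {0..t+1}"
        by (intro h_int continuous_intros ramp_cont)
      moreover have "\<omega> 1 \<tau> * m (\<xi> 0) a b \<tau> + \<omega> 0 \<tau> * h \<tau> = h \<tau> * (1 - ramp n t \<tau>) - m (\<xi> 0) a b \<tau> * kern n t \<tau>" for \<tau>
        unfolding \<omega>0 by (simp add: mult.commute)
      ultimately show ?thesis
        using Henstock_Kurzweil_Integration.integral_diff[OF _ mk_int[of 0 n]] by (simp only: order_refl)
    qed
    moreover have "integral {0..t+1} (\<lambda>\<tau>. m (\<xi> 0) a b \<tau> * kern n t \<tau>) = integral {t..t+1} (\<lambda>\<tau>. m (\<xi> 0) a b \<tau> * kern n t \<tau>)"
    proof -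
      have "integral {0..t} (\<lambda>\<tau>. m (\<xi> 0) a b \<tau> * kern n t \<tau>) = integral {0..t} (\<lambda>\<tau>. 0)"
        by (rule integral_cong) (simp add: kern_zero)
      then show ?thesis
        using Henstock_Kurzweil_Integration.integral_combine[of 0 t "t+1" "\<lambda>\<tau>. m (\<xi> 0) a b \<tau> * kern n t \<tau>"] mk_int[of 0 n] t by simp
    qed
    ultimately show ?thesis by simp
  qed
  have "(\<lambda>n. integral {t..t+1} (\<lambda>\<tau>. m (\<xi> 0) a b \<tau> * kern n t \<tau>)) \<longlonglongrightarrow> m (\<xi> 0) a b t"
  proof (rule kern_lim)
    have "isCont (m (\<xi> 0) a b) t" using continuous_on_interior[OF mc] t by simp
    then show "(m (\<xi> 0) a b \<longlongrightarrow> m (\<xi> 0) a b t) (at_right t)"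
      by (simp add: isCont_def filterlim_at_split)
  qed (use mk_int t in auto)
  moreover have "(\<lambda>n. integral {0..t+1} (\<lambda>\<tau>. h \<tau> * (1 - ramp n t \<tau>)) + M0) \<longlonglongrightarrow> integral {0..t+1} (\<lambda>\<tau>. if \<tau> \<in> {0..t} then h \<tau> else 0) + M0"
  proof (intro tendsto_add tendsto_const dominated_convergence(2)[where h="\<lambda>\<tau>. \<bar>h \<tau>\<bar>"])
    show "(\<lambda>\<tau>. h \<tau> * (1 - ramp n t \<tau>)) integrable_on {0..t+1}" for n by (intro h_int continuous_intros ramp_cont)
    have "\<Phi> (\<xi> 1) a b absolutely_integrable_on {0..t+1}" "m (\<xi> 0) a b absolutely_integrable_on {0..t+1}"
      by (intro absolutely_integrable_continuous_real continuous_on_subset[OF \<Phi>c] continuous_on_subset[OF mc]; auto)+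
    then have "h absolutely_integrable_on {0..t+1}"
      unfolding h_def
      using \<alpha> by (intro set_integral_add(1) absolutely_integrable_bounded_measurable_product_real)
        (auto simp: bounded_iff intro: measurable_restrict_space1)
    then show "(\<lambda>\<tau>. \<bar>h \<tau>\<bar>) integrable_on {0..t+1}" by (simp add: absolutely_integrable_on_def)
    show "norm (h \<tau> * (1 - ramp n t \<tau>)) \<le> \<bar>h \<tau>\<bar>" for n \<tau>
      using ramp_bd[of n t \<tau>] by (simp add: abs_mult mult_left_le)
    fix \<tau> assume "\<tau> \<in> {0..t+1}"
    have "(\<lambda>n. h \<tau> * (1 - ramp n t \<tau>)) \<longlonglongrightarrow> h \<tau> * (1 - (if \<tau> \<le> t then 0 else 1))"
      by (intro tendsto_intros ramp_lim)
    then show "(\<lambda>n. h \<tau> * (1 - ramp n t \<tau>)) \<longlonglongrightarrow> (if \<tau> \<in> {0..t} then h \<tau> else 0)"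
      using \<open>\<tau> \<in> {0..t+1}\<close> by (simp split: if_splits)
  qed
  ultimately have "m (\<xi> 0) a b t = integral {0..t+1} (\<lambda>\<tau>. if \<tau> \<in> {0..t} then h \<tau> else 0) + M0"
    unfolding id by (rule LIMSEQ_unique)
  also have "integral {0..t+1} (\<lambda>\<tau>. if \<tau> \<in> {0..t} then h \<tau> else 0) = integral {0..t} h"
    using t by (subst integral_restrict_Int) (simp add: Int_absorb2)
  finally show ?thesis by (simp add: h_def[abs_def] M0_def)
qed

definition w where "w t = exp (- integral {0..t} \<alpha>)"

lemma \<alpha>_int: "\<alpha> integrable_on {a..b}"
  using \<alpha> by (rule bounded_measurable_integrable)

lemma w_pos: "0 < w t" by (simp add: w_def)

lemma w_cont: "continuous_on {0..T} w"
  unfolding w_def[abs_def] by (intro continuous_intros indefinite_integral_continuous_1 \<alpha>_int)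

lemma w_bd:
  assumes "0 \<le> t" "t \<le> T" shows "w t \<le> exp (K * T)"
proof -
  have K: "0 \<le> K" using \<alpha>(2)[of 0] by simp
  have "\<bar>integral {0..t} \<alpha> - (t - 0) * 0\<bar> \<le> K * (t - 0)"
    using \<alpha>(2) K assms by (intro integral_close_to_const \<alpha>_int) auto
  also have "\<dots> \<le> K * T" using K assms by (simp add: mult_left_mono)
  finally show ?thesis by (simp add: w_def)
qed

lemma gauged_balance:
  assumes \<xi>: "smooth_derivs \<xi>" "\<And>x. x \<le> a \<or> b \<le> x \<Longrightarrow> \<xi> 0 x = 0 \<and> \<xi> 1 x = 0" and ab: "0 < a" "a < b"
    and T: "0 \<le> T"
  shows "w T * m (\<xi> 0) a b T = integral {a..b} (\<lambda>x. u0 x * \<xi> 0 x) + integral {0..T} (\<lambda>\<tau>. w \<tau> * \<Phi> (\<xi> 1) a b \<tau>)"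
proof -
  define M0 where "M0 = integral {a..b} (\<lambda>x. u0 x * \<xi> 0 x)"
  define I where "I t = integral {0..t} (\<lambda>\<tau>. \<Phi> (\<xi> 1) a b \<tau> + \<alpha> \<tau> * m (\<xi> 0) a b \<tau>)" for t
  have mc: "continuous_on {0..} (m (\<xi> 0) a b)" and \<Phi>c: "continuous_on {0..} (\<Phi> (\<xi> 1) a b)"
    using smooth_derivs_imp_continuous[OF \<xi>(1)] ab by (auto intro: m_cont \<Phi>_cont)
  have pos: "m (\<xi> 0) a b t = M0 + I t" if "0 < t" for t
    unfolding M0_def I_def by (rule weak_at_time[OF \<xi> ab that])
  \<comment> \<open>The identity was obtained at positive times by sampling just after them. Both
    sides are continuous in t, which extends it to t = 0 and yields the initial condition.\<close>
  have zero: "m (\<xi> 0) a b 0 = M0 + I 0"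
  proof -
    have "continuous_on {0..1} I" unfolding I_def
      by (intro indefinite_integral_continuous_1 integrable_add integrable_continuous_real \<alpha>_mult_int
          continuous_on_subset[OF \<Phi>c] continuous_on_subset[OF mc]) auto
    then have "continuous_on {0..1} (\<lambda>t. m (\<xi> 0) a b t - M0 - I t)"
      by (intro continuous_intros continuous_on_subset[OF mc]) auto
    then have "((\<lambda>t. m (\<xi> 0) a b t - M0 - I t) \<longlongrightarrow> m (\<xi> 0) a b 0 - M0 - I 0) (at 0 within {0..1})"
      by (auto simp: continuous_on_def)
    moreover have "((\<lambda>t. m (\<xi> 0) a b t - M0 - I t) \<longlongrightarrow> 0) (at 0 within {0..1})"
      by (rule tendsto_eventually) (auto simp: eventually_at_filter pos intro!: always_eventually)
    moreover have "at (0::real) within {0..1} \<noteq> bot" by (simp add: at_within_Icc_at_right)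
    ultimately show ?thesis using tendsto_unique by force
  qed
  have eq: "m (\<xi> 0) a b t = M0 + I t" if "0 \<le> t" for t
    using pos[of t] zero that by (cases "t = 0") auto
  show ?thesis
    unfolding w_def M0_def[symmetric]
    by (rule linear_ode_gauge[OF \<alpha> continuous_on_subset[OF \<Phi>c] continuous_on_subset[OF mc] _ T])
       (use eq in \<open>auto simp: I_def\<close>)
qed

lemma ramp_cont: "continuous_on S (ramp n a)"
  by (rule ramp_smooth[of n a]) (metis smooth_derivs_imp_continuous)

lemma kern_integral: assumes "a + 1 \<le> c" shows "(kern n a has_integral 1) {a..c}"
proof -
  obtain D where D: "smooth_derivs D" "D 0 = ramp n a" "D 1 = kern n a" by (rule ramp_smooth)
  have "(kern n a has_integral (ramp n a c - ramp n a a)) {a..c}"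
  proof (rule fundamental_theorem_of_calculus)
    show "(ramp n a has_vector_derivative kern n a x) (at x within {a..c})" for x
      using smooth_derivsD[OF D(1), of 0 x] D(2,3)
      by (simp add: has_real_derivative_iff_has_vector_derivative has_vector_derivative_at_within)
  qed (use assms in simp)
  moreover have "inverse (N n) \<le> 1" by (simp add: field_simps)
  ultimately show ?thesis using assms ramp_above[of a n c] ramp_below[of a a n] by simp
qed

lemma kern_nonneg: "0 \<le> kern n a x" unfolding kern_def using H(4) by simp

text \<open>The difference of the ramps tends to the indicator of (a, b]; the additional unit of
  length leaves room for the ramp at b.\<close>

lemma ramp_diff_lim:
  assumes k: "k absolutely_integrable_on {a..b + 1}" and ab: "a < b"
  shows "(\<lambda>n. integral {a..b + 1} (\<lambda>x. k x * (ramp n a x - ramp n b x))) \<longlonglongrightarrow> integral {a..b} k"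
proof -
  define p where "p x = k x * ((if x \<le> a then 0 else 1) - (if x \<le> b then 0 else 1))" for x
  have "(\<lambda>n. integral {a..b + 1} (\<lambda>x. k x * (ramp n a x - ramp n b x))) \<longlonglongrightarrow> integral {a..b + 1} p"
  proof (rule dominated_convergence(2)[where h="\<lambda>x. \<bar>k x\<bar>"])
    show "(\<lambda>x. k x * (ramp n a x - ramp n b x)) integrable_on {a..b + 1}" for n
    proof -
      have "continuous_on {a..b+1} (\<lambda>x. ramp n a x - ramp n b x)" by (intro continuous_intros ramp_cont)
      then have "(\<lambda>x. (ramp n a x - ramp n b x) * k x) absolutely_integrable_on {a..b + 1}"
        by (intro absolutely_integrable_bounded_measurable_product_real k
            continuous_imp_measurable_on_sets_lebesgue compact_imp_bounded[OF compact_continuous_image]) auto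
      then show ?thesis by (simp add: mult.commute absolutely_integrable_on_def)
    qed
    show "(\<lambda>x. \<bar>k x\<bar>) integrable_on {a..b + 1}" using k by (simp add: absolutely_integrable_on_def)
    show "norm (k x * (ramp n a x - ramp n b x)) \<le> \<bar>k x\<bar>" for n x
    proof -
      have "\<bar>ramp n a x - ramp n b x\<bar> \<le> 1" using ramp_bd[of n a x] ramp_bd[of n b x] by (simp add: abs_le_iff)
      then show ?thesis by (simp add: abs_mult mult_left_le)
    qed
    show "(\<lambda>n. k x * (ramp n a x - ramp n b x)) \<longlonglongrightarrow> p x" for x
      unfolding p_def by (intro tendsto_intros ramp_lim)
  qed
  also have "integral {a..b + 1} p = integral {a..b + 1} (\<lambda>x. if x \<in> {a..b} then k x else 0)"
    by (rule integral_spike[of "{a}"]) (auto simp: p_def)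
  also have "\<dots> = integral {a..b} k"
    by (subst integral_restrict_Int) (simp add: Int_absorb2)
  finally show ?thesis .
qed

text \<open>The balance is tested with a difference of ramps. Each kernel samples the flux just to
  the right of its base point, so right traces appear at both ends of the interval.\<close>

lemma sharp_balance:
  assumes ab: "0 < a" "a < b" and T: "0 \<le> T"
  shows "((\<lambda>\<tau>. w \<tau> * (f (ur a \<tau>) - f (ur b \<tau>))) has_integral (w T * integral {a..b} (\<lambda>x. u x T) - integral {a..b} u0)) {0..T}"
proof -
  obtain F where F: "0 \<le> F" "\<And>p. \<bar>p\<bar> \<le> C \<Longrightarrow> \<bar>f p\<bar> \<le> F" using comp_bounded[OF f_cont] by blast
  define \<Psi> where "\<Psi> n = \<Phi> (\<lambda>x. kern n a x - kern n b x) a (b + 1)" for n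
  define M where "M n = integral {a..b+1} (\<lambda>x. u x T * (ramp n a x - ramp n b x))" for n
  define M0 where "M0 n = integral {a..b+1} (\<lambda>x. u0 x * (ramp n a x - ramp n b x))" for n
  have kc: "continuous_on UNIV (\<lambda>x. kern n a x - kern n b x)" for n by (intro continuous_intros kern_cont)
  have id: "w T * M n = M0 n + integral {0..T} (\<lambda>\<tau>. w \<tau> * \<Psi> n \<tau>)" for n
  proof -
    obtain D where D: "smooth_derivs D" "D 0 = ramp n a" "D 1 = kern n a" by (rule ramp_smooth)
    obtain E where E: "smooth_derivs E" "E 0 = ramp n b" "E 1 = kern n b" by (rule ramp_smooth)
    define \<xi> where "\<xi> k x = D k x - E k x" for k x
    have \<xi>: "smooth_derivs \<xi>" unfolding \<xi>_def by (rule smooth_derivs_diff[OF D(1) E(1)])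
    have \<xi>01: "\<xi> 0 = (\<lambda>x. ramp n a x - ramp n b x)" "\<xi> 1 = (\<lambda>x. kern n a x - kern n b x)"
      unfolding \<xi>_def D E by simp_all
    have inv: "inverse (N n) \<le> 1" by (simp add: field_simps)
    have "\<xi> 0 x = 0 \<and> \<xi> 1 x = 0" if "x \<le> a \<or> b + 1 \<le> x" for x
      unfolding \<xi>01 using that ab inv ramp_below[of x a n] ramp_below[of x b n] ramp_above[of a n x] ramp_above[of b n x]
        kern_zero[of x a n] kern_zero[of x b n] by auto
    from gauged_balance[OF \<xi> this ab(1) _ T] ab show ?thesis
      unfolding \<xi>01 \<Psi>_def M_def M0_def m_def by simp
  qed
  have \<Psi>_eq: "\<Psi> n \<tau> = integral {a..b+1} (\<lambda>x. f (u x \<tau>) * kern n a x) - integral {b..b+1} (\<lambda>x. f (u x \<tau>) * kern n b x)"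
    if "0 \<le> \<tau>" for n \<tau>
  proof -
    have i: "(\<lambda>x. f (u x \<tau>) * kern n c x) integrable_on {d..e}" for c d e
      using that by (intro comp_weight_integrable f_cont kern_cont)
    have "\<Psi> n \<tau> = integral {a..b+1} (\<lambda>x. f (u x \<tau>) * kern n a x) - integral {a..b+1} (\<lambda>x. f (u x \<tau>) * kern n b x)"
      unfolding \<Psi>_def \<Phi>_def using Henstock_Kurzweil_Integration.integral_diff[OF i[of a] i[of b]] by (simp add: right_diff_distrib)
    moreover have "integral {a..b} (\<lambda>x. f (u x \<tau>) * kern n b x) = integral {a..b} (\<lambda>x. 0)"
      by (rule integral_cong) (simp add: kern_zero)
    ultimately show ?thesis
      using Henstock_Kurzweil_Integration.integral_combine[of a b "b+1" "\<lambda>x. f (u x \<tau>) * kern n b x"] i ab by simp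
  qed
  have kern_bd: "\<bar>integral {c..b+1} (\<lambda>x. f (u x \<tau>) * kern n c x)\<bar> \<le> F" if "0 \<le> \<tau>" "c \<le> b" for c n \<tau>
  proof -
    have k1: "(kern n c has_integral 1) {c..b+1}" using that by (intro kern_integral) simp
    have "norm (integral {c..b+1} (\<lambda>x. f (u x \<tau>) * kern n c x)) \<le> integral {c..b+1} (\<lambda>x. F * kern n c x)"
    proof (rule integral_norm_bound_integral)
      show "(\<lambda>x. f (u x \<tau>) * kern n c x) integrable_on {c..b+1}" using that by (intro comp_weight_integrable f_cont kern_cont)
      show "(\<lambda>x. F * kern n c x) integrable_on {c..b+1}"
        using has_integral_mult_right[OF k1, of F] by (auto simp: integrable_on_def)
      show "norm (f (u x \<tau>) * kern n c x) \<le> F * kern n c x" for x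
        using F(2)[OF u_bd, of x \<tau>] kern_nonneg[of n c x] by (simp add: abs_mult mult_right_mono)
    qed
    also have "\<dots> = F" using integral_unique[OF has_integral_mult_right[OF k1, of F]] by simp
    finally show ?thesis by simp
  qed
  have \<Psi>_bd: "\<bar>\<Psi> n \<tau>\<bar> \<le> 2 * F" if "0 \<le> \<tau>" for n \<tau>
    using kern_bd[OF that, of a n] kern_bd[OF that, of b n] ab \<Psi>_eq[OF that, of n] by simp
  have \<Psi>_lim: "(\<lambda>n. \<Psi> n \<tau>) \<longlonglongrightarrow> f (ur a \<tau>) - f (ur b \<tau>)" if "0 < \<tau>" for \<tau>
  proof -
    have r: "((\<lambda>x. f (u x \<tau>)) \<longlongrightarrow> f (ur c \<tau>)) (at_right c)" if "0 \<le> c" for c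
      using that \<open>0 < \<tau>\<close> by (intro continuous_on_tendsto_compose[OF f_cont u_right]) auto
    have "(\<lambda>n. integral {a..b+1} (\<lambda>x. f (u x \<tau>) * kern n a x) - integral {b..b+1} (\<lambda>x. f (u x \<tau>) * kern n b x))
        \<longlonglongrightarrow> f (ur a \<tau>) - f (ur b \<tau>)"
      using ab that by (intro tendsto_diff kern_lim r comp_weight_integrable f_cont kern_cont) auto
    then show ?thesis using that by (simp add: \<Psi>_eq)
  qed
  have \<Psi>_int: "(\<lambda>\<tau>. w \<tau> * \<Psi> n \<tau>) integrable_on {0..T}" for n
    using \<Phi>_cont[OF kc, of a "b+1" n] ab unfolding \<Psi>_def
    by (intro integrable_continuous_real continuous_intros w_cont) (auto intro: continuous_on_subset)
  have bd: "norm (w \<tau> * \<Psi> n \<tau>) \<le> exp (K * T) * (2 * F)" if "\<tau> \<in> {0..T} - {0}" for n \<tau>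
    using w_bd[of \<tau> T] w_pos[of \<tau>] \<Psi>_bd[of \<tau> n] that unfolding real_norm_def abs_mult
    by (intro mult_mono) auto
  have lim: "(\<lambda>n. w \<tau> * \<Psi> n \<tau>) \<longlonglongrightarrow> w \<tau> * (f (ur a \<tau>) - f (ur b \<tau>))" if "\<tau> \<in> {0..T} - {0}" for \<tau>
    using that by (intro tendsto_mult tendsto_const \<Psi>_lim) auto
  note dom = dominated_convergence_off_negligible[where N="{0}", OF \<Psi>_int integrable_const_ivl negligible_sing bd lim]
  have "M \<longlonglongrightarrow> integral {a..b} (\<lambda>x. u x T)"
    unfolding M_def
  proof (rule ramp_diff_lim[OF _ ab(2)])
    show "(\<lambda>x. u x T) absolutely_integrable_on {a..b + 1}"
      using u_bd u_meas[OF T]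
      by (intro measurable_bounded_by_integrable_imp_absolutely_integrable[where g="\<lambda>_. C"]) (auto intro: measurable_restrict_space1)
  qed
  moreover have "M0 \<longlonglongrightarrow> integral {a..b} u0"
    unfolding M0_def
  proof (rule ramp_diff_lim[OF _ ab(2)])
    show "u0 absolutely_integrable_on {a..b + 1}"
      by (rule set_integrable_subset[OF u0]) (use ab in auto)
  qed
  ultimately have "(\<lambda>n. w T * M n - M0 n) \<longlonglongrightarrow> w T * integral {a..b} (\<lambda>x. u x T) - integral {a..b} u0"
    by (intro tendsto_intros)
  then have "(\<lambda>n. integral {0..T} (\<lambda>\<tau>. w \<tau> * \<Psi> n \<tau>)) \<longlonglongrightarrow> w T * integral {a..b} (\<lambda>x. u x T) - integral {a..b} u0"
    unfolding id by simp
  from LIMSEQ_unique[OF this dom(2)] dom(1) show ?thesis by (metis integrable_integral)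
qed

section \<open>The potential of a solution\<close>

lemma inverse_N_at_right: "filterlim (\<lambda>n. x + inverse (N n)) (at_right x) sequentially"
  unfolding filterlim_at
  using tendsto_add[OF tendsto_const[of x] LIMSEQ_inverse_real_of_nat] by (auto intro: always_eventually)

text \<open>The question is measurability of the trace in time. For y > 0 the trace is the limit of
  averages of u over short intervals to the right of y, which are continuous in t. Continuity in
  time is available only away from x = 0, so the trace at 0 is reached in a second limit, through
  the traces at positive points.\<close>

lemma flux_integrable:
  assumes x: "0 \<le> x" and T: "0 \<le> T"
  shows "(\<lambda>\<tau>. w \<tau> * f (ur x \<tau>)) integrable_on {0..T}"
proof -
  obtain F where F: "0 \<le> F" "\<And>p. \<bar>p\<bar> \<le> C \<Longrightarrow> \<bar>f p\<bar> \<le> F" using comp_bounded[OF f_cont] by blast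
  have bd: "norm (w \<tau> * f p) \<le> exp (K * T) * F" if "\<tau> \<in> {0..T} - {0}" "\<bar>p\<bar> \<le> C" for \<tau> p
    using w_bd[of \<tau> T] w_pos[of \<tau>] F that unfolding real_norm_def abs_mult by (intro mult_mono) auto
  have pos: "(\<lambda>\<tau>. w \<tau> * f (ur y \<tau>)) integrable_on {0..T}" if y: "0 < y" for y
  proof -
    define v where "v n \<tau> = integral {y..y + inverse (N n)} (\<lambda>z. u z \<tau>) / (y + inverse (N n) - y)" for n \<tau>
    have v_cont: "continuous_on {0..T} (v n)" for n
    proof -
      have "continuous_on {0..} (\<lambda>t. integral {y..y + inverse (N n)} (\<lambda>x. u x t * 1))"
        using y comp_weight_integral_continuous[of "\<lambda>p. p" 1 "\<lambda>_. 1" y "y + inverse (N n)"] by simp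
      then have "continuous_on {0..T} (\<lambda>t. integral {y..y + inverse (N n)} (\<lambda>x. u x t))"
        by (auto intro: continuous_on_subset)
      then show ?thesis unfolding v_def by (intro continuous_intros) auto
    qed
    have v_bd: "\<bar>v n \<tau>\<bar> \<le> C" if "0 \<le> \<tau>" for n \<tau>
    proof -
      have "\<bar>integral {y..y + inverse (N n)} (\<lambda>z. u z \<tau>) - (y + inverse (N n) - y) * 0\<bar> \<le> C * (y + inverse (N n) - y)"
        using u_bd C_nonneg that by (intro integral_close_to_const u_int) auto
      then show ?thesis by (simp add: v_def abs_divide divide_le_eq del: of_nat_Suc)
    qed
    have v_lim: "(\<lambda>n. v n \<tau>) \<longlonglongrightarrow> ur y \<tau>" if "0 < \<tau>" for \<tau>
      unfolding v_def using y that
      by (intro filterlim_compose[OF integral_average_right[OF u_right u_int] inverse_N_at_right]) auto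
    have int: "(\<lambda>\<tau>. w \<tau> * f (v n \<tau>)) integrable_on {0..T}" for n
      by (intro integrable_continuous_real continuous_intros w_cont continuous_on_compose2[OF f_cont v_cont]) auto
    have lim: "(\<lambda>n. w \<tau> * f (v n \<tau>)) \<longlonglongrightarrow> w \<tau> * f (ur y \<tau>)" if "\<tau> \<in> {0..T} - {0}" for \<tau>
      using that by (intro tendsto_mult tendsto_const continuous_on_tendsto_compose[OF f_cont v_lim]) auto
    show ?thesis
      by (rule dominated_convergence_off_negligible(1)[where N="{0}", OF int integrable_const_ivl negligible_sing bd lim])
         (auto intro: v_bd)
  qed
  show ?thesis
  proof (cases "x = 0")
    case True
    have int: "(\<lambda>\<tau>. w \<tau> * f (ur (0 + inverse (N n)) \<tau>)) integrable_on {0..T}" for n by (rule pos) simp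
    have lim: "(\<lambda>n. w \<tau> * f (ur (0 + inverse (N n)) \<tau>)) \<longlonglongrightarrow> w \<tau> * f (ur x \<tau>)" if "\<tau> \<in> {0..T} - {0}" for \<tau>
      unfolding True using that
      by (intro tendsto_mult tendsto_const continuous_on_tendsto_compose[OF f_cont]
          filterlim_compose[OF ur_right inverse_N_at_right]) auto
    show ?thesis
      by (rule dominated_convergence_off_negligible(1)[where N="{0}", OF int integrable_const_ivl negligible_sing bd lim])
         (auto intro!: ur_bd)
  qed (use pos x in simp)
qed

text \<open>The gauged mass between 0 and x, minus the gauged flux through x = 0 accumulated up to
  time t. The second term makes the rate of change in t equal to minus the flux at x, with no
  boundary contribution left.\<close>

definition U where "U x t = w t * integral {0..x} (\<lambda>y. u y t) - integral {0..t} (\<lambda>\<tau>. w \<tau> * f (ur 0 \<tau>))"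

text \<open>The left end of the interval in \<open>sharp_balance\<close> tends to 0. In the
  resulting form the initial value and the rate of change in t can be read off.\<close>

lemma U_eq:
  assumes x: "0 \<le> x" and T: "0 \<le> T"
  shows "U x T = integral {0..x} u0 - integral {0..T} (\<lambda>\<tau>. w \<tau> * f (ur x \<tau>))"
proof (cases "x = 0")
  case False
  then have x: "0 < x" using x by simp
  obtain F where F: "0 \<le> F" "\<And>p. \<bar>p\<bar> \<le> C \<Longrightarrow> \<bar>f p\<bar> \<le> F" using comp_bounded[OF f_cont] by blast
  \<comment> \<open>x / (n + 2) lies strictly between 0 and x for every n.\<close>
  define a where "a n = x * inverse (N (Suc n))" for n
  have a: "0 < a n" "a n < x" for n
  proof -
    show "0 < a n" using x by (simp add: a_def)
    have "inverse (N (Suc n)) < 1" by (simp add: field_simps)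
    then show "a n < x" using x unfolding a_def by (metis mult.right_neutral mult_strict_left_mono)
  qed
  have a_lim: "a \<longlonglongrightarrow> 0"
    unfolding a_def using tendsto_mult[OF tendsto_const[of x] LIMSEQ_Suc[OF LIMSEQ_inverse_real_of_nat]] by simp
  have a_right: "filterlim a (at_right 0) sequentially"
    unfolding filterlim_at using a_lim a(1) by (auto intro!: always_eventually simp: less_imp_neq[symmetric])
  have tail: "(\<lambda>n. integral {a n..x} k) \<longlonglongrightarrow> integral {0..x} k" if k: "k integrable_on {0..x}" for k :: "real \<Rightarrow> real"
  proof -
    have "continuous_on {0..x} (\<lambda>y. integral {0..y} k)" using k by (rule indefinite_integral_continuous_1)
    then have "((\<lambda>y. integral {0..y} k) \<longlongrightarrow> integral {0..0} k) (at 0 within {0..x})"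
      unfolding continuous_on_def by (rule bspec) (use x in simp)
    then have "((\<lambda>y. integral {0..y} k) \<longlongrightarrow> 0) (at_right 0)"
      using x by (simp add: at_within_Icc_at_right)
    then have "(\<lambda>n. integral {0..x} k - integral {0..a n} k) \<longlonglongrightarrow> integral {0..x} k - 0"
      by (intro tendsto_diff tendsto_const filterlim_compose[OF _ a_right])
    moreover have "integral {0..x} k - integral {0..a n} k = integral {a n..x} k" for n
      using Henstock_Kurzweil_Integration.integral_combine[of 0 "a n" x k] k a[of n] by simp
    ultimately show ?thesis by simp
  qed
  define g where "g n \<tau> = w \<tau> * (f (ur (a n) \<tau>) - f (ur x \<tau>))" for n \<tau>
  have g: "(g n has_integral (w T * integral {a n..x} (\<lambda>y. u y T) - integral {a n..x} u0)) {0..T}" for n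
    unfolding g_def using sharp_balance[OF a T] .
  have g_int: "g n integrable_on {0..T}" for n using g by (auto simp: integrable_on_def)
  have bd: "norm (g n \<tau>) \<le> exp (K * T) * (2 * F)" if "\<tau> \<in> {0..T} - {0}" for n \<tau>
  proof -
    have "\<bar>f (ur (a n) \<tau>) - f (ur x \<tau>)\<bar> \<le> 2 * F"
      using F(2)[OF ur_bd[of "a n" \<tau>]] F(2)[OF ur_bd[of x \<tau>]] a(1)[of n] x that by simp
    then show ?thesis unfolding g_def real_norm_def abs_mult
      using w_bd[of \<tau> T] w_pos[of \<tau>] that by (intro mult_mono) auto
  qed
  have lim: "(\<lambda>n. g n \<tau>) \<longlonglongrightarrow> w \<tau> * (f (ur 0 \<tau>) - f (ur x \<tau>))" if "\<tau> \<in> {0..T} - {0}" for \<tau>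
    unfolding g_def using that
    by (intro tendsto_mult tendsto_diff tendsto_const continuous_on_tendsto_compose[OF f_cont]
        filterlim_compose[OF ur_right a_right]) auto
  note dom = dominated_convergence_off_negligible[where N="{0}", OF g_int integrable_const_ivl negligible_sing bd lim]
  have "(\<lambda>n. w T * integral {a n..x} (\<lambda>y. u y T) - integral {a n..x} u0)
      \<longlonglongrightarrow> w T * integral {0..x} (\<lambda>y. u y T) - integral {0..x} u0"
  proof (intro tendsto_intros tail)
    show "(\<lambda>y. u y T) integrable_on {0..x}" using T by (rule u_int)
    have "u0 absolutely_integrable_on {0..x}" by (rule set_integrable_subset[OF u0]) auto
    then show "u0 integrable_on {0..x}" by (simp add: absolutely_integrable_on_def)
  qed
  moreover have "(\<lambda>n. w T * integral {a n..x} (\<lambda>y. u y T) - integral {a n..x} u0)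
      \<longlonglongrightarrow> integral {0..T} (\<lambda>\<tau>. w \<tau> * (f (ur 0 \<tau>) - f (ur x \<tau>)))"
    using dom(2) unfolding integral_unique[OF g] .
  ultimately have "w T * integral {0..x} (\<lambda>y. u y T) - integral {0..x} u0 = integral {0..T} (\<lambda>\<tau>. w \<tau> * (f (ur 0 \<tau>) - f (ur x \<tau>)))"
    by (rule LIMSEQ_unique)
  also have "\<dots> = integral {0..T} (\<lambda>\<tau>. w \<tau> * f (ur 0 \<tau>)) - integral {0..T} (\<lambda>\<tau>. w \<tau> * f (ur x \<tau>))"
    using Henstock_Kurzweil_Integration.integral_diff[OF flux_integrable[OF order_refl T] flux_integrable[OF _ T, of x]] x
    by (simp add: right_diff_distrib)
  finally show ?thesis by (simp add: U_def)
qed (simp add: U_def)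

text \<open>The factor exp (K * T) bounds the integrating factor; C bounds the slope in x through u,
  and F bounds the slope in t through the flux.\<close>

lemma potential_U:
  assumes T: "0 < T" and F: "\<And>p. \<bar>p\<bar> \<le> C \<Longrightarrow> \<bar>f p\<bar> \<le> F"
  shows "potential f w U ul ur T (exp (K * T) * (C + F))"
proof
  define B where "B = exp (K * T) * (C + F)"
  have F0: "0 \<le> F" using F[of 0] C_nonneg by simp
  have CB: "exp (K * T) * C \<le> B" "exp (K * T) * F \<le> B" using C_nonneg F0 by (simp_all add: B_def)
  show "0 < T" by (rule T)
  show "continuous_on UNIV f" by (rule f_cont)
  show "continuous_on {0..T} w" by (rule w_cont)
  show "0 < w t" for t by (rule w_pos)
  have flux: "\<bar>w t * f (ur x t)\<bar> \<le> exp (K * T) * F" if "0 \<le> x" "0 < t" "t \<le> T" for x t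
    using w_bd[of t T] w_pos[of t] F[OF ur_bd] that unfolding abs_mult by (intro mult_mono) auto
  show "\<bar>w t * f (ur x t)\<bar> \<le> exp (K * T) * (C + F)" if "0 \<le> x" "0 < t" "t \<le> T" for x t
    using flux[OF that] CB(2) unfolding B_def[symmetric] by linarith
  show dt: "((\<lambda>\<tau>. w \<tau> * f (ur x \<tau>)) has_integral (U x s - U x t)) {s..t}" if "0 \<le> x" "0 \<le> s" "s \<le> t" "t \<le> T" for x s t
  proof -
    have i: "(\<lambda>\<tau>. w \<tau> * f (ur x \<tau>)) integrable_on {0..t}" using that by (intro flux_integrable) auto
    then have "(\<lambda>\<tau>. w \<tau> * f (ur x \<tau>)) integrable_on {s..t}"
      by (rule integrable_on_subinterval) (use that in auto)
    then show ?thesis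
      using Henstock_Kurzweil_Integration.integral_combine[of 0 s t "\<lambda>\<tau>. w \<tau> * f (ur x \<tau>)"] i that
      by (simp add: U_eq has_integral_integrable_integral)
  qed
  have U_diff: "U y t - U x t = w t * integral {x..y} (\<lambda>z. u z t)" if "0 \<le> x" "x \<le> y" "0 \<le> t" for x y t
  proof -
    have "integral {0..y} (\<lambda>z. u z t) = integral {0..x} (\<lambda>z. u z t) + integral {x..y} (\<lambda>z. u z t)"
      using Henstock_Kurzweil_Integration.integral_combine[of 0 x y "\<lambda>z. u z t"] u_int[of t 0 y] that by simp
    then show ?thesis unfolding U_def by (simp add: distrib_left)
  qed
  have lip_x: "\<bar>U y t - U x t\<bar> \<le> B * (y - x)" if "0 \<le> x" "x \<le> y" "0 \<le> t" "t \<le> T" for x y t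
  proof -
    have "\<bar>integral {x..y} (\<lambda>z. u z t) - (y - x) * 0\<bar> \<le> C * (y - x)"
      using u_bd C_nonneg that by (intro integral_close_to_const u_int) auto
    then have "\<bar>w t * integral {x..y} (\<lambda>z. u z t)\<bar> \<le> exp (K * T) * (C * (y - x))"
      unfolding abs_mult using w_bd[of t T] w_pos[of t] that by (intro mult_mono) auto
    also have "\<dots> \<le> B * (y - x)" using CB(1) that by (simp add: mult_right_mono flip: mult.assoc)
    finally show ?thesis using U_diff that by simp
  qed
  have lip_t: "\<bar>U x t - U x s\<bar> \<le> B * (t - s)" if "0 \<le> x" "0 \<le> s" "s \<le> t" "t \<le> T" for x s t
  proof -
    note i = dt[OF that]
    have "\<bar>integral {s..t} (\<lambda>\<tau>. w \<tau> * f (ur x \<tau>)) - (t - s) * 0\<bar> \<le> exp (K * T) * F * (t - s)"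
      using i flux that F0 by (intro integral_close_to_const) (auto simp: integrable_on_def)
    also have "\<dots> \<le> B * (t - s)" using CB(2) that by (simp add: mult_right_mono)
    finally show ?thesis using integral_unique[OF i] by (simp add: abs_minus_commute)
  qed
  show "\<bar>U x s - U y t\<bar> \<le> exp (K * T) * (C + F) * (\<bar>x - y\<bar> + \<bar>s - t\<bar>)"
    if "0 \<le> x" "0 \<le> y" "0 \<le> s" "s \<le> T" "0 \<le> t" "t \<le> T" for x y s t
  proof -
    have "\<bar>U x s - U x t\<bar> \<le> B * \<bar>s - t\<bar>"
      using lip_t[of x s t] lip_t[of x t s] that by (cases "s \<le> t") (auto simp: abs_minus_commute)
    moreover have "\<bar>U x t - U y t\<bar> \<le> B * \<bar>x - y\<bar>"
      using lip_x[of x y t] lip_x[of y x t] that by (cases "x \<le> y") (auto simp: abs_minus_commute)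
    ultimately have "\<bar>U x s - U y t\<bar> \<le> B * (\<bar>x - y\<bar> + \<bar>s - t\<bar>)"
      unfolding distrib_left by linarith
    then show ?thesis unfolding B_def .
  qed
  show "((\<lambda>y. (U y t - U x t) / (y - x)) \<longlongrightarrow> w t * ur x t) (at_right x)" if "0 \<le> x" "0 < t" "t \<le> T" for x t
  proof -
    have "((\<lambda>y. w t * (integral {x..y} (\<lambda>z. u z t) / (y - x))) \<longlongrightarrow> w t * ur x t) (at_right x)"
      using that by (intro tendsto_mult tendsto_const integral_average_right u_right u_int) auto
    then show ?thesis
    proof (rule Lim_transform_eventually)
      show "\<forall>\<^sub>F y in at_right x. w t * (integral {x..y} (\<lambda>z. u z t) / (y - x)) = (U y t - U x t) / (y - x)"
        using U_diff that unfolding eventually_at_right_field by (intro exI[of _ "x + 1"]) auto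
    qed
  qed
  show "((\<lambda>y. (U y t - U x t) / (y - x)) \<longlongrightarrow> w t * ul x t) (at_left x)" if "0 < x" "0 < t" "t \<le> T" for x t
  proof -
    have "((\<lambda>y. w t * (integral {y..x} (\<lambda>z. u z t) / (x - y))) \<longlongrightarrow> w t * ul x t) (at_left x)"
      using that by (intro tendsto_mult tendsto_const integral_average_left[where c=0] u_left u_int) auto
    then show ?thesis
    proof (rule Lim_transform_eventually)
      have "w t * (integral {y..x} (\<lambda>z. u z t) / (x - y)) = (U y t - U x t) / (y - x)" if "0 < y" "y < x" for y
      proof -
        have "w t * (integral {y..x} (\<lambda>z. u z t) / (x - y)) = (U x t - U y t) / (x - y)"
          using U_diff[of y x t] that \<open>0 < t\<close> by simp
        also have "\<dots> = (U y t - U x t) / (y - x)" by (metis minus_diff_eq minus_divide_divide)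
        finally show ?thesis .
      qed
      then show "\<forall>\<^sub>F y in at_left x. w t * (integral {y..x} (\<lambda>z. u z t) / (x - y)) = (U y t - U x t) / (y - x)"
        using that unfolding eventually_at_left_field by (intro exI[of _ 0]) auto
    qed
  qed
  show "((\<lambda>y. ur y t) \<longlongrightarrow> ur x t) (at_right x)" if "0 \<le> x" "0 < t" for x t using that by (rule ur_right)
  show "((\<lambda>y. ur y t) \<longlongrightarrow> ul x t) (at_left x)" if "0 < x" "0 < t" for x t using that by (rule ur_left)
qed

end

section \<open>Bounded variation, traces and bounds\<close>

lemma AE_lebesgue_on_negligible:
  fixes S :: "'a::euclidean_space set"
  assumes "AE x in lebesgue_on S. P x" "S \<in> sets lebesgue"
  obtains N where "negligible N" "\<And>x. x \<in> S \<Longrightarrow> x \<notin> N \<Longrightarrow> P x"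
proof -
  have "AE x in lebesgue. x \<in> S \<longrightarrow> P x"
    using assms by (simp add: AE_restrict_space_iff)
  then obtain N where "N \<in> null_sets lebesgue" "{x \<in> space lebesgue. \<not> (x \<in> S \<longrightarrow> P x)} \<subseteq> N"
    unfolding eventually_ae_filter by auto
  then show ?thesis by (intro that[of N]) (auto simp: negligible_iff_null_sets)
qed

text \<open>Jordan decomposition: the variation function and its difference with the function are monotone.\<close>

lemma BV_on_one_sided_limits:
  assumes "BV_on {0<..} g"
  shows "0 \<le> x \<Longrightarrow> \<exists>l. (g \<longlongrightarrow> l) (at_right x)" "0 < x \<Longrightarrow> \<exists>l. (g \<longlongrightarrow> l) (at_left x)"
proof -
  obtain B where B: "\<And>(n::nat) p. (\<forall>i\<le>n. p i \<in> {0<..}) \<Longrightarrow> (\<forall>i<n. p i \<le> p (Suc i)) \<Longrightarrow>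
      (\<Sum>i<n. \<bar>g (p (Suc i)) - g (p i)\<bar>) \<le> B"
    using assms unfolding BV_on_def by blast
  \<comment> \<open>Variation sums over partitions ending at or before y; their supremum is the
    variation on (0, y].\<close>
  define S where "S y = {\<Sum>i<n. \<bar>g (p (Suc i)) - g (p i)\<bar> | (n::nat) p.
      (\<forall>i\<le>n. p i \<in> {0<..}) \<and> (\<forall>i<n. p i \<le> p (Suc i)) \<and> p n \<le> y}" for y
  define V where "V y = Sup (S y)" for y
  have bdd: "bdd_above (S y)" for y
    by (rule bdd_aboveI[of _ B]) (use B in \<open>auto simp: S_def\<close>)
  have ne: "0 \<in> S y" if "0 < y" for y
    unfolding S_def using that by (intro CollectI exI[of _ 0] exI[of _ "\<lambda>_. y"]) auto
  have V_nonneg: "0 \<le> V y" if "0 < y" for y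
    unfolding V_def by (rule cSup_upper[OF ne[OF that] bdd])
  have V_le: "V y \<le> B" if "0 < y" for y
    unfolding V_def using ne[OF that] B by (intro cSup_least) (auto simp: S_def)
  have step: "V y + \<bar>g z - g y\<bar> \<le> V z" if yz: "0 < y" "y \<le> z" for y z
  proof -
    have "a \<le> V z - \<bar>g z - g y\<bar>" if "a \<in> S y" for a
    proof -
      obtain n and p :: "nat \<Rightarrow> real" where a: "a = (\<Sum>i<n. \<bar>g (p (Suc i)) - g (p i)\<bar>)"
        and p: "\<forall>i\<le>n. p i \<in> {0<..}" "\<forall>i<n. p i \<le> p (Suc i)" "p n \<le> y"
        using \<open>a \<in> S y\<close> unfolding S_def by blast
      \<comment> \<open>A partition ending by y is continued with the points y and z, which raises
        its sum by at least |g z - g y|.\<close>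
      define p' where "p' i = (if i \<le> n then p i else if i = Suc n then y else z)" for i
      have "(\<Sum>i<n. \<bar>g (p' (Suc i)) - g (p' i)\<bar>) = a"
        unfolding a by (rule sum.cong) (auto simp: p'_def)
      then have "(\<Sum>i<Suc (Suc n). \<bar>g (p' (Suc i)) - g (p' i)\<bar>) = a + \<bar>g y - g (p n)\<bar> + \<bar>g z - g y\<bar>"
        by (simp add: p'_def)
      moreover have "(\<Sum>i<Suc (Suc n). \<bar>g (p' (Suc i)) - g (p' i)\<bar>) \<in> S z"
        unfolding S_def
      proof (intro CollectI exI[of _ "Suc (Suc n)"] exI[of _ p'] conjI refl)
        show "\<forall>i\<le>Suc (Suc n). p' i \<in> {0<..}" using p(1) yz by (auto simp: p'_def)
        show "\<forall>i<Suc (Suc n). p' i \<le> p' (Suc i)"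
        proof (intro allI impI)
          fix i assume "i < Suc (Suc n)"
          then consider "i < n" | "i = n" | "i = Suc n" by linarith
          then show "p' i \<le> p' (Suc i)" using p yz by cases (auto simp: p'_def)
        qed
        show "p' (Suc (Suc n)) \<le> z" by (simp add: p'_def)
      qed
      then have "(\<Sum>i<Suc (Suc n). \<bar>g (p' (Suc i)) - g (p' i)\<bar>) \<le> V z"
        unfolding V_def by (rule cSup_upper[OF _ bdd])
      ultimately show ?thesis by linarith
    qed
    then have "V y \<le> V z - \<bar>g z - g y\<bar>"
      unfolding V_def[of y] using ne[OF yz(1)] by (intro cSup_least) auto
    then show ?thesis by simp
  qed
  define W where "W y = V y - g y" for y
  have V_mono: "V y \<le> V z" and W_mono: "W y \<le> W z" if "0 < y" "y \<le> z" for y z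
    using step[OF that] by (auto simp: W_def abs_le_iff)
  have gd: "\<bar>g z - g y\<bar> \<le> B" if "0 < y" "0 < z" for y z
    using step[of y z] step[of z y] that V_nonneg[of y] V_nonneg[of z] V_le[of y] V_le[of z] by (cases "y \<le> z") auto
  have W_bd: "- \<bar>g 1\<bar> - B \<le> W y" "W y \<le> B + (\<bar>g 1\<bar> + B)" if "0 < y" for y
    using V_nonneg[OF that] V_le[OF that] gd[of y 1] that by (auto simp: W_def)
  have gVW: "g = (\<lambda>y. V y - W y)" by (simp add: W_def)
  show "\<exists>l. (g \<longlongrightarrow> l) (at_right x)" if x: "0 \<le> x"
  proof -
    have "(V \<longlongrightarrow> Inf (V ` ({x<..} \<inter> UNIV))) (at x within ({x<..} \<inter> UNIV))"
      by (rule Lim_right_bound[where K=0]) (use x V_mono V_nonneg in auto)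
    moreover have "(W \<longlongrightarrow> Inf (W ` ({x<..} \<inter> UNIV))) (at x within ({x<..} \<inter> UNIV))"
      by (rule Lim_right_bound[where K="- \<bar>g 1\<bar> - B"]) (use x W_mono W_bd in auto)
    ultimately show ?thesis
      by (subst gVW) (auto intro!: exI tendsto_diff)
  qed
  show "\<exists>l. (g \<longlongrightarrow> l) (at_left x)" if x: "0 < x"
  proof -
    have eq: "at x within ({..<x} \<inter> {0<..}) = at_left x"
      by (rule at_within_nhd[of x "{0<..}"]) (use x in auto)
    have "(V \<longlongrightarrow> Sup (V ` ({..<x} \<inter> {0<..}))) (at x within ({..<x} \<inter> {0<..}))"
      by (rule Lim_left_bound[where K=B]) (use x V_mono V_le in auto)
    moreover have "(W \<longlongrightarrow> Sup (W ` ({..<x} \<inter> {0<..}))) (at x within ({..<x} \<inter> {0<..}))"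
      by (rule Lim_left_bound[where K="B + (\<bar>g 1\<bar> + B)"]) (use x W_mono W_bd in auto)
    ultimately show ?thesis unfolding eq
      by (subst gVW) (auto intro!: exI tendsto_diff)
  qed
qed

section \<open>Null sets and bounds on time slices\<close>

lemma negligible_no_interval:
  fixes N :: "real set"
  assumes "negligible N" "a < b"
  obtains x where "a < x" "x < b" "x \<notin> N"
proof -
  have "\<not> negligible {a<..<b}" using assms(2) by (intro open_not_negligible) auto
  then have "\<not> {a<..<b} \<subseteq> N" using negligible_subset[OF assms(1)] by blast
  then obtain x where "x \<in> {a<..<b}" "x \<notin> N" by blast
  then show ?thesis by (intro that[of x]) auto
qed

lemma ae_zero_if_integrals_zero:
  fixes h :: "real \<Rightarrow> real"
  assumes "\<And>s t. a \<le> s \<Longrightarrow> s \<le> t \<Longrightarrow> t \<le> b \<Longrightarrow> (h has_integral 0) {s..t}"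
  obtains N where "negligible N" "\<And>t. a < t \<Longrightarrow> t < b \<Longrightarrow> t \<notin> N \<Longrightarrow> h t = 0"
proof -
  have "(h has_integral ((\<lambda>_. 0) t - (\<lambda>_. 0) s)) {s..t}" if "a \<le> s" "s \<le> t" "t \<le> b" for s t
    using assms[OF that] by simp
  from ae_deriv_of_integral[OF this] obtain N where N: "negligible N"
    "\<And>t. a < t \<Longrightarrow> t < b \<Longrightarrow> t \<notin> N \<Longrightarrow> ((\<lambda>_. 0) has_real_derivative h t) (at t)" by blast
  have "h t = 0" if "a < t" "t < b" "t \<notin> N" for t
    using DERIV_unique[OF N(2)[OF that] DERIV_const] .
  then show ?thesis using that N(1) by blast
qed

lemma ae_zero_if_integral_zero_nonneg:
  fixes h :: "real \<Rightarrow> real"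
  assumes h: "(h has_integral 0) {a..b}" "\<And>x. 0 \<le> h x"
  obtains N where "negligible N" "\<And>t. a < t \<Longrightarrow> t < b \<Longrightarrow> t \<notin> N \<Longrightarrow> h t = 0"
proof (rule ae_zero_if_integrals_zero[of a b h])
  fix s t assume st: "a \<le> s" "s \<le> t" "t \<le> b"
  have i: "h integrable_on {s..t}"
    by (rule integrable_on_subinterval[OF has_integral_integrable[OF h(1)]]) (use st in auto)
  have "integral {s..t} h \<le> integral {a..b} h"
    using st h i by (intro integral_subset_le) (auto intro: has_integral_integrable)
  moreover have "0 \<le> integral {s..t} h" using i h(2) by (intro Henstock_Kurzweil_Integration.integral_nonneg) auto
  ultimately have "integral {s..t} h = 0" using integral_unique[OF h(1)] by simp
  then show "(h has_integral 0) {s..t}" using i by (metis integrable_integral)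
next
  fix N assume "negligible N" "\<And>t. a < t \<Longrightarrow> t < b \<Longrightarrow> t \<notin> N \<Longrightarrow> h t = 0"
  then show thesis by (rule that)
qed

text \<open>Fubini for null sets. The exceptional set is first enlarged to a Borel null set of the
  product measure, so that the order of the two almost-everywhere quantifiers may be
  exchanged.\<close>

lemma Linfty_slices:
  assumes "Linfty_on quadrant (\<lambda>(x, t). u x t)"
  obtains C M where "negligible M" "0 \<le> C"
    "\<And>t. 0 < t \<Longrightarrow> t \<notin> M \<Longrightarrow> \<exists>N. negligible N \<and> (\<forall>x>0. x \<notin> N \<longrightarrow> \<bar>u x t\<bar> \<le> C)"
proof -
  obtain C where C: "AE p in lebesgue_on quadrant. \<bar>case p of (x, t) \<Rightarrow> u x t\<bar> \<le> C"
    using assms unfolding Linfty_on_def by blast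
  have q: "quadrant \<in> sets lebesgue"
  proof -
    have "open quadrant" unfolding quadrant_def by (intro open_Times) auto
    then show ?thesis by (intro sets_completionI_sets) simp
  qed
  obtain N0 where N0: "negligible N0" "\<And>p. p \<in> quadrant \<Longrightarrow> p \<notin> N0 \<Longrightarrow> \<bar>case p of (x, t) \<Rightarrow> u x t\<bar> \<le> C"
    using AE_lebesgue_on_negligible[OF C q] by blast
  have "N0 \<in> null_sets (completion lborel)" using N0(1) by (simp add: negligible_iff_null_sets)
  then obtain N1 where N1: "N1 \<in> null_sets lborel" "N0 \<subseteq> N1"
    unfolding null_sets_completion_iff2 by blast
  have "AE p in lborel. p \<notin> N1" using N1(1) by (rule AE_not_in)
  then have ae: "AE p in lborel \<Otimes>\<^sub>M (lborel :: real measure). (fst p, snd p) \<notin> N1"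
    by (subst lborel_prod) simp
  have N1_sets: "N1 \<in> sets (lborel \<Otimes>\<^sub>M lborel)" using N1(1) by (subst lborel_prod) (auto simp: null_sets_def)
  have "AE x in lborel. AE t in lborel. (x, t) \<notin> N1" using lborel_pair.AE_pair[OF ae] by simp
  moreover have "{p \<in> space (lborel \<Otimes>\<^sub>M (lborel :: real measure)). (fst p, snd p) \<notin> N1} \<in> sets (lborel \<Otimes>\<^sub>M lborel)"
  proof -
    have "{p \<in> space (lborel \<Otimes>\<^sub>M (lborel :: real measure)). (fst p, snd p) \<notin> N1} = space (lborel \<Otimes>\<^sub>M lborel) - N1" by auto
    then show ?thesis using sets.compl_sets[OF N1_sets] by (simp only:)
  qed
  ultimately have "AE t in lborel. AE x in lborel. (x, t) \<notin> N1"
    using lborel_pair.AE_commute[of "\<lambda>x t. (x, t) \<notin> N1"] by simp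
  then obtain M where M: "M \<in> null_sets lborel" "{t \<in> space lborel. \<not> (AE x in lborel. (x, t) \<notin> N1)} \<subseteq> M"
    unfolding eventually_ae_filter by auto
  show ?thesis
  proof (rule that[of M "\<bar>C\<bar>"])
    show "negligible M" using M(1) by (simp add: negligible_iff_null_sets null_sets_completionI)
    show "0 \<le> \<bar>C\<bar>" by simp
    fix t assume t: "0 < t" "t \<notin> M"
    then have "AE x in lborel. (x, t) \<notin> N1" using M(2) by auto
    then obtain N where N: "N \<in> null_sets lborel" "{x \<in> space lborel. \<not> (x, t) \<notin> N1} \<subseteq> N"
      unfolding eventually_ae_filter by auto
    show "\<exists>N. negligible N \<and> (\<forall>x>0. x \<notin> N \<longrightarrow> \<bar>u x t\<bar> \<le> \<bar>C\<bar>)"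
    proof (intro exI[of _ N] conjI allI impI)
      show "negligible N" using N(1) by (simp add: negligible_iff_null_sets null_sets_completionI)
      fix x :: real assume x: "0 < x" "x \<notin> N"
      then have "(x, t) \<notin> N0" using N(2) N1(2) by auto
      then show "\<bar>u x t\<bar> \<le> \<bar>C\<bar>" using N0(2)[of "(x, t)"] x t by (simp add: quadrant_def)
    qed
  qed
qed

lemma continuous_into_L1locD:
  assumes u: "continuous_into_L1loc u" and ab: "0 < a" and t: "0 \<le> t"
  shows "(\<lambda>x. u x t) absolutely_integrable_on {a..b}"
    "((\<lambda>s. integral {a..b} (\<lambda>x. \<bar>u x s - u x t\<bar>)) \<longlongrightarrow> 0) (at t within {0..})"
proof -
  have sub: "compact {a..b}" "{a..b} \<subseteq> {0<..}" using ab by auto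
  note D = u[unfolded continuous_into_L1loc_def, rule_format, OF _ sub]
  have *: "(\<lambda>x. u x s) absolutely_integrable_on {a..b}" if "0 \<le> s" for s
    using D[of "s + 1" s] that by simp
  then show "(\<lambda>x. u x t) absolutely_integrable_on {a..b}" using t .
  have "((\<lambda>s. LINT x:{a..b}|lebesgue. \<bar>u x s - u x t\<bar>) \<longlongrightarrow> 0) (at t within {0..t+1})"
    using D[of "t + 1" t] t by simp
  moreover have "at t within {0..t+1} = at t within {0..}"
    by (rule at_within_nhd[of t "{..<t+1}"]) auto
  ultimately have lim: "((\<lambda>s. LINT x:{a..b}|lebesgue. \<bar>u x s - u x t\<bar>) \<longlongrightarrow> 0) (at t within {0..})" by simp
  have eq: "(LINT x:{a..b}|lebesgue. \<bar>u x s - u x t\<bar>) = integral {a..b} (\<lambda>x. \<bar>u x s - u x t\<bar>)" if "0 \<le> s" for s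
    by (intro set_lebesgue_integral_eq_integral(2) set_integrable_abs set_integral_diff(1) *[OF that] *[OF t])
  show "((\<lambda>s. integral {a..b} (\<lambda>x. \<bar>u x s - u x t\<bar>)) \<longlongrightarrow> 0) (at t within {0..})"
    by (rule Lim_transform_eventually[OF lim]) (auto simp: eventually_at_filter eq intro!: always_eventually)
qed

text \<open>The essential bound gives bounded slices for almost every time. Every t is a limit of
  such times s, and for these the excess of |u| over C at time t is at most |u x s - u x t| almost
  everywhere; by continuity into L^1 its integral vanishes.\<close>

lemma bounded_slices:
  assumes "Linfty_on quadrant (\<lambda>(x, t). u x t)" and u: "continuous_into_L1loc u"
  obtains C where "0 \<le> C" "\<And>t. 0 \<le> t \<Longrightarrow> \<exists>N. negligible N \<and> (\<forall>x>0. x \<notin> N \<longrightarrow> \<bar>u x t\<bar> \<le> C)"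
proof -
  obtain C M where M: "negligible M" and C: "0 \<le> C"
    "\<And>t. 0 < t \<Longrightarrow> t \<notin> M \<Longrightarrow> \<exists>N. negligible N \<and> (\<forall>x>0. x \<notin> N \<longrightarrow> \<bar>u x t\<bar> \<le> C)"
    using Linfty_slices[OF assms(1)] by metis
  have "\<exists>N. negligible N \<and> (\<forall>x>0. x \<notin> N \<longrightarrow> \<bar>u x t\<bar> \<le> C)" if t: "0 \<le> t" for t
  proof -
    have slab: "\<exists>N. negligible N \<and> (\<forall>x. a < x \<longrightarrow> x < b \<longrightarrow> x \<notin> N \<longrightarrow> \<bar>u x t\<bar> \<le> C)" if a: "0 < a" for a b
    proof -
      define e where "e x = max 0 (\<bar>u x t\<bar> - C)" for x
      have ut: "(\<lambda>x. u x t) absolutely_integrable_on {a..b}" by (rule continuous_into_L1locD(1)[OF u a t])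
      have "e absolutely_integrable_on {a..b}"
        unfolding e_def by (intro absolutely_integrable_max_1 set_integral_diff(1) set_integrable_abs ut absolutely_integrable_on_const) auto
      then have ei: "e integrable_on {a..b}" by (simp add: absolutely_integrable_on_def)
      have small: "integral {a..b} e \<le> d" if d: "0 < d" for d
      proof -
        have "\<forall>\<^sub>F s in at t within {0..}. dist (integral {a..b} (\<lambda>x. \<bar>u x s - u x t\<bar>)) 0 < d"
          using continuous_into_L1locD(2)[OF u a t] d by (rule tendstoD)
        then obtain r where r: "r > 0" "\<And>s. s \<in> {0..} \<Longrightarrow> s \<noteq> t \<Longrightarrow> dist s t < r \<Longrightarrow>
            \<bar>integral {a..b} (\<lambda>x. \<bar>u x s - u x t\<bar>)\<bar> < d"
          unfolding eventually_at by (auto simp: dist_real_def)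
        obtain s where s: "t < s" "s < t + r" "s \<notin> M" using negligible_no_interval[OF M, of t "t + r"] r(1) by auto
        obtain N where N: "negligible N" "\<forall>x>0. x \<notin> N \<longrightarrow> \<bar>u x s\<bar> \<le> C" using C(2)[of s] s t by auto
        have "(\<lambda>x. u x s) absolutely_integrable_on {a..b}" by (rule continuous_into_L1locD(1)[OF u a]) (use s t in simp)
        then have di: "(\<lambda>x. \<bar>u x s - u x t\<bar>) integrable_on {a..b}"
          using ut by (intro set_lebesgue_integral_eq_integral(1) set_integrable_abs set_integral_diff(1))
        have "integral {a..b} e \<le> integral {a..b} (\<lambda>x. if x \<in> N then e x else \<bar>u x s - u x t\<bar>)"
        proof (rule integral_le[OF ei])
          show "(\<lambda>x. if x \<in> N then e x else \<bar>u x s - u x t\<bar>) integrable_on {a..b}"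
            by (rule integrable_spike[OF di N(1)]) auto
          fix x assume "x \<in> {a..b}"
          then show "e x \<le> (if x \<in> N then e x else \<bar>u x s - u x t\<bar>)"
            using N(2)[rule_format, of x] a by (auto simp: e_def)
        qed
        also have "\<dots> = integral {a..b} (\<lambda>x. \<bar>u x s - u x t\<bar>)"
          by (rule integral_spike[OF N(1)]) auto
        also have "\<dots> \<le> d" using r(2)[of s] s t by (simp add: dist_real_def)
        finally show ?thesis .
      qed
      have "integral {a..b} e \<le> 0"
      proof (rule field_le_epsilon)
        show "integral {a..b} e \<le> 0 + d" if "0 < d" for d using small[OF that] by simp
      qed
      moreover have "0 \<le> integral {a..b} e" using ei by (intro Henstock_Kurzweil_Integration.integral_nonneg) (auto simp: e_def)
      ultimately have "(e has_integral 0) {a..b}" using ei by (metis antisym integrable_integral)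
      then obtain N where "negligible N" "\<And>x. a < x \<Longrightarrow> x < b \<Longrightarrow> x \<notin> N \<Longrightarrow> e x = 0"
        by (rule ae_zero_if_integral_zero_nonneg) (auto simp: e_def)
      then show ?thesis by (intro exI[of _ N]) (force simp: e_def max_def split: if_splits)
    qed
    have "\<forall>n::nat. \<exists>N. negligible N \<and> (\<forall>x. inverse (real (Suc n)) < x \<longrightarrow> x < real (Suc n) \<longrightarrow> x \<notin> N \<longrightarrow> \<bar>u x t\<bar> \<le> C)"
      using slab by simp
    from choice[OF this] obtain N where N: "\<And>n. negligible (N n)"
      "\<And>n x. inverse (real (Suc n)) < x \<Longrightarrow> x < real (Suc n) \<Longrightarrow> x \<notin> N n \<Longrightarrow> \<bar>u x t\<bar> \<le> C" by blast
    show ?thesis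
    proof (intro exI[of _ "\<Union>n. N n"] conjI allI impI)
      show "negligible (\<Union>n. N n)" by (intro negligible_Union_nat N(1))
      fix x :: real assume x: "0 < x" "x \<notin> (\<Union>n. N n)"
      obtain n where n: "max x (inverse x) < real n" using reals_Archimedean2 by blast
      have "inverse (real (Suc n)) < inverse (inverse x)"
        using n x by (intro less_imp_inverse_less) auto
      then have "inverse (real (Suc n)) < x" "x < real (Suc n)" using n by auto
      then show "\<bar>u x t\<bar> \<le> C" using N(2)[of n x] x by blast
    qed
  qed
  then show ?thesis using that C(1) by blast
qed

text \<open>Reduces the set integrals of the weak formulation to integrals over a compact interval.
  Integrability of F on S is inherited from g across the null set N.\<close>

lemma set_lebesgue_integral_eq_Icc:
  fixes F g :: "real \<Rightarrow> real"
  assumes g: "g absolutely_integrable_on {a..b}" and N: "negligible N"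
    and out: "\<And>x. x \<in> {a..b} \<Longrightarrow> x \<notin> N \<Longrightarrow> x \<in> S"
    and eq: "\<And>x. x \<in> S \<Longrightarrow> x \<notin> N \<Longrightarrow> F x = (if x \<in> {a..b} then g x else 0)"
  shows "(LINT x:S|lebesgue. F x) = integral {a..b} g"
proof -
  define G where "G x = (if x \<in> {a..b} then g x else 0)" for x
  have G: "G absolutely_integrable_on UNIV"
    using g unfolding G_def set_integrable_def
    by (rule back_subst[of "integrable lebesgue"]) (auto simp: fun_eq_iff indicator_def)
  have "(\<lambda>x. if x \<in> S then F x else 0) absolutely_integrable_on UNIV"
    by (rule absolutely_integrable_spike[OF G N]) (use eq out in \<open>auto simp: G_def\<close>)
  then have "F absolutely_integrable_on S"
    unfolding set_integrable_def
    by (rule back_subst[of "integrable lebesgue"]) (auto simp: fun_eq_iff indicator_def)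
  then have "(LINT x:S|lebesgue. F x) = integral S F" by (rule set_lebesgue_integral_eq_integral(2))
  also have "\<dots> = integral UNIV (\<lambda>x. if x \<in> S then F x else 0)" by (simp add: integral_restrict_UNIV)
  also have "\<dots> = integral UNIV G"
    by (rule integral_spike[OF N]) (use eq out in \<open>auto simp: G_def\<close>)
  also have "\<dots> = integral {a..b} g" unfolding G_def by (rule integral_restrict_UNIV)
  finally show ?thesis .
qed

section \<open>From weak solutions to bounded representatives\<close>

lemma test_function_product:
  assumes \<xi>: "smooth_derivs \<xi>" and \<omega>: "smooth_derivs \<omega>" and a: "0 < a"
    and \<xi>0: "\<And>x. x \<le> a \<or> b \<le> x \<Longrightarrow> \<xi> 0 x = 0" and \<omega>0: "\<And>t. S \<le> t \<Longrightarrow> \<omega> 0 t = 0"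
  shows "test_function (\<lambda>x t. \<xi> 0 x * \<omega> 0 t)"
  unfolding test_function_def
proof (intro conjI exI[of _ "{a..b} \<times> {0..S}"])
  show "Ck_on \<infinity> ({0<..} \<times> {0..}) (\<lambda>x t. \<xi> 0 x * \<omega> 0 t)"
    unfolding Ck_on_def
  proof (intro exI[of _ "\<lambda>i j x t. \<xi> i x * \<omega> j t"] conjI allI impI ballI, goal_cases)
    case (2 i j)
    show ?case unfolding split_beta
      by (intro continuous_intros continuous_on_compose2[OF smooth_derivs_imp_continuous[OF \<xi>, of UNIV]]
          continuous_on_compose2[OF smooth_derivs_imp_continuous[OF \<omega>, of UNIV]]) auto
  next
    case (3 i j p)
    obtain x t where p: "p = (x, t)" by fastforce
    show ?case unfolding p
      by (auto intro!: DERIV_cmult DERIV_cmult_right DERIV_subset[OF smooth_derivsD[OF \<xi>] subset_UNIV]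
          DERIV_subset[OF smooth_derivsD[OF \<omega>] subset_UNIV])
  qed auto
  show "compact ({a..b} \<times> {0..S})" by (intro compact_Times) auto
  show "{a..b} \<times> {0..S} \<subseteq> {0<..} \<times> {0..}" using a by auto
  show "vanishes_off ({a..b} \<times> {0..S}) ({0<..} \<times> {0..}) (\<lambda>x t. \<xi> 0 x * \<omega> 0 t)"
  proof -
    have *: "\<xi> 0 x * \<omega> 0 t = 0" if "0 \<le> t" "(x, t) \<notin> {a..b} \<times> {0..S}" for x t
    proof -
      have "x \<le> a \<or> b \<le> x \<or> S \<le> t" using that by auto
      then show ?thesis using \<xi>0[of x] \<omega>0[of t] by auto
    qed
    show ?thesis unfolding vanishes_off_def
    proof (rule ballI, unfold split_paired_all prod.case)
      fix x t :: real assume "(x, t) \<in> {0<..} \<times> {0..} - {a..b} \<times> {0..S}"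
      then show "\<xi> 0 x * \<omega> 0 t = 0" by (intro *) auto
    qed
  qed
qed

text \<open>A representative that is bounded everywhere and has the same traces.\<close>

definition clamp_to :: "real \<Rightarrow> (real \<Rightarrow> real \<Rightarrow> real) \<Rightarrow> real \<Rightarrow> real \<Rightarrow> real" where
  "clamp_to C u x t = (if 0 < x then max (- C) (min C (u x t)) else 0)"

text \<open>Truncation does not increase distances, so continuity into L^1 is inherited. The local
  integrability of the slices refers to compact subsets of x > 0, hence measurability is obtained by
  exhausting that half-line with the intervals [1 / (n + 1), n + 1].\<close>

lemma clamp_to_bounded_flow:
  assumes f: "continuous_on UNIV f" and f_lip: "\<And>p q. \<bar>p\<bar> \<le> C \<Longrightarrow> \<bar>q\<bar> \<le> C \<Longrightarrow> \<bar>f p - f q\<bar> \<le> \<kappa> * \<bar>p - q\<bar>"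
    and \<kappa>: "0 \<le> \<kappa>" and C: "0 \<le> C" and u: "continuous_into_L1loc u"
    and \<alpha>: "\<alpha> \<in> borel_measurable lebesgue" "\<And>t. \<bar>\<alpha> t\<bar> \<le> K"
  shows "bounded_flow f \<alpha> (clamp_to C u) C K \<kappa>"
proof
  show "\<bar>clamp_to C u x t\<bar> \<le> C" for x t using C by (auto simp: clamp_to_def)
  show meas: "(\<lambda>x. clamp_to C u x t) \<in> borel_measurable lebesgue" if t: "0 \<le> t" for t
  proof -
    define v where "v n x = indicator {inverse (real (Suc n))..real (Suc n)} x * u x t" for n x
    have "v n \<in> borel_measurable lebesgue" for n
    proof -
      have "(\<lambda>x. u x t) absolutely_integrable_on {inverse (real (Suc n))..real (Suc n)}"
        by (rule continuous_into_L1locD(1)[OF u _ t]) simp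
      then show ?thesis unfolding v_def set_integrable_def by (auto dest: borel_measurable_integrable)
    qed
    moreover have "(\<lambda>n. v n x) \<longlonglongrightarrow> (if 0 < x then u x t else 0)" for x
    proof (cases "0 < x")
      case True
      have "\<forall>\<^sub>F n in sequentially. v n x = u x t"
      proof -
        obtain n0 where n0: "max x (inverse x) < real n0" using reals_Archimedean2 by blast
        have "v n x = u x t" if "n \<ge> n0" for n
        proof -
          have "inverse x < real (Suc n)" "x < real (Suc n)" using n0 that by auto
          then have "inverse (real (Suc n)) < inverse (inverse x)" using True by (intro less_imp_inverse_less) auto
          then show ?thesis using \<open>x < real (Suc n)\<close> by (simp add: v_def)
        qed
        then show ?thesis by (auto simp: eventually_sequentially)
      qed
      then show ?thesis using True by (simp add: tendsto_eventually)
    next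
      case False
      then have "x < inverse (real (Suc n))" for n by (smt (verit) inverse_positive_iff_positive of_nat_0_less_iff zero_less_Suc)
      then have "v n x = 0" for n by (simp add: v_def indicator_def not_le)
      then show ?thesis using False by simp
    qed
    ultimately have "(\<lambda>x. if 0 < x then u x t else 0) \<in> borel_measurable lebesgue"
      by (rule borel_measurable_LIMSEQ_real[rotated])
    then have "(\<lambda>x. max (- C) (min C (if 0 < x then u x t else 0))) \<in> borel_measurable lebesgue" by measurable
    moreover have "max (- C) (min C (if 0 < x then u x t else 0)) = clamp_to C u x t" for x
      using C by (simp add: clamp_to_def)
    ultimately show ?thesis by simp
  qed
  show "((\<lambda>s. integral {a..b} (\<lambda>x. \<bar>clamp_to C u x s - clamp_to C u x t\<bar>)) \<longlongrightarrow> 0) (at t within {0..})"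
    if ab: "0 < a" "a < b" and t: "0 \<le> t" for a b t
  proof (rule Lim_null_comparison[OF _ continuous_into_L1locD(2)[OF u ab(1) t]])
    have "norm (integral {a..b} (\<lambda>x. \<bar>clamp_to C u x s - clamp_to C u x t\<bar>)) \<le> integral {a..b} (\<lambda>x. \<bar>u x s - u x t\<bar>)"
      if s: "0 \<le> s" for s
    proof (rule integral_norm_bound_integral)
      show "(\<lambda>x. \<bar>clamp_to C u x s - clamp_to C u x t\<bar>) integrable_on {a..b}"
      proof (rule bounded_measurable_integrable)
        show "(\<lambda>x. \<bar>clamp_to C u x s - clamp_to C u x t\<bar>) \<in> borel_measurable lebesgue"
          using meas[OF s] meas[OF t] by measurable
        show "\<bar>\<bar>clamp_to C u x s - clamp_to C u x t\<bar>\<bar> \<le> 2 * C" for x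
          using C by (auto simp: clamp_to_def)
      qed
      show "(\<lambda>x. \<bar>u x s - u x t\<bar>) integrable_on {a..b}"
        by (intro set_lebesgue_integral_eq_integral(1) set_integrable_abs set_integral_diff(1)
            continuous_into_L1locD(1)[OF u ab(1)] s t)
      show "norm \<bar>clamp_to C u x s - clamp_to C u x t\<bar> \<le> \<bar>u x s - u x t\<bar>" for x
        by (auto simp: clamp_to_def)
    qed
    then show "\<forall>\<^sub>F s in at t within {0..}. norm (integral {a..b} (\<lambda>x. \<bar>clamp_to C u x s - clamp_to C u x t\<bar>))
        \<le> integral {a..b} (\<lambda>x. \<bar>u x s - u x t\<bar>)"
      unfolding eventually_at_filter by (intro always_eventually allI impI) simp
  qed
qed (use f f_lip \<kappa> \<alpha> in auto)

text \<open>Every one-sided neighbourhood contains points outside the null set N, so the limit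
  itself lies in [-C, C] and truncation leaves it unchanged.\<close>

lemma tendsto_clamp_to:
  assumes lim: "((\<lambda>y. u y t) \<longlongrightarrow> l) F" and N: "negligible N" "\<forall>x>0. x \<notin> N \<longrightarrow> \<bar>u x t\<bar> \<le> C"
    and F: "F = at_right x \<and> 0 \<le> x \<or> F = at_left x \<and> 0 < x"
  shows "((\<lambda>y. clamp_to C u y t) \<longlongrightarrow> l) F"
proof -
  have ev: "\<exists>a b. 0 \<le> a \<and> a < b \<and> (\<forall>y. a < y \<longrightarrow> y < b \<longrightarrow> P y)" if "eventually P F" for P
  proof -
    consider "F = at_right x" "0 \<le> x" | "F = at_left x" "0 < x" using F by blast
    then show ?thesis
    proof cases
      case 1
      then obtain b where "b > x" "\<forall>y>x. y < b \<longrightarrow> P y" using \<open>eventually P F\<close> unfolding 1(1) eventually_at_right_field by blast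
      then show ?thesis using 1(2) by blast
    next
      case 2
      then obtain a where "a < x" "\<forall>y>a. y < x \<longrightarrow> P y" using \<open>eventually P F\<close> unfolding 2(1) eventually_at_left_field by blast
      then show ?thesis using 2(2) by (intro exI[of _ "max 0 a"] exI[of _ x]) auto
    qed
  qed
  have "\<bar>l\<bar> \<le> C"
  proof (rule ccontr)
    assume "\<not> \<bar>l\<bar> \<le> C"
    then have "\<forall>\<^sub>F y in F. C < \<bar>u y t\<bar>"
      using tendsto_rabs[OF lim] by (intro order_tendstoD(1)) auto
    from ev[OF this] obtain a b where ab: "0 \<le> a" "a < b" "\<forall>y. a < y \<longrightarrow> y < b \<longrightarrow> C < \<bar>u y t\<bar>" by blast
    obtain y where "a < y" "y < b" "y \<notin> N" using negligible_no_interval[OF N(1) ab(2)] by blast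
    then have "C < \<bar>u y t\<bar>" "\<bar>u y t\<bar> \<le> C" using N(2) ab(1,3) by simp_all
    then show False by simp
  qed
  then have l: "max (- C) (min C l) = l" by (simp add: abs_le_iff)
  have "((\<lambda>y. max (- C) (min C (u y t))) \<longlongrightarrow> max (- C) (min C l)) F"
    by (intro tendsto_max tendsto_min tendsto_const lim)
  moreover have "\<forall>\<^sub>F y in F. max (- C) (min C (u y t)) = clamp_to C u y t"
  proof -
    have "\<forall>\<^sub>F y in F. 0 < y"
    proof -
      have "\<forall>\<^sub>F y in at_right x. 0 < y" if "0 \<le> x"
        using that unfolding eventually_at_right_field by (intro exI[of _ "x + 1"]) auto
      moreover have "\<forall>\<^sub>F y in at_left x. 0 < y" if "0 < x"
        using that unfolding eventually_at_left_field by (intro exI[of _ 0]) auto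
      ultimately show ?thesis using F by blast
    qed
    then show ?thesis by eventually_elim (simp add: clamp_to_def)
  qed
  ultimately show ?thesis unfolding l by (rule Lim_transform_eventually)
qed

text \<open>The weak identity is tested with products. At each positive time the slice and its
  truncation agree almost everywhere, which settles the inner integral; the times at which \<alpha>
  and \<beta> differ disappear in the outer one.\<close>

lemma weak_solution_balance_law:
  assumes f: "continuous_on UNIV f" and f_lip: "\<And>p q. \<bar>p\<bar> \<le> C \<Longrightarrow> \<bar>q\<bar> \<le> C \<Longrightarrow> \<bar>f p - f q\<bar> \<le> \<kappa> * \<bar>p - q\<bar>"
    and \<kappa>: "0 \<le> \<kappa>" and C: "0 \<le> C"
    and bd: "\<And>t. 0 \<le> t \<Longrightarrow> \<exists>N. negligible N \<and> (\<forall>x>0. x \<notin> N \<longrightarrow> \<bar>u x t\<bar> \<le> C)"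
    and \<beta>: "\<beta> \<in> borel_measurable lebesgue" "\<And>t. \<bar>\<beta> t\<bar> \<le> K"
    and \<alpha>\<beta>: "negligible N\<alpha>" "\<And>t. 0 \<le> t \<Longrightarrow> t \<notin> N\<alpha> \<Longrightarrow> \<alpha> t = \<beta> t"
    and u0: "set_integrable lebesgue {0..} u0"
    and u: "weak_solution f \<alpha> u0 ub u"
    and H: "smooth_derivs H" "\<And>x. x \<le> 0 \<Longrightarrow> H 0 x = 0" "\<And>x. 1 \<le> x \<Longrightarrow> H 0 x = 1"
      "\<And>x. 0 \<le> H 1 x" "\<And>x. x \<le> 0 \<or> 1 \<le> x \<Longrightarrow> H 1 x = 0" "\<And>x. 0 \<le> H 0 x \<and> H 0 x \<le> 1"
  shows "balance_law f \<beta> (clamp_to C u) C K \<kappa> u0 H"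
proof -
  have L1: "continuous_into_L1loc u" and BV: "\<And>t. 0 < t \<Longrightarrow> BV_on {0<..} (\<lambda>x. u x t)"
    using u by (simp_all add: weak_solution_def)
  interpret bounded_flow f \<beta> "clamp_to C u" C K \<kappa>
    by (rule clamp_to_bounded_flow[OF f f_lip \<kappa> C L1 \<beta>])
  define v where "v = clamp_to C u"
  have v_eq: "v x t = u x t" if "0 < x" "\<bar>u x t\<bar> \<le> C" for x t
    using that by (simp add: v_def clamp_to_def abs_le_iff)
  show ?thesis
  proof (intro balance_law.intro balance_law_axioms.intro bounded_flow_axioms)
    show "u0 absolutely_integrable_on {0..}" by (rule u0)
    show "\<exists>l. ((\<lambda>y. clamp_to C u y t) \<longlongrightarrow> l) (at_right x)" if "0 \<le> x" "0 < t" for x t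
      using BV_on_one_sided_limits(1)[OF BV[OF that(2)] that(1)] bd[of t] that tendsto_clamp_to[where F="at_right x" and x=x]
      by (meson less_imp_le)
    show "\<exists>l. ((\<lambda>y. clamp_to C u y t) \<longlongrightarrow> l) (at_left x)" if "0 < x" "0 < t" for x t
      using BV_on_one_sided_limits(2)[OF BV[OF that(2)] that(1)] bd[of t] that tendsto_clamp_to[where F="at_left x" and x=x]
      by (meson less_imp_le)
    fix \<xi> \<omega> :: "nat \<Rightarrow> real \<Rightarrow> real" and a b S :: real
    assume \<xi>: "smooth_derivs \<xi>" and \<omega>: "smooth_derivs \<omega>" and ab: "0 < a" "a < b" and S: "0 < S"
      and \<xi>0: "\<And>x. x \<le> a \<or> b \<le> x \<Longrightarrow> \<xi> 0 x = 0 \<and> \<xi> 1 x = 0"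
      and \<omega>0: "\<And>t. S \<le> t \<Longrightarrow> \<omega> 0 t = 0 \<and> \<omega> 1 t = 0"
    define M where "M t = integral {a..b} (\<lambda>x. v x t * \<xi> 0 x)" for t
    define P where "P t = integral {a..b} (\<lambda>x. f (v x t) * \<xi> 1 x)" for t
    define \<phi> where "\<phi> x t = \<xi> 0 x * \<omega> 0 t" for x t
    have "test_function \<phi>"
      unfolding \<phi>_def by (rule test_function_product[OF \<xi> \<omega> ab(1)]) (use \<xi>0 \<omega>0 in auto)
    then have weak: "(LINT t:{0<..}|lebesgue. LINT x:{0<..}|lebesgue.
         u x t * deriv (\<lambda>s. \<phi> x s) t + f (u x t) * deriv (\<lambda>y. \<phi> y t) x + \<alpha> t * u x t * \<phi> x t)
      + (LINT x:{0<..}|lebesgue. u0 x * \<phi> x 0) = 0"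
      using u unfolding weak_solution_def by blast
    have d_t: "deriv (\<lambda>s. \<phi> x s) t = \<xi> 0 x * \<omega> 1 t" for x t
      unfolding \<phi>_def using smooth_derivsD[OF \<omega>, of 0 t] by (intro DERIV_imp_deriv DERIV_cmult) simp
    have d_x: "deriv (\<lambda>y. \<phi> y t) x = \<xi> 1 x * \<omega> 0 t" for x t
      unfolding \<phi>_def using smooth_derivsD[OF \<xi>, of 0 x] by (intro DERIV_imp_deriv DERIV_cmult_right) simp
    note \<xi>_cont = smooth_derivs_imp_continuous[OF \<xi>]
    have v0_int: "(\<lambda>x. v x t * \<xi> 0 x) absolutely_integrable_on {a..b}"
      and v1_int: "(\<lambda>x. f (v x t) * \<xi> 1 x) absolutely_integrable_on {a..b}" if t: "0 \<le> t" for t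
    proof -
      have *: "(\<lambda>x. k (v x t) * \<xi> i x) absolutely_integrable_on {a..b}" if k: "continuous_on UNIV k" for k :: "real \<Rightarrow> real" and i
      proof -
        have "(\<lambda>x. \<xi> i x * k (v x t)) absolutely_integrable_on {a..b}"
        proof (rule absolutely_integrable_bounded_measurable_product_real)
          show "\<xi> i \<in> borel_measurable (lebesgue_on {a..b})"
            by (intro continuous_imp_measurable_on_sets_lebesgue \<xi>_cont) auto
          show "bounded (\<xi> i ` {a..b})" by (intro compact_imp_bounded compact_continuous_image \<xi>_cont) auto
          obtain B where B: "\<And>p. \<bar>p\<bar> \<le> C \<Longrightarrow> \<bar>k p\<bar> \<le> B" using comp_bounded[OF k] by blast
          show "(\<lambda>x. k (v x t)) absolutely_integrable_on {a..b}"
            using comp_measurable[OF k t] B u_bd unfolding v_def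
            by (intro measurable_bounded_by_integrable_imp_absolutely_integrable[where g="\<lambda>_. B"])
               (auto intro: measurable_restrict_space1)
        qed simp
        then show ?thesis by (simp add: mult.commute)
      qed
      show "(\<lambda>x. v x t * \<xi> 0 x) absolutely_integrable_on {a..b}" by (rule *[OF continuous_on_id])
      show "(\<lambda>x. f (v x t) * \<xi> 1 x) absolutely_integrable_on {a..b}" by (rule *[OF f])
    qed
    have inner: "(LINT x:{0<..}|lebesgue. u x t * deriv (\<lambda>s. \<phi> x s) t + f (u x t) * deriv (\<lambda>y. \<phi> y t) x + \<alpha> t * u x t * \<phi> x t)
        = \<omega> 1 t * M t + \<omega> 0 t * (P t + \<alpha> t * M t)" if t: "0 < t" for t
    proof -
      obtain N where N: "negligible N" "\<forall>x>0. x \<notin> N \<longrightarrow> \<bar>u x t\<bar> \<le> C" using bd[of t] t by auto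
      have v0: "(\<lambda>x. v x t * \<xi> 0 x) absolutely_integrable_on {a..b}"
        and v1: "(\<lambda>x. f (v x t) * \<xi> 1 x) absolutely_integrable_on {a..b}" using v0_int v1_int t by auto
      have g: "(\<lambda>x. (\<omega> 1 t + \<omega> 0 t * \<alpha> t) * (v x t * \<xi> 0 x) + \<omega> 0 t * (f (v x t) * \<xi> 1 x)) absolutely_integrable_on {a..b}"
        by (intro set_integral_add(1) set_integrable_mult_right impI v0 v1)
      have "(LINT x:{0<..}|lebesgue. u x t * deriv (\<lambda>s. \<phi> x s) t + f (u x t) * deriv (\<lambda>y. \<phi> y t) x + \<alpha> t * u x t * \<phi> x t)
          = integral {a..b} (\<lambda>x. (\<omega> 1 t + \<omega> 0 t * \<alpha> t) * (v x t * \<xi> 0 x) + \<omega> 0 t * (f (v x t) * \<xi> 1 x))"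
      proof (rule set_lebesgue_integral_eq_Icc[OF g N(1)])
        fix x assume x: "x \<in> {0<..}" "x \<notin> N"
        then have "v x t = u x t" using N(2) by (intro v_eq) auto
        then show "u x t * deriv (\<lambda>s. \<phi> x s) t + f (u x t) * deriv (\<lambda>y. \<phi> y t) x + \<alpha> t * u x t * \<phi> x t =
            (if x \<in> {a..b} then (\<omega> 1 t + \<omega> 0 t * \<alpha> t) * (v x t * \<xi> 0 x) + \<omega> 0 t * (f (v x t) * \<xi> 1 x) else 0)"
          using \<xi>0[of x] unfolding d_t d_x unfolding \<phi>_def by (auto simp: algebra_simps)
      qed (use ab in auto)
      also have "\<dots> = (\<omega> 1 t + \<omega> 0 t * \<alpha> t) * M t + \<omega> 0 t * P t"
        using v0 v1 unfolding M_def P_def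
        by (subst Henstock_Kurzweil_Integration.integral_add) (auto simp: absolutely_integrable_on_def intro!: integrable_on_mult_right)
      finally show ?thesis by (simp add: algebra_simps)
    qed
    have Mc: "continuous_on {0..S} M" and Pc: "continuous_on {0..S} P"
      using continuous_on_subset[OF m_cont[OF \<xi>_cont ab], of "{0..S}" 0] continuous_on_subset[OF \<Phi>_cont[OF \<xi>_cont ab], of "{0..S}" 1]
      unfolding m_def[abs_def] \<Phi>_def[abs_def] M_def[abs_def] P_def[abs_def] v_def by auto
    have outer: "(LINT t:{0<..}|lebesgue. LINT x:{0<..}|lebesgue.
         u x t * deriv (\<lambda>s. \<phi> x s) t + f (u x t) * deriv (\<lambda>y. \<phi> y t) x + \<alpha> t * u x t * \<phi> x t)
      = integral {0..S} (\<lambda>t. \<omega> 1 t * M t + \<omega> 0 t * (P t + \<beta> t * M t))"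
    proof (rule set_lebesgue_integral_eq_Icc)
      have c: "continuous_on {0..S} (\<lambda>t. \<omega> 1 t * M t + \<omega> 0 t * P t)" "continuous_on {0..S} (\<lambda>t. \<omega> 0 t * M t)"
        by (intro continuous_intros smooth_derivs_imp_continuous[OF \<omega>] Mc Pc)+
      have "(\<lambda>t. (\<omega> 1 t * M t + \<omega> 0 t * P t) + \<beta> t * (\<omega> 0 t * M t)) absolutely_integrable_on {0..S}"
      proof (rule set_integral_add(1))
        show "(\<lambda>t. \<omega> 1 t * M t + \<omega> 0 t * P t) absolutely_integrable_on {0..S}"
          by (rule absolutely_integrable_continuous_real[OF c(1)])
        show "(\<lambda>t. \<beta> t * (\<omega> 0 t * M t)) absolutely_integrable_on {0..S}"
          using \<beta> by (intro absolutely_integrable_bounded_measurable_product_real absolutely_integrable_continuous_real c(2))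
            (auto simp: bounded_iff intro: measurable_restrict_space1)
      qed
      then show "(\<lambda>t. \<omega> 1 t * M t + \<omega> 0 t * (P t + \<beta> t * M t)) absolutely_integrable_on {0..S}"
        by (simp add: algebra_simps)
      show "negligible (insert 0 N\<alpha>)" using \<alpha>\<beta>(1) by simp
      fix t assume t: "t \<in> {0<..}" "t \<notin> insert 0 N\<alpha>"
      then have "\<alpha> t = \<beta> t" using \<alpha>\<beta>(2) by simp
      then show "(LINT x:{0<..}|lebesgue. u x t * deriv (\<lambda>s. \<phi> x s) t + f (u x t) * deriv (\<lambda>y. \<phi> y t) x + \<alpha> t * u x t * \<phi> x t)
          = (if t \<in> {0..S} then \<omega> 1 t * M t + \<omega> 0 t * (P t + \<beta> t * M t) else 0)"
        using inner[of t] t \<omega>0[of t] by auto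
    qed (use S in auto)
    have initial: "(LINT x:{0<..}|lebesgue. u0 x * \<phi> x 0) = \<omega> 0 0 * integral {a..b} (\<lambda>x. u0 x * \<xi> 0 x)"
    proof -
      have "(\<lambda>x. \<xi> 0 x * u0 x) absolutely_integrable_on {a..b}"
      proof (rule absolutely_integrable_bounded_measurable_product_real)
        show "\<xi> 0 \<in> borel_measurable (lebesgue_on {a..b})"
          by (intro continuous_imp_measurable_on_sets_lebesgue \<xi>_cont) auto
        show "bounded (\<xi> 0 ` {a..b})" by (intro compact_imp_bounded compact_continuous_image \<xi>_cont) auto
        show "u0 absolutely_integrable_on {a..b}" by (rule set_integrable_subset[OF u0]) (use ab in auto)
      qed simp
      then have g: "(\<lambda>x. \<omega> 0 0 * (u0 x * \<xi> 0 x)) absolutely_integrable_on {a..b}"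
        by (intro set_integrable_mult_right) (simp add: mult.commute)
      have "(LINT x:{0<..}|lebesgue. u0 x * \<phi> x 0) = integral {a..b} (\<lambda>x. \<omega> 0 0 * (u0 x * \<xi> 0 x))"
        by (rule set_lebesgue_integral_eq_Icc[OF g negligible_empty]) (use ab \<xi>0 in \<open>auto simp: \<phi>_def\<close>)
      then show ?thesis by simp
    qed
    show "integral {0..S} (\<lambda>t. \<omega> 1 t * integral {a..b} (\<lambda>x. clamp_to C u x t * \<xi> 0 x) + \<omega> 0 t *
        (integral {a..b} (\<lambda>x. f (clamp_to C u x t) * \<xi> 1 x) + \<beta> t * integral {a..b} (\<lambda>x. clamp_to C u x t * \<xi> 0 x)))
      + \<omega> 0 0 * integral {a..b} (\<lambda>x. u0 x * \<xi> 0 x) = 0"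
      using weak unfolding outer initial M_def P_def v_def .
  qed (rule H; assumption)+
qed

section \<open>Uniqueness\<close>

lemma C1_differentiable_deriv:
  fixes f :: "real \<Rightarrow> real"
  assumes "f C1_differentiable_on UNIV"
  shows "(f has_real_derivative deriv f x) (at x)" "continuous_on UNIV (deriv f)"
proof -
  obtain D where D: "\<And>x. (f has_vector_derivative D x) (at x)" "continuous_on UNIV D"
    using assms unfolding C1_differentiable_on_def by auto
  then have "(f has_real_derivative D x) (at x)" for x by (simp add: has_real_derivative_iff_has_vector_derivative)
  then show "(f has_real_derivative deriv f x) (at x)" "continuous_on UNIV (deriv f)"
    using D(2) DERIV_imp_deriv[of f] by (metis, metis ext)
qed

lemma strictly_convex_imp_convex_on:
  assumes "strictly_convex f" shows "convex_on UNIV f"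
proof (rule convex_onI)
  fix t x y :: real assume t: "0 < t" "t < 1"
  show "f ((1 - t) *\<^sub>R x + t *\<^sub>R y) \<le> (1 - t) * f x + t * f y"
  proof (cases "x = y")
    case True
    then show ?thesis by (simp add: algebra_simps)
  next
    case False
    then show ?thesis using assms t unfolding strictly_convex_def by (simp add: less_imp_le)
  qed
qed simp

text \<open>Strict convexity at the midpoint sharpens the tangent inequality at x, so the slope of
  the chord strictly exceeds the derivative at x; the tangent at y bounds the same slope from
  above.\<close>

lemma strictly_convex_deriv_strict_mono:
  assumes f: "strictly_convex f" and der: "\<And>x. (f has_real_derivative deriv f x) (at x)" and xy: "x < y"
  shows "deriv f x < deriv f y"
proof -
  have tangent: "deriv f a * (b - a) \<le> f b - f a" for a b
    using convex_on_imp_above_tangent[OF strictly_convex_imp_convex_on[OF f], of a b] der[of a] by simp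
  define z where "z = (1 - 1/2) * x + 1/2 * y"
  have "f z < (1 - 1/2) * f x + 1/2 * f y"
    using f xy unfolding strictly_convex_def z_def by (metis half_gt_zero_iff less_irrefl one_less_numeral_iff semiring_norm(76) zero_less_one field_sum_of_halves less_add_same_cancel1 half_gt_zero)
  moreover have "deriv f x * (z - x) \<le> f z - f x" by (rule tangent)
  moreover have "z - x = (y - x) / 2" by (simp add: z_def field_simps)
  ultimately have "deriv f x * ((y - x) / 2) < (f y - f x) / 2" by simp
  then have "deriv f x * (y - x) < f y - f x" by simp
  also have "f y - f x \<le> deriv f y * (y - x)" using tangent[of y x] by (simp add: algebra_simps)
  finally show ?thesis using xy by simp
qed

lemma superlinear_deriv_zero:
  assumes der: "\<And>x. (f has_real_derivative deriv f x) (at x)" "continuous_on UNIV (deriv f)"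
    and lim: "filterlim (\<lambda>w. f w / \<bar>w\<bar>) at_top at_infinity"
  obtains l where "deriv f l = 0"
proof -
  have "\<forall>\<^sub>F w in at_infinity. 1 \<le> f w / \<bar>w\<bar>" using lim by (simp add: filterlim_at_top)
  then obtain b where b: "\<And>w. b \<le> \<bar>w\<bar> \<Longrightarrow> 1 \<le> f w / \<bar>w\<bar>" unfolding eventually_at_infinity by auto
  \<comment> \<open>With this R, the values of f at R and at -R are at least R, which exceeds f 0;
    the mean values of the derivative on the two sides of 0 therefore have opposite signs.\<close>
  define R where "R = max b (\<bar>f 0\<bar> + 1)"
  have R: "0 < R" by (auto simp: R_def)
  have "1 \<le> f R / \<bar>R\<bar>" "1 \<le> f (- R) / \<bar>- R\<bar>" by (rule b, simp add: R_def)+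
  then have "R \<le> f R" "R \<le> f (- R)" using R by (simp_all add: le_divide_eq)
  moreover have "f 0 < R" by (simp add: R_def)
  ultimately have big: "f 0 < f R" "f 0 < f (- R)" by linarith+
  obtain p where p: "0 < p" "p < R" "f R - f 0 = (R - 0) * deriv f p"
    using MVT2[OF R, of f "deriv f"] der(1) by auto
  obtain q where q: "- R < q" "q < 0" "f 0 - f (- R) = (0 - - R) * deriv f q"
    using MVT2[of "- R" 0 f "deriv f"] der(1) R by auto
  have "0 < R * deriv f p" using big(1) p(3) by simp
  then have "0 \<le> deriv f p" using R by (simp add: zero_less_mult_iff)
  moreover have "R * deriv f q < 0" using big(2) q(3) by simp
  then have "deriv f q \<le> 0" using R by (simp add: mult_less_0_iff)
  moreover have "q \<le> p" using p q by simp
  moreover have "continuous_on {q..p} (deriv f)" using der(2) continuous_on_subset by blast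
  ultimately obtain l where "deriv f l = 0" using IVT'[of "deriv f" q 0 p] by auto
  then show ?thesis by (rule that)
qed

lemma sign_change_point_eq:
  assumes mono: "\<And>x y. x < y \<Longrightarrow> deriv f x < deriv f y" and l: "deriv f l = 0"
  shows "sign_change_point f = l"
  unfolding sign_change_point_def
proof (rule the_equality)
  show "(\<forall>w<l. deriv f w < 0) \<and> (\<forall>w>l. 0 < deriv f w)" using mono l by metis
  fix k assume k: "(\<forall>w<k. deriv f w < 0) \<and> (\<forall>w>k. 0 < deriv f w)"
  show "k = l"
  proof (rule ccontr)
    assume "k \<noteq> l"
    then have "deriv f l < 0 \<or> 0 < deriv f l" using k by (meson linorder_neqE_linordered_idom)
    then show False using l by simp
  qed
qed

text \<open>Both solutions refer to the same boundary value b. If v attains b, the boundary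
  condition for u gives a flux of at least f b. Otherwise the trace of v lies where f is
  nonincreasing, and the trace of u lies to its left.\<close>

lemma boundary_flux_comparison:
  assumes der: "\<And>x. (f has_real_derivative deriv f x) (at x)" and mono: "\<And>x y. x < y \<Longrightarrow> deriv f x < deriv f y"
    and l: "deriv f l = 0" and bc: "boundary_condition f ub u t" "boundary_condition f ub v t"
    and le: "trace_right u 0 t \<le> trace_right v 0 t"
  shows "f (trace_right v 0 t) \<le> f (trace_right u 0 t)"
proof -
  define p where "p = trace_right u 0 t"
  define q where "q = trace_right v 0 t"
  define b where "b = max (ub t) l"
  have pq: "p = b \<or> deriv f p \<le> 0 \<and> f b \<le> f p" "q = b \<or> deriv f q \<le> 0 \<and> f b \<le> f q"
    using bc sign_change_point_eq[OF mono l] by (simp_all add: boundary_condition_def Let_def p_def q_def b_def)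
  have below: "w \<le> l" if "deriv f w \<le> 0" for w
    using mono[of l w] l that by (cases "w \<le> l") auto
  have dec: "f y \<le> f x" if "x \<le> y" "y \<le> l" for x y
  proof (rule DERIV_nonpos_imp_nonincreasing[OF that(1)])
    fix z assume "x \<le> z" "z \<le> y"
    then have "deriv f z \<le> 0" using mono[of z l] l that by (cases "z = l") auto
    then show "\<exists>y. DERIV f z :> y \<and> y \<le> 0" using der by blast
  qed
  have "f q \<le> f p"
  proof (cases "q = b")
    case True
    then show ?thesis using pq(1) by auto
  next
    case False
    then have q: "q \<le> l" using pq(2) below by auto
    then show ?thesis using dec[of p q] le by (simp add: p_def q_def)
  qed
  then show ?thesis by (simp add: p_def q_def)
qed

section \<open>Traces at continuity points and the Lax condition\<close>

lemma trace_eq_at_continuity: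
  assumes S: "open S" "continuous_on S (\<lambda>(x, t). u x t)" and xt: "(x, t) \<in> S"
  shows "trace_right u x t = u x t" "trace_left u x t = u x t"
proof -
  have "isCont (\<lambda>(x, t). u x t) (x, t)" using S xt by (simp add: continuous_on_eq_continuous_at)
  moreover have "isCont (\<lambda>y. (y, t)) x" by (intro continuous_intros)
  ultimately have "isCont (\<lambda>y. (\<lambda>(x, t). u x t) (y, t)) x" by (rule isCont_o2[rotated])
  then have "((\<lambda>y. u y t) \<longlongrightarrow> u x t) (at x)" by (simp add: isCont_def)
  then show "trace_right u x t = u x t" "trace_left u x t = u x t"
    unfolding trace_right_def trace_left_def by (auto intro!: tendsto_Lim simp: filterlim_at_split)
qed

lemma isCont_trace_at_continuity:
  assumes S: "open S" "continuous_on S (\<lambda>(x, t). u x t)" and xt: "(x, t) \<in> S"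
  shows "isCont (trace_right u x) t"
proof -
  have "isCont (\<lambda>(x, t). u x t) (x, t)" using S xt by (simp add: continuous_on_eq_continuous_at)
  moreover have "isCont (\<lambda>s. (x, s)) t" by (intro continuous_intros)
  ultimately have "isCont (\<lambda>s. (\<lambda>(x, t). u x t) (x, s)) t" by (rule isCont_o2[rotated])
  then have lim: "((\<lambda>s. u x s) \<longlongrightarrow> u x t) (at t)" by (simp add: isCont_def)
  have "open ((\<lambda>s. (x, s)) -` S)" using S(1) by (intro continuous_open_vimage continuous_intros) auto
  then have "\<forall>\<^sub>F s in at t. s \<in> (\<lambda>s. (x, s)) -` S" using xt by (intro eventually_at_in_open') auto
  then have "\<forall>\<^sub>F s in at t. u x s = trace_right u x s"
    by eventually_elim (use trace_eq_at_continuity(1)[OF S] in auto)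
  then show ?thesis
    unfolding isCont_def trace_eq_at_continuity(1)[OF S xt] by (rule Lim_transform_eventually[OF lim])
qed

text \<open>At a jump on a graph X the Lax condition gives f'(u-) > X' > f'(u+), and since f'
  increases the jump is downwards. Off the graphs, at times outside the null set, u is continuous.
  Countability of the graphs yields one null set of times that is valid for all x.\<close>

lemma Lax_regularity:
  assumes mono: "\<And>x y. x < y \<Longrightarrow> deriv f x < deriv f y"
    and Lax: "Lax_entropy f u" and C1: "C1_off_Lipschitz_curves u" and T: "0 < T"
  obtains \<X> N where "countable \<X>" "negligible N"
    "\<And>X. X \<in> \<X> \<Longrightarrow> \<exists>L. L-lipschitz_on UNIV X" "\<And>X. X \<in> \<X> \<Longrightarrow> \<exists>c>0. \<forall>t. c \<le> X t"
    "\<And>x t. 0 < x \<Longrightarrow> 0 < t \<Longrightarrow> t < T \<Longrightarrow> t \<notin> N \<Longrightarrow> trace_right u x t \<le> trace_left u x t"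
    "\<And>x t. 0 < x \<Longrightarrow> 0 < t \<Longrightarrow> t < T \<Longrightarrow> t \<notin> N \<Longrightarrow> (\<forall>X\<in>\<X>. X t \<noteq> x) \<Longrightarrow>
      trace_left u x t = trace_right u x t \<and> isCont (trace_right u x) t"
proof -
  obtain \<Gamma> \<X> N0 where \<Gamma>: "open (quadrant - \<Gamma>)" "continuous_on (quadrant - \<Gamma>) (\<lambda>(x, t). u x t)"
    and \<X>1: "countable \<X>" and N0: "negligible N0"
    and \<X>: "\<And>X. X \<in> \<X> \<Longrightarrow> \<exists>L. L-lipschitz_on UNIV X" "\<And>X. X \<in> \<X> \<Longrightarrow> \<exists>c>0. \<forall>t. c \<le> X t"
    and cover: "\<And>x t. (x, t) \<in> \<Gamma> \<Longrightarrow> (x, t) \<in> quadrant \<Longrightarrow> t \<notin> N0 \<Longrightarrow> \<exists>X\<in>\<X>. X t = x"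
    by (rule C1_off_Lipschitz_curves_graphs[OF C1], rule that; simp)
  have "\<exists>M. negligible M \<and> (\<forall>t. 0 < t \<longrightarrow> t < T \<longrightarrow> t \<notin> M \<longrightarrow> trace_right u (X t) t \<le> trace_left u (X t) t)"
    if X_in: "X \<in> \<X>" for X
  proof -
    obtain L where L: "L-lipschitz_on UNIV X" using \<X>(1)[OF X_in] by blast
    obtain c where c: "0 < c" "\<And>t. c \<le> X t" using \<X>(2)[OF X_in] by blast
    have pos: "\<forall>t\<in>{0<..<T}. 0 < X t" using c by (meson less_le_trans)
    have ae: "AE t in lebesgue_on {0<..<T}. trace_left u (X t) t \<noteq> trace_right u (X t) t \<longrightarrow>
        X differentiable (at t) \<and> deriv f (trace_left u (X t) t) > deriv X t \<and> deriv X t > deriv f (trace_right u (X t) t)"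
      using Lax[unfolded Lax_entropy_def, rule_format, OF order_refl T lipschitz_on_subset[OF L subset_UNIV]] pos by blast
    obtain M where M: "negligible M" "\<And>t. t \<in> {0<..<T} \<Longrightarrow> t \<notin> M \<Longrightarrow> trace_left u (X t) t \<noteq> trace_right u (X t) t \<longrightarrow>
        X differentiable (at t) \<and> deriv f (trace_left u (X t) t) > deriv X t \<and> deriv X t > deriv f (trace_right u (X t) t)"
      using AE_lebesgue_on_negligible[OF ae] by auto
    have "trace_right u (X t) t \<le> trace_left u (X t) t" if t: "0 < t" "t < T" "t \<notin> M" for t
    proof (rule ccontr)
      assume *: "\<not> ?thesis"
      then have "deriv f (trace_left u (X t) t) > deriv f (trace_right u (X t) t)"
        using M(2)[of t] t by auto
      moreover have "deriv f (trace_left u (X t) t) < deriv f (trace_right u (X t) t)"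
        using * by (intro mono) simp
      ultimately show False by simp
    qed
    then show ?thesis using M(1) by blast
  qed
  then have "\<forall>X\<in>\<X>. \<exists>M. negligible M \<and> (\<forall>t. 0 < t \<longrightarrow> t < T \<longrightarrow> t \<notin> M \<longrightarrow> trace_right u (X t) t \<le> trace_left u (X t) t)" by blast
  from bchoice[OF this] obtain M where M: "\<forall>X\<in>\<X>. negligible (M X) \<and>
      (\<forall>t. 0 < t \<longrightarrow> t < T \<longrightarrow> t \<notin> M X \<longrightarrow> trace_right u (X t) t \<le> trace_left u (X t) t)" ..
  define N where "N = N0 \<union> \<Union>(M ` \<X>)"
  have neg: "negligible N"
    unfolding N_def using N0 \<X>1 M by (intro negligible_Un negligible_countable_Union) auto
  have reg: "trace_left u x t = trace_right u x t \<and> isCont (trace_right u x) t"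
    if "0 < x" "0 < t" "t \<notin> N" "\<forall>X\<in>\<X>. X t \<noteq> x" for x t
  proof -
    have "(x, t) \<in> quadrant" using that by (simp add: quadrant_def)
    moreover have "(x, t) \<notin> \<Gamma>" using cover[of x t] that calculation by (auto simp: N_def)
    ultimately have "(x, t) \<in> quadrant - \<Gamma>" by simp
    then show ?thesis
      using trace_eq_at_continuity[OF \<Gamma>] isCont_trace_at_continuity[OF \<Gamma>] by auto
  qed
  have ent: "trace_right u x t \<le> trace_left u x t" if "0 < x" "0 < t" "t < T" "t \<notin> N" for x t
  proof (cases "\<exists>X\<in>\<X>. X t = x")
    case True
    then obtain X where X: "X \<in> \<X>" "X t = x" by blast
    have "t \<notin> M X" using X(1) that(4) by (auto simp: N_def)
    then have "trace_right u (X t) t \<le> trace_left u (X t) t" using bspec[OF M X(1)] that by simp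
    then show ?thesis by (simp add: X(2))
  next
    case False
    then show ?thesis using reg[of x t] that by auto
  qed
  show ?thesis
    by (rule that[OF \<X>1 neg \<X>]) (use ent reg in auto)
qed

text \<open>Truncation at the essential bound, after extension by zero to negative times, gives a
  coefficient that is measurable and bounded on the whole line, as the integrating factor
  requires.\<close>

lemma Linfty_on_bounded_version:
  assumes "Linfty_on {0..} \<alpha>"
  obtains \<beta> K N :: "_" where "\<beta> \<in> borel_measurable lebesgue" "\<And>t::real. \<bar>\<beta> t\<bar> \<le> K" "negligible N"
    "\<And>t. 0 \<le> t \<Longrightarrow> t \<notin> N \<Longrightarrow> \<alpha> t = \<beta> t"
proof -
  obtain K where \<alpha>: "\<alpha> \<in> borel_measurable (lebesgue_on {0..})" "AE t in lebesgue_on {0..}. \<bar>\<alpha> t\<bar> \<le> K"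
    using assms unfolding Linfty_on_def by blast
  obtain N where N: "negligible N" "\<And>t. t \<in> {0..} \<Longrightarrow> t \<notin> N \<Longrightarrow> \<bar>\<alpha> t\<bar> \<le> K"
    using AE_lebesgue_on_negligible[OF \<alpha>(2)] by auto
  define a where "a t = (if t \<in> {0..} then \<alpha> t else 0)" for t
  have a: "a \<in> borel_measurable lebesgue"
    unfolding a_def using \<alpha>(1) by (intro borel_measurable_if_I) auto
  define \<beta> where "\<beta> t = max (- \<bar>K\<bar>) (min \<bar>K\<bar> (a t))" for t
  show ?thesis
  proof (rule that[of \<beta> "\<bar>K\<bar>" N])
    show "\<beta> \<in> borel_measurable lebesgue" unfolding \<beta>_def using a by measurable
    show "\<bar>\<beta> t\<bar> \<le> \<bar>K\<bar>" for t by (auto simp: \<beta>_def)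
    show "\<alpha> t = \<beta> t" if "0 \<le> t" "t \<notin> N" for t
      using N(2)[of t] that by (auto simp: \<beta>_def a_def abs_le_iff)
  qed (rule N)
qed

lemma C1_lipschitz_on_Icc:
  fixes f :: "real \<Rightarrow> real"
  assumes der: "\<And>x. (f has_real_derivative deriv f x) (at x)" "continuous_on UNIV (deriv f)"
  obtains \<kappa> where "0 \<le> \<kappa>" "\<And>p q. \<bar>p\<bar> \<le> C \<Longrightarrow> \<bar>q\<bar> \<le> C \<Longrightarrow> \<bar>f p - f q\<bar> \<le> \<kappa> * \<bar>p - q\<bar>"
proof -
  have "bounded (deriv f ` {-C..C})"
    by (rule compact_imp_bounded[OF compact_continuous_image[OF continuous_on_subset[OF der(2) subset_UNIV] compact_Icc]])
  then obtain k where k: "\<forall>y\<in>deriv f ` {-C..C}. norm y \<le> k" unfolding bounded_iff by blast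
  have "\<bar>f p - f q\<bar> \<le> \<bar>k\<bar> * \<bar>p - q\<bar>" if "\<bar>p\<bar> \<le> C" "\<bar>q\<bar> \<le> C" for p q
  proof -
    have "norm (f p - f q) \<le> \<bar>k\<bar> * norm (p - q)"
    proof (rule field_differentiable_bound[of "{-C..C}"])
      show "(f has_field_derivative deriv f z) (at z within {-C..C})" for z
        using der(1) has_field_derivative_at_within by blast
      show "norm (deriv f z) \<le> \<bar>k\<bar>" if "z \<in> {-C..C}" for z using bspec[OF k imageI[OF that]] by simp
    qed (use that in \<open>auto simp: abs_le_iff\<close>)
    then show ?thesis by simp
  qed
  then show ?thesis by (intro that[of "\<bar>k\<bar>"]) auto
qed

context balance_law
begin

lemma trace_clamp_to:
  assumes u: "\<And>t. 0 < t \<Longrightarrow> BV_on {0<..} (\<lambda>x. v x t)" and eq: "u = clamp_to C v"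
    and bd: "\<And>t. 0 \<le> t \<Longrightarrow> \<exists>N. negligible N \<and> (\<forall>x>0. x \<notin> N \<longrightarrow> \<bar>v x t\<bar> \<le> C)" and t: "0 < t"
  shows "0 \<le> x \<Longrightarrow> ur x t = trace_right v x t" "0 < x \<Longrightarrow> ul x t = trace_left v x t"
proof -
  obtain N where N: "negligible N" "\<forall>x>0. x \<notin> N \<longrightarrow> \<bar>v x t\<bar> \<le> C" using bd[of t] t by auto
  show "ur x t = trace_right v x t" if x: "0 \<le> x"
  proof -
    obtain l where l: "((\<lambda>y. v y t) \<longlongrightarrow> l) (at_right x)" using BV_on_one_sided_limits(1)[OF u[OF t] x] by blast
    have "((\<lambda>y. clamp_to C v y t) \<longlongrightarrow> l) (at_right x)" by (rule tendsto_clamp_to[where u=v and t=t, OF l N]) (use x in auto)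
    then show ?thesis unfolding ur_def trace_right_def unfolding eq using l by (simp add: tendsto_Lim)
  qed
  show "ul x t = trace_left v x t" if x: "0 < x"
  proof -
    obtain l where l: "((\<lambda>y. v y t) \<longlongrightarrow> l) (at_left x)" using BV_on_one_sided_limits(2)[OF u[OF t] x] by blast
    have "((\<lambda>y. clamp_to C v y t) \<longlongrightarrow> l) (at_left x)" by (rule tendsto_clamp_to[where u=v and t=t, OF l N]) (use x in auto)
    then show ?thesis unfolding ul_def trace_left_def unfolding eq using l by (simp add: tendsto_Lim)
  qed
qed

end

text \<open>All data are symmetric in u and v, so exchanging the two solutions supplies the reverse
  inequality.\<close>

lemma solution_potential_le:
  assumes der: "\<And>x. (f has_real_derivative deriv f x) (at x)" and mono: "\<And>x y. x < y \<Longrightarrow> deriv f x < deriv f y"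
    and l: "deriv f l = 0" and f_convex: "convex_on UNIV f"
    and BU: "balance_law f \<beta> (clamp_to C u) C K \<kappa> u0 H" and BV: "balance_law f \<beta> (clamp_to C v) C K \<kappa> u0 H"
    and u: "weak_solution f \<alpha> u0 ub u" and v: "weak_solution f \<alpha> u0 ub v"
    and bd_u: "\<And>t. 0 \<le> t \<Longrightarrow> \<exists>N. negligible N \<and> (\<forall>x>0. x \<notin> N \<longrightarrow> \<bar>u x t\<bar> \<le> C)"
    and bd_v: "\<And>t. 0 \<le> t \<Longrightarrow> \<exists>N. negligible N \<and> (\<forall>x>0. x \<notin> N \<longrightarrow> \<bar>v x t\<bar> \<le> C)"
    and Lax: "Lax_entropy f u" "Lax_entropy f v"
    and C1: "C1_off_Lipschitz_curves u" "C1_off_Lipschitz_curves v"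
    and xt: "0 \<le> x" "0 \<le> t"
  shows "balance_law.U f \<beta> (clamp_to C u) x t \<le> balance_law.U f \<beta> (clamp_to C v) x t"
proof -
  interpret U: balance_law f \<beta> "clamp_to C u" C K \<kappa> u0 H by (rule BU)
  interpret V: balance_law f \<beta> "clamp_to C v" C K \<kappa> u0 H by (rule BV)
  \<comment> \<open>The comparison asks for a final time strictly after t.\<close>
  define T where "T = t + 1"
  have T: "0 < T" "t < T" using xt by (auto simp: T_def)
  obtain F where F: "\<And>p. \<bar>p\<bar> \<le> C \<Longrightarrow> \<bar>f p\<bar> \<le> F" using U.comp_bounded[OF U.f_cont] by blast
  have BVu: "\<And>t. 0 < t \<Longrightarrow> BV_on {0<..} (\<lambda>x. u x t)" and BVv: "\<And>t. 0 < t \<Longrightarrow> BV_on {0<..} (\<lambda>x. v x t)"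
    using u v by (simp_all add: weak_solution_def)
  note tr_u = U.trace_clamp_to[OF BVu refl bd_u] and tr_v = V.trace_clamp_to[OF BVv refl bd_v]
  obtain \<X>u Nu where \<X>u1: "countable \<X>u" and Nu: "negligible Nu"
    and \<X>u: "\<And>X. X \<in> \<X>u \<Longrightarrow> \<exists>L. L-lipschitz_on UNIV X" "\<And>X. X \<in> \<X>u \<Longrightarrow> \<exists>c>0. \<forall>t. c \<le> X t"
    and ent_u: "\<And>x t. 0 < x \<Longrightarrow> 0 < t \<Longrightarrow> t < T \<Longrightarrow> t \<notin> Nu \<Longrightarrow> trace_right u x t \<le> trace_left u x t"
    and reg_u: "\<And>x t. 0 < x \<Longrightarrow> 0 < t \<Longrightarrow> t < T \<Longrightarrow> t \<notin> Nu \<Longrightarrow> (\<forall>X\<in>\<X>u. X t \<noteq> x) \<Longrightarrow>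
      trace_left u x t = trace_right u x t \<and> isCont (trace_right u x) t"
    by (rule Lax_regularity[OF mono Lax(1) C1(1) T(1)], assumption, rule that; simp)
  obtain \<X>v Nv where \<X>v1: "countable \<X>v" and Nv: "negligible Nv"
    and \<X>v: "\<And>X. X \<in> \<X>v \<Longrightarrow> \<exists>L. L-lipschitz_on UNIV X" "\<And>X. X \<in> \<X>v \<Longrightarrow> \<exists>c>0. \<forall>t. c \<le> X t"
    and ent_v: "\<And>x t. 0 < x \<Longrightarrow> 0 < t \<Longrightarrow> t < T \<Longrightarrow> t \<notin> Nv \<Longrightarrow> trace_right v x t \<le> trace_left v x t"
    and reg_v: "\<And>x t. 0 < x \<Longrightarrow> 0 < t \<Longrightarrow> t < T \<Longrightarrow> t \<notin> Nv \<Longrightarrow> (\<forall>X\<in>\<X>v. X t \<noteq> x) \<Longrightarrow>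
      trace_left v x t = trace_right v x t \<and> isCont (trace_right v x) t"
    by (rule Lax_regularity[OF mono Lax(2) C1(2) T(1)], assumption, rule that; simp)
  have ae: "AE t in lebesgue_on {0<..}. boundary_condition f ub u t" "AE t in lebesgue_on {0<..}. boundary_condition f ub v t"
    using u v by (simp_all add: weak_solution_def)
  obtain Mu where Mu: "negligible Mu" "\<And>t. t \<in> {0<..} \<Longrightarrow> t \<notin> Mu \<Longrightarrow> boundary_condition f ub u t"
    using AE_lebesgue_on_negligible[OF ae(1)] by auto
  obtain Mv where Mv: "negligible Mv" "\<And>t. t \<in> {0<..} \<Longrightarrow> t \<notin> Mv \<Longrightarrow> boundary_condition f ub v t"
    using AE_lebesgue_on_negligible[OF ae(2)] by auto
  have isCont_eq: "isCont a t" if "0 < t" "isCont b t" "\<And>s. 0 < s \<Longrightarrow> a s = b s" for a b :: "real \<Rightarrow> real" and t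
  proof -
    have "\<forall>\<^sub>F s in at t. s \<in> {0<..}" using that(1) by (intro eventually_at_in_open') auto
    then have "\<forall>\<^sub>F s in at t. b s = a s" by eventually_elim (simp add: that(3))
    then show ?thesis using that by (auto simp: isCont_def intro: Lim_transform_eventually)
  qed
  show ?thesis
  proof (rule potential_comparison[OF U.potential_U[OF T(1) F] V.potential_U[OF T(1) F], where N="Nu \<union> Nv \<union> Mu \<union> Mv" and \<X>="\<X>u \<union> \<X>v"])
    show "U.U x 0 = V.U x 0" if "0 \<le> x" for x using that by (simp add: U.U_eq V.U_eq)
    show "convex_on UNIV f" by (rule f_convex)
    show "\<bar>f a - f b\<bar> \<le> \<kappa> * \<bar>a - b\<bar>" if "\<bar>a\<bar> \<le> C" "\<bar>b\<bar> \<le> C" for a b using that by (rule U.f_lip)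
    show "0 \<le> \<kappa>" by (rule U.\<kappa>)
    show "\<bar>U.ul x t\<bar> \<le> C" "\<bar>V.ul x t\<bar> \<le> C" if "0 < x" "0 < t" for x t using that by (rule U.ul_bd, rule V.ul_bd)
    show "negligible (Nu \<union> Nv \<union> Mu \<union> Mv)" using Nu Nv Mu Mv by simp
    show "f (V.ur 0 t) \<le> f (U.ur 0 t)" if t: "0 < t" "t < T" "t \<notin> Nu \<union> Nv \<union> Mu \<union> Mv" and le: "U.ur 0 t \<le> V.ur 0 t" for t
      using boundary_flux_comparison[OF der mono l, of ub u t v] Mu(2)[of t] Mv(2)[of t] t le tr_u(1)[of t 0] tr_v(1)[of t 0] by simp
    show "countable (\<X>u \<union> \<X>v)" using \<X>u1 \<X>v1 by simp
    show "\<exists>L. L-lipschitz_on UNIV X" if "X \<in> \<X>u \<union> \<X>v" for X using that \<X>u(1) \<X>v(1) by blast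
    show "\<exists>c>0. \<forall>t. c \<le> X t" if "X \<in> \<X>u \<union> \<X>v" for X using that \<X>u(2) \<X>v(2) by blast
    show "V.ur x t \<le> V.ul x t" if "0 < x" "0 < t" "t < T" "t \<notin> Nu \<union> Nv \<union> Mu \<union> Mv" for x t
      using ent_v[of x t] tr_v[of t x] that by simp
    show "U.ul x t = U.ur x t \<and> isCont (U.ur x) t \<and> isCont (V.ur x) t"
      if "0 < x" "0 < t" "t < T" "t \<notin> Nu \<union> Nv \<union> Mu \<union> Mv" "\<forall>X\<in>\<X>u \<union> \<X>v. X t \<noteq> x" for x t
    proof -
      have ru: "trace_left u x t = trace_right u x t" "isCont (trace_right u x) t" using reg_u[of x t] that by auto
      have rv: "isCont (trace_right v x) t" using reg_v[of x t] that by auto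
      have "isCont (U.ur x) t" by (rule isCont_eq[OF that(2) ru(2)]) (use tr_u(1) that(1) in auto)
      moreover have "isCont (V.ur x) t" by (rule isCont_eq[OF that(2) rv]) (use tr_v(1) that(1) in auto)
      ultimately show ?thesis using ru(1) tr_u[of t x] that by simp
    qed
  qed (use xt T in auto)
qed

theorem theorem1p3:
  fixes f \<alpha> u\<^sub>0 u\<^sub>b :: "real \<Rightarrow> real" and u v :: "real \<Rightarrow> real \<Rightarrow> real"
  assumes f_C2: "f C1_differentiable_on UNIV" "deriv f C1_differentiable_on UNIV"
    and f_convex: "strictly_convex f"
    and f_superlinear: "filterlim (\<lambda>w. f w / \<bar>w\<bar>) at_top at_infinity"
    and alpha: "Linfty_on {0..} \<alpha>"
    and u0: "set_integrable lebesgue {0..} u\<^sub>0" "Linfty_on {0..} u\<^sub>0"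
    and ub: "BV_on {0..} u\<^sub>b"
    and u_space: "Linfty_on quadrant (\<lambda>(x, t). u x t)" "BV_loc u"
    and v_space: "Linfty_on quadrant (\<lambda>(x, t). v x t)" "BV_loc v"
    and u_weak: "weak_solution f \<alpha> u\<^sub>0 u\<^sub>b u"
    and v_weak: "weak_solution f \<alpha> u\<^sub>0 u\<^sub>b v"
    and u_Lax: "Lax_entropy f u"
    and v_Lax: "Lax_entropy f v"
    and u_C1: "C1_off_Lipschitz_curves u"
    and v_C1: "C1_off_Lipschitz_curves v"
  shows "\<forall>t\<ge>0. AE x in lebesgue_on {0<..}. u x t = v x t"
proof (intro allI impI)
  fix t :: real assume t: "0 \<le> t"
  note der = C1_differentiable_deriv[OF f_C2(1)]
  note mono = strictly_convex_deriv_strict_mono[OF f_convex der(1)]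
  obtain l where l: "deriv f l = 0" by (rule superlinear_deriv_zero[OF der f_superlinear])
  have f_cont: "continuous_on UNIV f" using der(1) by (meson DERIV_isCont continuous_at_imp_continuous_on)
  note convex = strictly_convex_imp_convex_on[OF f_convex]
  have L1: "continuous_into_L1loc u" "continuous_into_L1loc v" using u_weak v_weak by (simp_all add: weak_solution_def)
  obtain Cu where Cu: "0 \<le> Cu" "\<And>t. 0 \<le> t \<Longrightarrow> \<exists>N. negligible N \<and> (\<forall>x>0. x \<notin> N \<longrightarrow> \<bar>u x t\<bar> \<le> Cu)"
    using bounded_slices[OF u_space(1) L1(1)] by metis
  obtain Cv where Cv: "0 \<le> Cv" "\<And>t. 0 \<le> t \<Longrightarrow> \<exists>N. negligible N \<and> (\<forall>x>0. x \<notin> N \<longrightarrow> \<bar>v x t\<bar> \<le> Cv)"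
    using bounded_slices[OF v_space(1) L1(2)] by metis
  define C where "C = max Cu Cv"
  have C: "0 \<le> C" using Cu(1) by (simp add: C_def)
  have bd_u: "\<exists>N. negligible N \<and> (\<forall>x>0. x \<notin> N \<longrightarrow> \<bar>u x t\<bar> \<le> C)" if "0 \<le> t" for t
    using Cu(2)[OF that] unfolding C_def by (meson max.coboundedI1)
  have bd_v: "\<exists>N. negligible N \<and> (\<forall>x>0. x \<notin> N \<longrightarrow> \<bar>v x t\<bar> \<le> C)" if "0 \<le> t" for t
    using Cv(2)[OF that] unfolding C_def by (meson max.coboundedI2)
  obtain \<kappa> where \<kappa>: "0 \<le> \<kappa>" "\<And>p q. \<bar>p\<bar> \<le> C \<Longrightarrow> \<bar>q\<bar> \<le> C \<Longrightarrow> \<bar>f p - f q\<bar> \<le> \<kappa> * \<bar>p - q\<bar>"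
    by (rule C1_lipschitz_on_Icc[where C=C, OF der], rule that; blast)
  obtain \<beta> K N\<alpha> where \<beta>: "\<beta> \<in> borel_measurable lebesgue" "\<And>t. \<bar>\<beta> t\<bar> \<le> K"
    and N\<alpha>: "negligible N\<alpha>" "\<And>t. 0 \<le> t \<Longrightarrow> t \<notin> N\<alpha> \<Longrightarrow> \<alpha> t = \<beta> t"
    using Linfty_on_bounded_version[OF alpha] by metis
  obtain H where H: "smooth_derivs H" "\<And>x. x \<le> 0 \<Longrightarrow> H 0 x = 0" "\<And>x. 1 \<le> x \<Longrightarrow> H 0 x = 1"
      "\<And>x. 0 \<le> H 1 x" "\<And>x. x \<le> 0 \<or> 1 \<le> x \<Longrightarrow> H 1 x = 0" "\<And>x. 0 \<le> H 0 x \<and> H 0 x \<le> 1"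
    using smooth_step by metis
  have BU: "balance_law f \<beta> (clamp_to C u) C K \<kappa> u\<^sub>0 H"
    by (rule weak_solution_balance_law[OF f_cont \<kappa>(2,1) C bd_u \<beta> N\<alpha> u0(1) u_weak H])
  have BV: "balance_law f \<beta> (clamp_to C v) C K \<kappa> u\<^sub>0 H"
    by (rule weak_solution_balance_law[OF f_cont \<kappa>(2,1) C bd_v \<beta> N\<alpha> u0(1) v_weak H])
  interpret U: balance_law f \<beta> "clamp_to C u" C K \<kappa> u\<^sub>0 H by (rule BU)
  interpret V: balance_law f \<beta> "clamp_to C v" C K \<kappa> u\<^sub>0 H by (rule BV)
  have UV: "U.U x t = V.U x t" if "0 \<le> x" for x
    using solution_potential_le[OF der(1) mono l convex BU BV u_weak v_weak bd_u bd_v u_Lax v_Lax u_C1 v_C1 that t]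
      solution_potential_le[OF der(1) mono l convex BV BU v_weak u_weak bd_v bd_u v_Lax u_Lax v_C1 u_C1 that t]
    by simp
  \<comment> \<open>The integrals of \<open>h\<close> over all intervals [0, x] vanish, which forces
    \<open>h\<close> to vanish almost everywhere. The truncation is removed at the end, off the null
    sets where |u| or |v| exceeds C.\<close>
  define h where "h x = clamp_to C u x t - clamp_to C v x t" for x
  have h_int: "h integrable_on {a..b}" for a b
    unfolding h_def by (intro integrable_diff U.u_int V.u_int t)
  have h0: "integral {0..x} h = 0" if x: "0 \<le> x" for x
  proof -
    \<comment> \<open>Equality of the potentials at x = 0 identifies the accumulated boundary
      fluxes, which therefore cancel in the equality at x.\<close>
    have "U.w t * integral {0..x} (\<lambda>y. clamp_to C u y t) = U.w t * integral {0..x} (\<lambda>y. clamp_to C v y t)"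
      using UV[OF x] UV[OF order_refl] by (simp add: U.U_def V.U_def)
    then have "integral {0..x} (\<lambda>y. clamp_to C u y t) = integral {0..x} (\<lambda>y. clamp_to C v y t)"
      using U.w_pos[of t] by simp
    then show ?thesis
      unfolding h_def using Henstock_Kurzweil_Integration.integral_diff[OF U.u_int[OF t] V.u_int[OF t]] by simp
  qed
  have h_zero: "(h has_integral 0) {a..b}" if "0 \<le> a" "a \<le> b" for a b
    using Henstock_Kurzweil_Integration.integral_combine[of 0 a b h] h_int h0[of a] h0[of b] that
    by (simp add: has_integral_integrable_integral)
  have "\<forall>n::nat. \<exists>N. negligible N \<and> (\<forall>x. 0 < x \<longrightarrow> x < real n \<longrightarrow> x \<notin> N \<longrightarrow> h x = 0)"
  proof
    fix n :: nat
    show "\<exists>N. negligible N \<and> (\<forall>x. 0 < x \<longrightarrow> x < real n \<longrightarrow> x \<notin> N \<longrightarrow> h x = 0)"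
    proof (rule ae_zero_if_integrals_zero[of 0 "real n" h])
      show "(h has_integral 0) {a..b}" if "0 \<le> a" "a \<le> b" "b \<le> real n" for a b using h_zero that by simp
      fix N assume "negligible N" "\<And>t. 0 < t \<Longrightarrow> t < real n \<Longrightarrow> t \<notin> N \<Longrightarrow> h t = 0"
      then show ?thesis by (intro exI[of _ N] conjI allI impI)
    qed
  qed
  from choice[OF this] obtain N where N: "\<And>n::nat. negligible (N n)" "\<And>n x. 0 < x \<Longrightarrow> x < real n \<Longrightarrow> x \<notin> N n \<Longrightarrow> h x = 0" by blast
  obtain Nu where Nu: "negligible Nu" "\<forall>x>0. x \<notin> Nu \<longrightarrow> \<bar>u x t\<bar> \<le> C" using bd_u[OF t] by blast
  obtain Nv where Nv: "negligible Nv" "\<forall>x>0. x \<notin> Nv \<longrightarrow> \<bar>v x t\<bar> \<le> C" using bd_v[OF t] by blast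
  have "negligible (\<Union>n. N n)" using N(1) by (intro negligible_Union_nat)
  then have neg: "negligible ((\<Union>n. N n) \<union> Nu \<union> Nv)" using Nu(1) Nv(1) by simp
  have "u x t = v x t" if x: "0 < x" "x \<notin> (\<Union>n. N n) \<union> Nu \<union> Nv" for x
  proof -
    obtain n where "x < real n" using reals_Archimedean2 by blast
    then have "h x = 0" using N(2)[of x n] x by blast
    moreover have "\<bar>u x t\<bar> \<le> C" "\<bar>v x t\<bar> \<le> C" using Nu(2) Nv(2) x by auto
    ultimately show ?thesis using x(1) by (simp add: h_def clamp_to_def abs_le_iff)
  qed
  then have "AE x in lebesgue. x \<in> {0<..} \<longrightarrow> u x t = v x t"
    using neg by (intro AE_I'[of "(\<Union>n. N n) \<union> Nu \<union> Nv"]) (auto simp: negligible_iff_null_sets)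
  then show "AE x in lebesgue_on {0<..}. u x t = v x t" by (simp add: AE_restrict_space_iff)
qed

end
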